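(* Let $W_S$ be a finitely generated Coxeter group that is not virtually abelian, let $V$ be a finite-dimensional real vector space, and let $\rho: W_S \to \mathrm{GL}(V)$ be a representation of $W_S$ as a reflection group. Suppose that $\rho$ is irreducible. (1) If $\rho(W_S)$ preserves a nonzero symmetric bilinear form $f$ on $V$, then the Zariski-closure of $\rho(W_S)$ is the orthogonal group $\mathrm{O}_f(V)$ of $f$. (2) Otherwise, the Zariski-closure of $\rho(W_S)$ is $\mathrm{SL}^\pm(V)=\{g\in\mathrm{GL}(V): \det g=\pm1\}$.
   Context: A Coxeter group $W_S$ is given by a finite set $S$ and a symmetric matrix $(m_{st})_{s,t\in S}$ with $m_{ss}=1$ and $m_{st}\in\{2,3,\dots,\infty\}$ for $s\neq t$; it is the group presented by generators $S$ and relations $(st)^{m_{st}}=1$ whenever $m_{st}<\infty$. A Cartan matrix on $S$ is a real matrix $\mathscr{A}=(\mathscr{A}_{st})_{s,t\in S}$ with $\mathscr{A}_{ss}=2$, $\mathscr{A}_{st}\le 0$ for $s\ne t$, and $\mathscr{A}_{st}=0\iff\mathscr{A}_{ts}=0$. It is compatible with $W_S$ if for all $s\neq t$: $m_{st}=2\iff\mathscr{A}_{st}=0$; $m_{st}<\infty\Rightarrow \mathscr{A}_{st}\mathscr{A}_{ts}=4\cos^2(\pi/m_{st})$; $m_{st}=\infty\Rightarrow\mathscr{A}_{st}\mathscr{A}_{ts}\ge4$. A representation $\rho:W_S\to\mathrm{GL}(V)$ is a representation of $W_S$ as a reflection group if there exist $\alpha_s\in V^*$ and $v_s\in V$ ($s\in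 S$) with $\alpha_s(v_s)=2$ and $\rho(s)(x)=x-\alpha_s(x)v_s$ for all $x\in V$, such that $(\alpha_s(v_t))_{s,t\in S}$ is a Cartan matrix compatible with $W_S$, and such that the convex cone $\bigcap_{s\in S}\{x:\alpha_s(x)\le 0\}$ has nonempty interior. The Zariski-closure is taken in $\mathrm{GL}(V)$ viewed as a real algebraic group. *)

theory Defs
  imports "HOL-Analysis.Analysis" "HOL-Algebra.Generated_Groups" "HOL-Algebra.Coset"
    "HOL-Library.Extended_Nat"
begin

section \<open>Coxeter systems\<close>

text \<open>Coxeter matrix on a finite set S; the value \<infinity> is encoded as enat's \<infinity>.\<close>
definition coxeter_matrix :: "'s set \<Rightarrow> ('s \<Rightarrow> 's \<Rightarrow> enat) \<Rightarrow> bool" where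
  "coxeter_matrix S m \<longleftrightarrow> finite S \<and>
     (\<forall>s\<in>S. \<forall>t\<in>S. m s t = m t s) \<and>
     (\<forall>s\<in>S. m s s = 1) \<and>
     (\<forall>s\<in>S. \<forall>t\<in>S. s \<noteq> t \<longrightarrow> m s t \<ge> 2)"

text \<open>The relator (s t)^k as a word.\<close>
definition alt_word :: "'s \<Rightarrow> 's \<Rightarrow> nat \<Rightarrow> 's list" where
  "alt_word s t k = concat (replicate k [s, t])"

definition coxeter_relators :: "'s set \<Rightarrow> ('s \<Rightarrow> 's \<Rightarrow> enat) \<Rightarrow> 's list set" where
  "coxeter_relators S m = {alt_word s t k | s t k. s \<in> S \<and> t \<in> S \<and> m s t = enat k}"

text \<open>The congruence on words generated by deleting/inserting relators.\<close>
inductive word_eq :: "'s list set \<Rightarrow> 's list \<Rightarrow> 's list \<Rightarrow> bool" for R where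
  refl: "word_eq R w w"
| sym: "word_eq R u w \<Longrightarrow> word_eq R w u"
| trans: "word_eq R u v \<Longrightarrow> word_eq R v w \<Longrightarrow> word_eq R u w"
| del: "r \<in> R \<Longrightarrow> word_eq R (u @ r @ v) (u @ v)"

definition word_val :: "('w, 'z) monoid_scheme \<Rightarrow> ('s \<Rightarrow> 'w) \<Rightarrow> 's list \<Rightarrow> 'w" where
  "word_val W gen w = foldr (\<lambda>s acc. gen s \<otimes>\<^bsub>W\<^esub> acc) w \<one>\<^bsub>W\<^esub>"

text \<open>(W, gen) is the Coxeter group W_S given by the presentation
  \<langle>S | (st)^{m_st} = 1 for m_st < \<infinity>\<rangle>: W is generated by gen`S, the relations hold,
  and every word over S with trivial value is a consequence of the relations.\<close>
definition coxeter_group :: "('w, 'z) monoid_scheme \<Rightarrow> 's set \<Rightarrow> ('s \<Rightarrow> 's \<Rightarrow> enat) \<Rightarrow> ('s \<Rightarrow> 'w) \<Rightarrow> bool" where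
  "coxeter_group W S m gen \<longleftrightarrow> group W \<and> coxeter_matrix S m \<and>
     gen ` S \<subseteq> carrier W \<and>
     generate W (gen ` S) = carrier W \<and>
     (\<forall>r\<in>coxeter_relators S m. word_val W gen r = \<one>\<^bsub>W\<^esub>) \<and>
     (\<forall>w\<in>lists S. word_val W gen w = \<one>\<^bsub>W\<^esub> \<longrightarrow> word_eq (coxeter_relators S m) w [])"

definition virtually_abelian :: "('w, 'z) monoid_scheme \<Rightarrow> bool" where
  "virtually_abelian W \<longleftrightarrow> (\<exists>H. subgroup H W \<and> finite (rcosets\<^bsub>W\<^esub> H) \<and>
     (\<forall>x\<in>H. \<forall>y\<in>H. x \<otimes>\<^bsub>W\<^esub> y = y \<otimes>\<^bsub>W\<^esub> x))"

section \<open>GL(V) for V = R^n\<close>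

definition GL :: "(real^'n^'n) monoid" where
  "GL = \<lparr>carrier = {A. invertible A}, mult = (**), one = mat 1\<rparr>"

section \<open>Reflection representations\<close>

text \<open>Cartan matrix A (A s t = alpha_s(v_t)) compatible with the Coxeter matrix m.\<close>
definition compatible_cartan :: "'s set \<Rightarrow> ('s \<Rightarrow> 's \<Rightarrow> enat) \<Rightarrow> ('s \<Rightarrow> 's \<Rightarrow> real) \<Rightarrow> bool" where
  "compatible_cartan S m A \<longleftrightarrow>
     (\<forall>s\<in>S. A s s = 2) \<and>
     (\<forall>s\<in>S. \<forall>t\<in>S. s \<noteq> t \<longrightarrow>
        A s t \<le> 0 \<and> (A s t = 0 \<longleftrightarrow> A t s = 0) \<and>
        (m s t = 2 \<longleftrightarrow> A s t = 0) \<and>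
        (\<forall>k. m s t = enat k \<longrightarrow> A s t * A t s = 4 * (cos (pi / real k))\<^sup>2) \<and>
        (m s t = \<infinity> \<longrightarrow> A s t * A t s \<ge> 4))"

text \<open>Linear forms alpha_s on V = R^n are represented by vectors via the inner product.\<close>
definition reflection_rep ::
  "('w, 'z) monoid_scheme \<Rightarrow> 's set \<Rightarrow> ('s \<Rightarrow> 's \<Rightarrow> enat) \<Rightarrow> ('s \<Rightarrow> 'w)
    \<Rightarrow> ('w \<Rightarrow> real^'n^'n) \<Rightarrow> bool" where
  "reflection_rep W S m gen \<rho> \<longleftrightarrow> \<rho> \<in> hom W GL \<and>
     (\<exists>(\<alpha> :: 's \<Rightarrow> real^'n) (v :: 's \<Rightarrow> real^'n).
        (\<forall>s\<in>S. \<alpha> s \<bullet> v s = 2) \<and>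
        (\<forall>s\<in>S. \<forall>x. \<rho> (gen s) *v x = x - (\<alpha> s \<bullet> x) *\<^sub>R v s) \<and>
        compatible_cartan S m (\<lambda>s t. \<alpha> s \<bullet> v t) \<and>
        interior {x. \<forall>s\<in>S. \<alpha> s \<bullet> x \<le> 0} \<noteq> {})"

definition irreducible_rep :: "('w, 'z) monoid_scheme \<Rightarrow> ('w \<Rightarrow> real^'n^'n) \<Rightarrow> bool" where
  "irreducible_rep W \<rho> \<longleftrightarrow> (\<forall>U. subspace U \<and> (\<forall>g\<in>carrier W. \<forall>x\<in>U. \<rho> g *v x \<in> U)
      \<longrightarrow> U = {0} \<or> U = UNIV)"

section \<open>Bilinear forms, classical groups, Zariski closure\<close>

text \<open>A bilinear form f on R^n is represented by its Gram matrix B: f(x,y) = x \<bullet> (B *v y).\<close>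
definition preserves_form :: "real^'n^'n \<Rightarrow> real^'n^'n \<Rightarrow> bool" where
  "preserves_form B g \<longleftrightarrow> transpose g ** B ** g = B"

definition orth_group :: "real^'n^'n \<Rightarrow> (real^'n^'n) set" where
  "orth_group B = {g. invertible g \<and> preserves_form B g}"

definition SL_pm :: "(real^'n^'n) set" where
  "SL_pm = {g. invertible g \<and> (det g = 1 \<or> det g = -1)}"

text \<open>Polynomial functions in the matrix entries.\<close>
inductive_set mat_poly :: "(real^'n^'n \<Rightarrow> real) set" where
  const: "(\<lambda>_. c) \<in> mat_poly"
| coord: "(\<lambda>A. A $ i $ j) \<in> mat_poly"
| add: "p \<in> mat_poly \<Longrightarrow> q \<in> mat_poly \<Longrightarrow> (\<lambda>A. p A + q A) \<in> mat_poly"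
| mult: "p \<in> mat_poly \<Longrightarrow> q \<in> mat_poly \<Longrightarrow> (\<lambda>A. p A * q A) \<in> mat_poly"

text \<open>Zariski closure in GL(V) (regular functions on GL are p/det^k; their zero sets
  on GL coincide with those of the polynomials p).\<close>
definition zariski_closure_GL :: "(real^'n^'n) set \<Rightarrow> (real^'n^'n) set" where
  "zariski_closure_GL G = {g. invertible g \<and>
     (\<forall>p\<in>mat_poly. (\<forall>h\<in>G. p h = 0) \<longrightarrow> p g = 0)}"

end

(*
Let \<Gamma> be the image of the representation. The idea is to bound polynomial degrees: for each d, the matrices X
such that differentiation along the left invariant field A \<mapsto> A X preserves the polynomials of degree at most d
vanishing on \<Gamma> form a Lie algebra g, normalised by \<Gamma>.

By the theorem of Tits and Vinberg \<rho> is faithful, so \<Gamma> is not virtually abelian. Hence the products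
\<alpha>(w) \<beta>(v), taken over pairs of reflections 1 - v \<otimes> \<alpha> and 1 - w \<otimes> \<beta> in \<Gamma>, are infinite in number:
otherwise \<Gamma> would contain finitely many reflections only. So some two reflections generate a dihedral group too
large for polynomials of degree d to distinguish it from its closure, and g contains a nonscalar element.

If g acted reducibly, V would split into weight lines permuted by \<Gamma>, and \<Gamma> would be virtually abelian. If g acts
irreducibly, let V = <v> + H be the decomposition given by a reflection in \<Gamma>. The -1 eigenspace of the
reflection on g is a subspace N of H + H* that projects onto both factors and is closed under triple brackets. These
force N to be either H + H* or the graph of a symmetric isomorphism H \<rightarrow> H*. In the first case g = sl(V); in the
second case g = so(f) for a form f invariant under \<Gamma>. Integrating g along rational curves yields all
transvections, respectively all reflections of f, and these generate SL(V), respectively O(f).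
*)

theory Submission
  imports Defs
begin

section \<open>Reflections as matrices\<close>

text \<open>The alternative between all traceless matrices and an orthogonal algebra is settled
  separately for each d, and the outcome is not compared between degrees. For small d the first
  alternative can hold although a form is preserved, because polynomials of low degree need not
  detect it. The conclusion absorbs this: a preserved form is nondegenerate by irreducibility, so
  its isometries have determinant 1 or -1 and are reached in the first alternative too; in the
  second one, the form found must be proportional to the given one.

  Irreducibility over the reals alone yields no eigenvectors. The reflections supply them: a matrix
  commuting with v \<otimes> \<alpha> has v as an eigenvector, and a subspace that meets the fixed
  hyperplane trivially is at most a line. Hence all arguments stay over the reals.

  The cone provides the point whose orbit shows faithfulness, and faithfulness carries commutation
  of matrices back to the Coxeter group; this is how finiteness of the reflections, or an invariant
  system of lines, contradicts the assumption on the group.\<close>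

definition outer :: "real^'n \<Rightarrow> real^'n \<Rightarrow> real^'n^'n" where
  "outer u a = (\<chi> i j. u $ i * a $ j)"

definition refl_mat :: "real^'n \<Rightarrow> real^'n \<Rightarrow> real^'n^'n" where
  "refl_mat a v = mat 1 - outer v a"

lemma outer_mult_vec [simp]: "outer u a *v x = (a \<bullet> x) *\<^sub>R u"
  by (simp add: vec_eq_iff outer_def matrix_vector_mult_def inner_vec_def sum_distrib_left mult_ac)

lemma refl_mat_mult_vec: "refl_mat a v *v x = x - (a \<bullet> x) *\<^sub>R v"
  by (simp add: refl_mat_def matrix_vector_mult_diff_rdistrib)

lemma inner_matrix_transpose: "(A *v x) \<bullet> y = x \<bullet> (transpose (A::real^'n^'n) *v y)"
  by (metis dot_lmul_matrix inner_commute transpose_matrix_vector)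

lemma transpose_diff: "transpose (A - B) = transpose A - transpose (B::real^'n^'m)"
  by (simp add: vec_eq_iff transpose_def)

lemma transpose_add: "transpose (A + B) = transpose A + transpose (B::real^'n^'m)"
  by (simp add: vec_eq_iff transpose_def)

lemma transpose_outer [simp]: "transpose (outer u a) = outer a u"
  by (simp add: vec_eq_iff transpose_def outer_def mult_ac)

lemma transpose_refl_mat: "transpose (refl_mat a v) = refl_mat v a"
  by (simp add: refl_mat_def transpose_diff transpose_mat)

lemma matrix_mult_outer: "A ** outer u a = outer (A *v u) a"
  by (simp add: matrix_eq matrix_vector_mul_assoc[symmetric] matrix_vector_mult_scaleR)

lemma outer_matrix_mult: "outer u a ** A = outer u (a v* A)"
  by (simp add: matrix_eq matrix_vector_mul_assoc[symmetric] dot_lmul_matrix)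

lemma outer_add_left: "outer (u + w) a = outer u a + outer w a"
  and outer_add_right: "outer u (a + b) = outer u a + outer u b"
  and outer_diff_left: "outer (u - w) a = outer u a - outer w a"
  and outer_diff_right: "outer u (a - b) = outer u a - outer u b"
  and outer_scaleR_left: "outer (c *\<^sub>R u) a = c *\<^sub>R outer u a"
  and outer_scaleR_right: "outer u (c *\<^sub>R a) = c *\<^sub>R outer u a"
  and outer_minus_left: "outer (- u) a = - outer u a"
  and outer_minus_right: "outer u (- a) = - outer u a"
  and outer_0_left: "outer 0 a = 0"
  and outer_0_right: "outer u 0 = 0"
  by (simp_all add: vec_eq_iff outer_def algebra_simps)

lemmas outer_linear = outer_add_left outer_add_right outer_diff_left outer_diff_right
  outer_scaleR_left outer_scaleR_right outer_minus_left outer_minus_right outer_0_left outer_0_right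

lemma trace_outer: "trace (outer u a) = a \<bullet> u"
  by (simp add: trace_def outer_def inner_vec_def mult_ac)

lemma trace_scaleR: "trace (c *\<^sub>R (A::real^'n^'n)) = c * trace A"
  by (simp add: trace_def sum_distrib_left)

lemma matrix_scaleR_mult: "(c *\<^sub>R A) ** (B::real^'n^'n) = c *\<^sub>R (A ** B)"
  by (simp add: scalar_matrix_assoc)

lemma matrix_mult_scaleR: "A ** (c *\<^sub>R (B::real^'n^'n)) = c *\<^sub>R (A ** B)"
  by (simp add: matrix_scalar_ac matrix_scaleR_mult)

lemma matrix_diff_ldistrib: "A ** (B - C) = A ** B - A ** (C::real^'n^'n)"
  and matrix_diff_rdistrib: "(A - B) ** C = A ** C - B ** (C::real^'n^'n)"
  and matrix_plus_ldistrib: "A ** (B + C) = A ** B + A ** (C::real^'n^'n)"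
  and matrix_plus_rdistrib: "(A + B) ** C = A ** C + B ** (C::real^'n^'n)"
  by (simp_all add: vec_eq_iff matrix_matrix_mult_def algebra_simps sum.distrib sum_subtractf)

lemmas matrix_distrib = matrix_diff_ldistrib matrix_diff_rdistrib matrix_plus_ldistrib
  matrix_plus_rdistrib matrix_scaleR_mult matrix_mult_scaleR

lemma refl_mat_square: "a \<bullet> v = 2 \<Longrightarrow> refl_mat a v ** refl_mat a v = mat 1"
  by (simp add: matrix_eq matrix_vector_mul_assoc[symmetric] refl_mat_mult_vec algebra_simps scaleR_2)

lemma refl_mat_involutive: "a \<bullet> v = 2 \<Longrightarrow> refl_mat a v *v (refl_mat a v *v x) = x"
  by (simp add: matrix_vector_mul_assoc refl_mat_square)

lemma refl_mat_conj:
  assumes "a \<bullet> v = 2"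
  shows "refl_mat a v ** refl_mat b w ** refl_mat a v
    = refl_mat (b - (b \<bullet> v) *\<^sub>R a) (w - (a \<bullet> w) *\<^sub>R v)"
  using assms
  by (simp add: matrix_eq matrix_vector_mul_assoc[symmetric] refl_mat_mult_vec inner_diff_left
      inner_diff_right algebra_simps) (simp add: scaleR_scaleR[symmetric] scaleR_2 del: scaleR_scaleR)

lemma det_id_replace_column: "det (\<chi> i j. if j = k then x $ i else (mat 1::real^'n^'n) $ i $ j) = x $ k"
  using cramer_lemma[of k "mat 1 :: real^'n^'n" x] by (simp only: matrix_vector_mul_lid det_I mult_1_right)

text \<open>In the coordinates given by P, the identity with row k replaced by \<open>a\<close>, the
  functional \<open>a\<close> becomes the k-th coordinate. The matrix then differs from the identity
  in column k only, where Cramer's rule gives the determinant.\<close>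

lemma det_id_plus_outer: "det (mat 1 + outer z a) = 1 + a \<bullet> (z::real^'n)"
proof (cases "a = 0")
  case True
  then show ?thesis by (simp add: outer_linear)
next
  case False
  then obtain k where k: "a $ k \<noteq> 0" by (metis vec_eq_iff zero_index)
  define P :: "real^'n^'n" where "P = (\<chi> i j. if i = k then a $ j else (mat 1::real^'n^'n) $ i $ j)"
  have "transpose P = (\<chi> i j. if j = k then a $ i else (mat 1::real^'n^'n) $ i $ j)"
    by (simp add: P_def transpose_def vec_eq_iff mat_def)
  then have detP: "det P \<noteq> 0"
    using det_id_replace_column[of k a] k by (metis det_transpose)
  then have "invertible P" by (simp add: invertible_det_nz)
  then obtain Q where Q: "P ** Q = mat 1" "Q ** P = mat 1" unfolding invertible_def by blast
  have Pk: "transpose P *v axis k 1 = a"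
    by (simp add: P_def transpose_def vec_eq_iff matrix_vector_mult_def axis_def if_distrib cong: if_cong)
  have Pz: "(P *v z) $ k = a \<bullet> z"
    by (simp add: P_def matrix_vector_mult_def inner_vec_def)
  have tQ: "a v* Q = axis k 1"
    using Q(1) Pk by (metis matrix_transpose_mul matrix_vector_mul_assoc matrix_vector_mul_lid transpose_mat transpose_matrix_vector)
  have "P ** (mat 1 + outer z a) ** Q = mat 1 + outer (P *v z) (axis k 1)"
    by (simp add: matrix_distrib Q tQ matrix_mult_outer outer_matrix_mult)
  also have "\<dots> = (\<chi> i j. if j = k then (axis k 1 + P *v z) $ i else (mat 1::real^'n^'n) $ i $ j)"
    by (auto simp: vec_eq_iff outer_def axis_def mat_def)
  finally have "det (P ** (mat 1 + outer z a) ** Q) = 1 + a \<bullet> z"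
    using det_id_replace_column[of k "axis k 1 + P *v z"] Pz by (simp add: axis_def)
  moreover have "det (P ** (mat 1 + outer z a) ** Q) = det (mat 1 + outer z a) * det (P ** Q)"
    by (simp add: det_mul)
  ultimately show ?thesis using Q by simp
qed

lemma det_refl_mat: "a \<bullet> v = 2 \<Longrightarrow> det (refl_mat a v) = - 1"
  using det_id_plus_outer[of "- v" a] by (simp add: refl_mat_def outer_linear)

section \<open>Faithfulness of reflection representations\<close>

fun alternating :: "nat \<Rightarrow> 'a \<Rightarrow> 'a \<Rightarrow> 'a list" where
  "alternating 0 s t = []"
| "alternating (Suc k) s t = s # alternating k t s"

lemma length_alternating [simp]: "length (alternating k s t) = k"
  by (induction k s t rule: alternating.induct) auto

lemma set_alternating: "set (alternating k s t) \<subseteq> {s, t}"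
  by (induction k s t rule: alternating.induct) auto

lemma alternating_add: "alternating (j + k) s t
    = alternating j s t @ (if even j then alternating k s t else alternating k t s)"
  by (induction j s t rule: alternating.induct) auto

lemma alternating_Suc_right: "alternating (Suc k) s t = alternating k s t @ [if even k then s else t]"
  using alternating_add[of k 1 s t] by auto

lemma rev_alternating: "rev (alternating k s t) = (if even k then alternating k t s else alternating k s t)"
proof (induction k s t rule: alternating.induct)
  case (2 k s t)
  have "rev (alternating (Suc k) s t) = rev (alternating k t s) @ [s]" by simp
  also have "\<dots> = (if even k then alternating k s t else alternating k t s) @ [s]" using 2 by simp
  also have "\<dots> = (if even (Suc k) then alternating (Suc k) t s else alternating (Suc k) s t)"
    unfolding alternating_Suc_right by simp
  finally show ?case .
qed simp

lemma alt_word_eq_alternating: "alt_word s t k = alternating (2 * k) s t"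
  by (induction k) (auto simp: alt_word_def)

lemma alternating_if_no_repetition:
  assumes "set u \<subseteq> {s, t}" "u = [] \<or> hd u = t" "\<And>x p q. u \<noteq> p @ [x, x] @ q"
  shows "u = alternating (length u) t s"
  using assms
proof (induction u arbitrary: s t)
  case (Cons x u)
  have x: "x = t" using Cons.prems by simp
  have *: "u = [] \<or> hd u = s"
  proof (cases u)
    case (Cons y u')
    have "y \<noteq> x" using Cons.prems(3)[of "[]" x u'] Cons by auto
    then show ?thesis using Cons.prems(1) x Cons by auto
  qed simp
  have "u = alternating (length u) s t"
  proof (rule Cons.IH)
    show "set u \<subseteq> {t, s}" using Cons.prems by auto
    show "u \<noteq> p @ [y, y] @ q" for y p q using Cons.prems(3)[of "x # p" y q] by auto
  qed (use * in auto)
  then show ?case using x by simp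
qed simp

text \<open>For finite m the recurrence is solved by sin (k \<theta>) / sin \<theta> with \<theta> =
  \<pi> / m, which is nonnegative up to k = m. For infinite m the constant C is at least 2, and the
  increments of e stay at least 1.\<close>

lemma chebyshev_nonneg:
  fixes a b :: real and m :: enat
  assumes "a \<ge> 0" "b \<ge> 0" "a = 0 \<longleftrightarrow> b = 0" "m \<ge> 2"
    and fin: "\<And>k. m = enat k \<Longrightarrow> a * b = 4 * (cos (pi / real k))\<^sup>2"
    and inf: "m = \<infinity> \<Longrightarrow> a * b \<ge> 4"
  obtains C r :: real and e :: "nat \<Rightarrow> real" where "r > 0" "a = r * C" "b * r = C" "e 0 = 0" "e (Suc 0) = 1"
    "\<And>k. e (Suc (Suc k)) = C * e (Suc k) - e k"
    "\<And>k. enat k \<le> m \<Longrightarrow> e k \<ge> 0" "\<And>k. 0 < k \<Longrightarrow> enat k < m \<Longrightarrow> e k > 0"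
proof -
  define C where "C = sqrt (a * b)"
  \<comment> \<open>Rescaling one of the two roots by r makes the Cartan matrix symmetric with
    off-diagonal entries -C. If \<open>a = 0\<close>, both entries vanish and any positive r
    serves.\<close>
  define r where "r = (if a = 0 then 1 else a / C)"
  have C0: "C \<ge> 0" using assms by (simp add: C_def)
  have CC: "C * C = a * b" using assms by (simp add: C_def)
  have Cz: "a \<noteq> 0 \<Longrightarrow> C > 0" using assms by (simp add: C_def)
  have r0: "r > 0" using Cz assms by (auto simp: r_def)
  have ra: "a = r * C"
    using Cz CC by (cases "a = 0") (auto simp: r_def C_def)
  have rb: "b * r = C"
  proof (cases "a = 0")
    case True then show ?thesis using assms by (simp add: r_def C_def)
  next
    case False
    have "b * (a / C) = C" using CC Cz[OF False] by (simp add: field_simps)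
    then show ?thesis using False by (simp add: r_def)
  qed
  show thesis
  proof (cases m)
    case (enat M)
    have M2: "M \<ge> 2" using assms(4) enat by (simp add: numeral_eq_enat)
    define th where "th = pi / real M"
    have th: "0 < th" "th \<le> pi / 2" using M2 by (auto simp: th_def field_simps)
    have c0: "cos th \<ge> 0" using th by (intro cos_ge_zero) auto
    have sn: "sin th > 0" using th by (intro sin_gt_zero) (auto intro: le_less_trans)
    have C: "C = 2 * cos th"
    proof -
      have "a * b = (2 * cos th)\<^sup>2" using fin[OF enat] by (simp add: th_def power2_eq_square)
      then have "C = \<bar>2 * cos th\<bar>" unfolding C_def by (simp only: real_sqrt_abs)
      then show ?thesis using c0 by simp
    qed
    define e where "e k = sin (real k * th) / sin th" for k :: nat
    show thesis
    proof (rule that[OF r0 ra rb])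
      show "e 0 = 0" "e (Suc 0) = 1" using sn by (auto simp: e_def)
      show "e (Suc (Suc k)) = C * e (Suc k) - e k" for k
      proof -
        have "sin (real (Suc k) * th + th) + sin (real (Suc k) * th - th) = 2 * cos th * sin (real (Suc k) * th)"
          by (simp add: sin_add sin_diff)
        then have "sin (real (Suc (Suc k)) * th) + sin (real k * th) = C * sin (real (Suc k) * th)"
          by (simp add: C algebra_simps)
        then show ?thesis using sn by (simp add: e_def field_simps)
      qed
      have le: "real k * th \<le> pi" if "k \<le> M" for k
        using that M2 by (simp add: th_def field_simps)
      show "e k \<ge> 0" if "enat k \<le> m" for k
        using that enat le[of k] sn th by (auto simp: e_def intro!: sin_ge_zero divide_nonneg_pos)
      show "e k > 0" if "0 < k" "enat k < m" for k
      proof -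
        have "real k * th < pi" using that enat M2 by (simp add: th_def field_simps)
        then show ?thesis using that sn th by (auto simp: e_def intro!: sin_gt_zero divide_pos_pos)
      qed
    qed
  next
    case infinity
    have C2: "C \<ge> 2"
      using inf[OF infinity] real_sqrt_le_mono[of 4 "a * b"] by (simp add: C_def)
    define g where "g = rec_nat (0::real, 1::real) (\<lambda>_ (x, y). (y, C * y - x))"
    define e where "e k = fst (g k)" for k
    have g: "g (Suc k) = (snd (g k), C * snd (g k) - fst (g k))" for k
      by (simp add: g_def split_beta)
    have e0: "e 0 = 0" "e (Suc 0) = 1" by (simp_all add: e_def g_def)
    have es: "e (Suc (Suc k)) = C * e (Suc k) - e k" for k
      by (simp add: e_def g)
    have mono: "e k \<ge> 0 \<and> e (Suc k) \<ge> e k + 1" for k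
    proof (induction k)
      case (Suc k)
      have "2 * e (Suc k) \<le> C * e (Suc k)" using C2 Suc by (intro mult_right_mono) auto
      then show ?case using Suc unfolding es by linarith
    qed (simp add: e0)
    show thesis
    proof (rule that[OF r0 ra rb e0 es])
      show "e k \<ge> 0" for k using mono by blast
      show "e k > 0" if "0 < k" for k using mono[of "k - 1"] that by simp
    qed
  qed
qed

section \<open>Word length and the separation of chambers by walls\<close>

locale coxeter_reflections = group W for W (structure) +
  fixes S :: "'s set" and m :: "'s \<Rightarrow> 's \<Rightarrow> enat" and gen :: "'s \<Rightarrow> 'a"
    and \<rho> :: "'a \<Rightarrow> real^'n^'n" and \<alpha> v :: "'s \<Rightarrow> real^'n" and x0 :: "real^'n"
  assumes cox: "coxeter_matrix S m"
    and gen_closed: "\<And>s. s \<in> S \<Longrightarrow> gen s \<in> carrier W"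
    and generated: "generate W (gen ` S) = carrier W"
    and relation: "\<And>s t k. s \<in> S \<Longrightarrow> t \<in> S \<Longrightarrow> m s t = enat k \<Longrightarrow> word_val W gen (alt_word s t k) = \<one>"
    and hom: "\<rho> \<in> hom W GL"
    and pairing: "\<And>s. s \<in> S \<Longrightarrow> \<alpha> s \<bullet> v s = 2"
    and \<rho>_gen: "\<And>s. s \<in> S \<Longrightarrow> \<rho> (gen s) = refl_mat (\<alpha> s) (v s)"
    and cartan: "compatible_cartan S m (\<lambda>s t. \<alpha> s \<bullet> v t)"
    and x0: "\<And>s. s \<in> S \<Longrightarrow> \<alpha> s \<bullet> x0 < 0"
begin

abbreviation val :: "'s list \<Rightarrow> 'a" where "val \<equiv> word_val W gen"

lemma val_Nil [simp]: "val [] = \<one>" and val_Cons [simp]: "val (s # u) = gen s \<otimes> val u"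
  by (simp_all add: word_val_def)

lemma val_closed [simp]: "set u \<subseteq> S \<Longrightarrow> val u \<in> carrier W"
  by (induction u) (auto simp: gen_closed)

lemma val_append: "set u \<subseteq> S \<Longrightarrow> set w \<subseteq> S \<Longrightarrow> val (u @ w) = val u \<otimes> val w"
  by (induction u) (auto simp: gen_closed m_assoc)

lemma gen_square: assumes "s \<in> S" shows "gen s \<otimes> gen s = \<one>"
proof -
  have "m s s = enat 1" using cox assms by (simp add: coxeter_matrix_def one_enat_def)
  from relation[OF assms assms this] show ?thesis using assms
    by (simp add: alt_word_def gen_closed)
qed

lemma inv_gen: "s \<in> S \<Longrightarrow> inv (gen s) = gen s"
  using gen_square gen_closed inv_equality by blast

lemma gen_gen_mult: "s \<in> S \<Longrightarrow> x \<in> carrier W \<Longrightarrow> gen s \<otimes> (gen s \<otimes> x) = x"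
  using gen_closed gen_square by (simp add: m_assoc[symmetric])

lemma val_rev: "set u \<subseteq> S \<Longrightarrow> val (rev u) = inv (val u)"
  by (induction u) (auto simp: val_append gen_closed inv_mult_group inv_gen)

lemma val_surj: assumes "w \<in> carrier W" obtains u where "set u \<subseteq> S" "val u = w"
proof -
  have "w \<in> generate W (gen ` S)" using assms generated by simp
  then have "\<exists>u. set u \<subseteq> S \<and> val u = w"
  proof induction
    case one show ?case by (rule exI[of _ "[]"]) simp
  next
    case (incl h)
    then obtain s where "s \<in> S" "h = gen s" by blast
    then show ?case by (intro exI[of _ "[s]"]) (auto simp: gen_closed)
  next
    case (inv h)
    then obtain s where "s \<in> S" "h = gen s" by blast
    then show ?case by (intro exI[of _ "[s]"]) (auto simp: gen_closed inv_gen)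
  next
    case (eng h1 h2)
    then obtain u1 u2 where "set u1 \<subseteq> S" "val u1 = h1" "set u2 \<subseteq> S" "val u2 = h2" by blast
    then show ?case by (intro exI[of _ "u1 @ u2"]) (auto simp: val_append)
  qed
  then show thesis using that by blast
qed

lemma \<rho>_mult: "x \<in> carrier W \<Longrightarrow> y \<in> carrier W \<Longrightarrow> \<rho> (x \<otimes> y) = \<rho> x ** \<rho> y"
  using hom by (simp add: hom_def GL_def)

lemma \<rho>_invertible: "x \<in> carrier W \<Longrightarrow> invertible (\<rho> x)"
  using hom by (auto simp: hom_def GL_def)

lemma \<rho>_one: "\<rho> \<one> = mat 1"
proof -
  have "\<rho> \<one> ** \<rho> \<one> = \<rho> \<one>" using \<rho>_mult[of \<one> \<one>] by simp
  moreover obtain B where "B ** \<rho> \<one> = mat 1" using \<rho>_invertible[of \<one>] unfolding invertible_def by auto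
  ultimately show ?thesis by (metis matrix_mul_assoc matrix_mul_lid)
qed

lemma det_\<rho>_val: "set u \<subseteq> S \<Longrightarrow> det (\<rho> (val u)) = (- 1) ^ length u"
  by (induction u) (auto simp: \<rho>_one \<rho>_mult gen_closed det_mul \<rho>_gen det_refl_mat pairing)

definition len :: "'a \<Rightarrow> nat" where
  "len w = (LEAST n. \<exists>u. set u \<subseteq> S \<and> length u = n \<and> val u = w)"

lemma len_le: "set u \<subseteq> S \<Longrightarrow> len (val u) \<le> length u"
  unfolding len_def by (rule Least_le) blast

lemma reduced_word:
  assumes "w \<in> carrier W" obtains u where "set u \<subseteq> S" "length u = len w" "val u = w"
proof -
  obtain u0 where "set u0 \<subseteq> S" "val u0 = w" using val_surj[OF assms] .
  then have "\<exists>n u. set u \<subseteq> S \<and> length u = n \<and> val u = w" by blast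
  from LeastI_ex[OF this] have "\<exists>u. set u \<subseteq> S \<and> length u = len w \<and> val u = w"
    unfolding len_def .
  then show thesis using that by blast
qed

lemma len_mult_le: assumes "set u \<subseteq> S" "y \<in> carrier W" shows "len (val u \<otimes> y) \<le> length u + len y"
proof -
  obtain w where "set w \<subseteq> S" "length w = len y" "val w = y" using reduced_word[OF assms(2)] .
  then show ?thesis using len_le[of "u @ w"] assms by (simp add: val_append)
qed

text \<open>Every generator acts with determinant -1, so the parity of the length can be read off
  from the determinant.\<close>

lemma len_gen_neq: assumes "s \<in> S" "w \<in> carrier W" shows "len (gen s \<otimes> w) \<noteq> len w"
proof
  assume eq: "len (gen s \<otimes> w) = len w"
  obtain u where u: "set u \<subseteq> S" "length u = len w" "val u = w" using reduced_word[OF assms(2)] .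
  obtain u' where u': "set u' \<subseteq> S" "length u' = len w" "val u' = gen s \<otimes> w"
    using reduced_word[of "gen s \<otimes> w"] assms eq gen_closed by (metis m_closed)
  have "det (\<rho> (val u')) = - det (\<rho> (val u))"
    using u u' assms by (simp add: \<rho>_mult gen_closed det_mul \<rho>_gen det_refl_mat pairing)
  then have "(- 1 :: real) ^ len w = - ((- 1) ^ len w)" using u u' det_\<rho>_val by metis
  then show False by simp
qed

text \<open>Cut the relator, an alternating word of length 2k, in the middle. Generators are
  involutions, so the inverse of the second half is its reversal, which is the other alternating
  word.\<close>

lemma braid:
  assumes "s \<in> S" "t \<in> S" "m s t = enat k"
  shows "val (alternating k s t) = val (alternating k t s)"
proof -
  define z where "z = (if even k then alternating k s t else alternating k t s)"
  have sub: "set (alternating k s t) \<subseteq> S" "set (alternating k t s) \<subseteq> S" "set z \<subseteq> S"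
    using assms set_alternating[of k s t] set_alternating[of k t s] by (auto simp: z_def)
  have "alternating (2 * k) s t = alternating k s t @ z"
    using alternating_add[of k k s t] by (simp add: mult_2 z_def)
  then have "val (alternating k s t) \<otimes> val z = \<one>"
    using relation[OF assms] sub by (simp add: alt_word_eq_alternating val_append)
  then have "val (alternating k s t) = inv (val z)"
    using sub by (metis inv_equality inv_inv val_closed)
  also have "\<dots> = val (rev z)" using sub by (simp add: val_rev)
  also have "rev z = alternating k t s" by (auto simp: z_def rev_alternating)
  finally show ?thesis .
qed

text \<open>Pulling \<alpha>_s back along the word gives the coefficients e k and e (k + 1), one of
  them multiplied by r; parity decides which belongs to which root. The word begins with t and is
  shorter than m, so s stays an ascent and both signs are right.\<close>

lemma dihedral_coefficients:
  assumes s: "s \<in> S" and t: "t \<in> S" and st: "s \<noteq> t" and k: "enat k < m s t"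
  obtains c d where "c \<ge> 0" "d \<ge> 0" "c + d > 0"
    "\<And>x. \<alpha> s \<bullet> (\<rho> (val (alternating k t s)) *v x) = c * (\<alpha> s \<bullet> x) + d * (\<alpha> t \<bullet> x)"
proof -
  define a where "a = - (\<alpha> s \<bullet> v t)"
  define b where "b = - (\<alpha> t \<bullet> v s)"
  have mm: "m s t \<ge> 2" using cox s t st by (simp add: coxeter_matrix_def)
  have ab: "a \<ge> 0" "b \<ge> 0" "a = 0 \<longleftrightarrow> b = 0" "m s t \<ge> 2"
    "\<And>k. m s t = enat k \<Longrightarrow> a * b = 4 * (cos (pi / real k))\<^sup>2" "m s t = \<infinity> \<Longrightarrow> a * b \<ge> 4"
    using cartan s t st cox unfolding compatible_cartan_def a_def b_def coxeter_matrix_def by auto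
  obtain C r e where E: "r > 0" "a = r * C" "b * r = C" "e 0 = (0::real)" "e (Suc 0) = 1"
    "\<And>k. e (Suc (Suc k)) = C * e (Suc k) - e k"
    "\<And>k. enat k \<le> m s t \<Longrightarrow> e k \<ge> 0" "\<And>k. 0 < k \<Longrightarrow> enat k < m s t \<Longrightarrow> e k > 0"
    by (rule chebyshev_nonneg[OF ab]) (use that in blast)+
  have main: "\<alpha> s \<bullet> (\<rho> (val (alternating j t s)) *v x) =
     (if even j then e (Suc j) * (\<alpha> s \<bullet> x) + r * e j * (\<alpha> t \<bullet> x)
      else e j * (\<alpha> s \<bullet> x) + r * e (Suc j) * (\<alpha> t \<bullet> x))" for j x
  proof (induction j arbitrary: x)
    case 0 then show ?case by (simp add: \<rho>_one E)
  next
    case (Suc j)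
    define y where "y = (if even j then t else s)"
    have y: "y \<in> S" using s t by (simp add: y_def)
    have sub: "set (alternating j t s) \<subseteq> S" using set_alternating[of j t s] s t by auto
    have "\<rho> (val (alternating (Suc j) t s)) *v x
      = \<rho> (val (alternating j t s)) *v (x - (\<alpha> y \<bullet> x) *\<^sub>R v y)"
      unfolding alternating_Suc_right using sub y
      by (simp add: val_append \<rho>_mult gen_closed \<rho>_gen matrix_vector_mul_assoc[symmetric]
          refl_mat_mult_vec y_def del: alternating.simps)
    then have *: "\<alpha> s \<bullet> (\<rho> (val (alternating (Suc j) t s)) *v x) =
     (if even j then e (Suc j) * (\<alpha> s \<bullet> (x - (\<alpha> y \<bullet> x) *\<^sub>R v y)) + r * e j * (\<alpha> t \<bullet> (x - (\<alpha> y \<bullet> x) *\<^sub>R v y))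
      else e j * (\<alpha> s \<bullet> (x - (\<alpha> y \<bullet> x) *\<^sub>R v y)) + r * e (Suc j) * (\<alpha> t \<bullet> (x - (\<alpha> y \<bullet> x) *\<^sub>R v y)))"
      using Suc.IH[of "x - (\<alpha> y \<bullet> x) *\<^sub>R v y"] by simp
    have sv: "\<alpha> s \<bullet> v t = - (r * C)" using E(2) by (simp add: a_def)
    have tv: "r * (\<alpha> t \<bullet> v s) = - C" using E(3) by (simp add: b_def algebra_simps)
    have tv': "r * (q * (\<alpha> t \<bullet> v s)) = - C * q" for q using tv by (metis mult.left_commute mult.commute)
    show ?case
    proof (cases "even j")
      case True
      then show ?thesis
        unfolding * using pairing[OF s] pairing[OF t] sv
        by (simp add: y_def E(6)[of j] algebra_simps)
    next
      case False
      have "r * (e (Suc j) * ((\<alpha> s \<bullet> x) * (\<alpha> t \<bullet> v s))) = - C * (e (Suc j) * (\<alpha> s \<bullet> x))"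
        using tv'[of "e (Suc j) * (\<alpha> s \<bullet> x)"] by (simp add: mult_ac)
      then show ?thesis
        unfolding * using pairing[OF s] pairing[OF t] False
        by (simp add: y_def E(6)[of j] algebra_simps)
    qed
  qed
  \<comment> \<open>The index k + 1 may equal m, where e vanishes; in that case e k is
    positive.\<close>
  have ks: "enat (Suc k) \<le> m s t" using k by (simp add: Suc_ile_eq)
  have e1: "e k \<ge> 0" "e (Suc k) \<ge> 0" using E(7) k ks by auto
  have e2: "e k > 0 \<or> e (Suc k) > 0" using E(8)[of k] E(5) k by (cases "k = 0") auto
  have re: "r * e k \<ge> 0" "r * e (Suc k) \<ge> 0" using E(1) e1 by simp_all
  have re2: "e k > 0 \<Longrightarrow> r * e k > 0" "e (Suc k) > 0 \<Longrightarrow> r * e (Suc k) > 0" using E(1) by simp_all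
  show thesis
  proof (cases "even k")
    case True
    have "e (Suc k) + r * e k > 0" using e1 e2 re re2 by linarith
    then show thesis using that[OF e1(2) re(1)] main[of k] True by simp
  next
    case False
    have "e k + r * e (Suc k) > 0" using e1 e2 re re2 by linarith
    then show thesis using that[OF e1(1) re(2)] main[of k] False by simp
  qed
qed

text \<open>Tits' argument: one splits off from \<open>w\<close> a longest possible prefix in a rank two subgroup.\<close>
lemma wall_side:
  assumes "s \<in> S" "w \<in> carrier W" "len (gen s \<otimes> w) > len w"
  shows "\<alpha> s \<bullet> (\<rho> w *v x0) < 0"
  using assms
proof (induction "len w" arbitrary: w s rule: less_induct)
  case less
  note s = less.prems(1) and w = less.prems(2) and longer = less.prems(3)
  obtain us where us: "set us \<subseteq> S" "length us = len w" "val us = w" using reduced_word[OF w] .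
  show ?case
  proof (cases us)
    case Nil
    then show ?thesis using us x0[OF s] by (auto simp: \<rho>_one)
  next
    case (Cons t us')
    have t: "t \<in> S" and us': "set us' \<subseteq> S" using us Cons by auto
    \<comment> \<open>The number n is the length left after a prefix in s and t has been split off
      without increasing the total length.\<close>
    define good where "good n \<longleftrightarrow> (\<exists>u y. set u \<subseteq> {s,t} \<and> y \<in> carrier W \<and> w = val u \<otimes> y \<and>
        length u + len y \<le> len w \<and> len y = n)" for n
    have len': "len (val us') < len w" using len_le[OF us'] us Cons by simp
    have good0: "good (len (val us'))"
    proof -
      have "w = val [t] \<otimes> val us'" using us(3) Cons t gen_closed by simp
      moreover have "length [t] + len (val us') \<le> len w" using len' by simp
      moreover have "set [t] \<subseteq> {s, t}" "val us' \<in> carrier W" using us' by auto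
      ultimately show ?thesis unfolding good_def by metis
    qed
    define n where "n = (LEAST n. good n)"
    have gn: "good n" unfolding n_def using good0 by (rule LeastI)
    have least: "\<not> good j" if "j < n" for j using that not_less_Least unfolding n_def by blast
    have nw: "n < len w" using Least_le[of good, OF good0] len' unfolding n_def by simp
    obtain u y where uy: "set u \<subseteq> {s,t}" "y \<in> carrier W" "w = val u \<otimes> y"
      "length u + len y \<le> len w" "len y = n" using gn unfolding good_def by blast
    have uS: "set u \<subseteq> S" using uy s t by auto
    \<comment> \<open>If s or t shortened y, that letter could be moved into the prefix, against the
      minimality of n. So the induction hypothesis applies to y at both walls.\<close>
    have up: "len (gen x \<otimes> y) > len y" if "x = s \<or> x = t" for x
    proof (rule ccontr)
      assume "\<not> ?thesis"
      then have lt: "len (gen x \<otimes> y) < len y" using len_gen_neq[of x y] that s t uy(2) by (metis linorder_neqE_nat)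
      have xS: "x \<in> S" using that s t by auto
      have "val (u @ [x]) \<otimes> (gen x \<otimes> y) = val u \<otimes> y"
        using uS xS uy(2) by (simp add: val_append m_assoc gen_closed gen_gen_mult)
      moreover have "length (u @ [x]) + len (gen x \<otimes> y) \<le> len w" using lt uy(4) by simp
      moreover have "set (u @ [x]) \<subseteq> {s, t}" "gen x \<otimes> y \<in> carrier W"
        using uy(1,2) that xS gen_closed by auto
      ultimately have "good (len (gen x \<otimes> y))"
        unfolding good_def using uy(3) by metis
      then show False using least lt uy by blast
    qed
    have ns: "\<alpha> s \<bullet> (\<rho> y *v x0) < 0"
      using less.hyps[of y s] uy(2,5) nw up[of s] s by blast
    have nt: "\<alpha> t \<bullet> (\<rho> y *v x0) < 0"
      using less.hyps[of y t] uy(2,5) nw up[of t] t by blast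
    \<comment> \<open>An equally short word for the prefix that begins with s would make s shorten
      w. This excludes s as the first letter, and below also prefixes of length m or more.\<close>
    have no_s: "\<not> (\<exists>z. set z \<subseteq> S \<and> length (s # z) \<le> length u \<and> val (s # z) = val u)"
    proof
      assume "\<exists>z. set z \<subseteq> S \<and> length (s # z) \<le> length u \<and> val (s # z) = val u"
      then obtain z where z: "set z \<subseteq> S" "length (s # z) \<le> length u" "val (s # z) = val u" by blast
      then have "w = gen s \<otimes> (val z \<otimes> y)"
        using uy(2,3) s by (metis gen_closed m_assoc val_Cons val_closed)
      then have "gen s \<otimes> w = val z \<otimes> y"
        using gen_gen_mult[of s "val z \<otimes> y"] s z(1) uy(2) by simp
      then have "len (gen s \<otimes> w) \<le> length z + len y" using len_mult_le[OF z(1) uy(2)] by simp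
      then show False using z(2) uy(4) longer by simp
    qed
    have red: "length u \<le> length z" if "set z \<subseteq> S" "val z = val u" for z
      using len_mult_le[OF that(1) uy(2)] uy(3,4) that(2) by simp
    have alt: "u = alternating (length u) t s"
    proof (rule alternating_if_no_repetition)
      show "u = [] \<or> hd u = t"
      proof (rule ccontr)
        assume "\<not> ?thesis"
        then obtain z where "u = s # z" using uy(1) by (cases u) auto
        then show False using no_s uS by auto
      qed
      show "u \<noteq> p @ [x, x] @ q" for x p q
      proof
        assume eq: "u = p @ [x, x] @ q"
        have "set p \<subseteq> S" "set q \<subseteq> S" "x \<in> S" using uS unfolding eq by auto
        then have "val (p @ [x, x] @ q) = val (p @ q)"
          by (simp add: val_append gen_closed gen_gen_mult)
        then have "val (p @ q) = val u" using eq by simp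
        moreover have "set (p @ q) \<subseteq> S" "length (p @ q) < length u" using uS eq by auto
        ultimately show False using red[of "p @ q"] by simp
      qed
    qed (use uy in auto)
    have s_t: "s \<noteq> t"
    proof
      assume "s = t"
      then have "gen s \<otimes> w = val us'" using us Cons us' s by (auto simp: gen_gen_mult)
      then show False using longer len' by simp
    qed
    \<comment> \<open>Otherwise the braid relation rewrites the first m letters so that they begin
      with s.\<close>
    have k: "enat (length u) < m s t"
    proof (rule ccontr)
      assume "\<not> ?thesis"
      then obtain M where M: "m s t = enat M" "M \<le> length u" by (cases "m s t") auto
      have "m s t \<ge> 2" using cox s t s_t by (simp add: coxeter_matrix_def)
      then have M1: "M > 0" using M by (cases M) (auto simp: zero_enat_def[symmetric])
      define z where "z = (if even M then alternating (length u - M) t s else alternating (length u - M) s t)"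
      have z: "u = alternating M t s @ z"
        using alternating_add[of M "length u - M" t s] M by (simp add: alt[symmetric] z_def)
      have zS: "set z \<subseteq> S" using uS z by (metis set_append le_sup_iff)
      have aS: "set (alternating k x y) \<subseteq> S" if "x \<in> S" "y \<in> S" for k x y
        using set_alternating[of k x y] that by auto
      have "val u = val (alternating M s t @ z)"
        using z zS aS s t braid[OF s t M(1)] by (metis val_append)
      moreover obtain M' where M': "M = Suc M'" using M1 by (cases M) auto
      ultimately have "val (s # alternating M' t s @ z) = val u" by simp
      moreover have "length (s # alternating M' t s @ z) = length u"
        using arg_cong[OF z, of length] M' by simp
      moreover have "set (alternating M' t s @ z) \<subseteq> S" using zS aS[OF t s, of M'] by simp
      ultimately show False using no_s by (metis order_refl)
    qed
    obtain c d where cd: "c \<ge> 0" "d \<ge> 0" "c + d > 0"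
      "\<And>x. \<alpha> s \<bullet> (\<rho> (val (alternating (length u) t s)) *v x) = c * (\<alpha> s \<bullet> x) + d * (\<alpha> t \<bullet> x)"
      using dihedral_coefficients[OF s t s_t k] by blast
    have "\<alpha> s \<bullet> (\<rho> w *v x0) = c * (\<alpha> s \<bullet> (\<rho> y *v x0)) + d * (\<alpha> t \<bullet> (\<rho> y *v x0))"
      using cd(4)[of "\<rho> y *v x0"] uy(2,3) uS
      by (simp add: alt[symmetric] \<rho>_mult matrix_vector_mul_assoc)
    also have "\<dots> < 0"
    proof (cases "c > 0")
      case True
      then have "c * (\<alpha> s \<bullet> (\<rho> y *v x0)) < 0" "d * (\<alpha> t \<bullet> (\<rho> y *v x0)) \<le> 0"
        using ns nt cd(2) by (simp_all add: mult_pos_neg mult_nonneg_nonpos)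
      then show ?thesis by linarith
    next
      case False
      then have "c = 0" "d > 0" using cd by auto
      then show ?thesis using nt by (simp add: mult_less_0_iff)
    qed
    finally show ?thesis .
  qed
qed

text \<open>If a reduced word of w begins with s, then the wall of s separates x0 from its image
  under w, so w moves x0.\<close>

lemma \<rho>_faithful: assumes w: "w \<in> carrier W" and "\<rho> w = mat 1" shows "w = \<one>"
proof -
  obtain us where us: "set us \<subseteq> S" "length us = len w" "val us = w" using reduced_word[OF w] .
  show ?thesis
  proof (cases us)
    case Nil then show ?thesis using us by simp
  next
    case (Cons s us')
    have s: "s \<in> S" and us': "set us' \<subseteq> S" using us Cons by auto
    have "gen s \<otimes> w = val us'" using us Cons us' s by (auto simp: gen_gen_mult)
    moreover have "w = gen s \<otimes> val us'" using us Cons by simp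
    moreover have "len (val us') < len w" using len_le[OF us'] us Cons by simp
    ultimately have "\<alpha> s \<bullet> (\<rho> (val us') *v x0) < 0"
      using wall_side[of s "val us'"] s us' by simp
    moreover have "\<rho> w *v x0 = \<rho> (val us') *v x0 - (\<alpha> s \<bullet> (\<rho> (val us') *v x0)) *\<^sub>R v s"
      using s us' \<open>w = gen s \<otimes> val us'\<close> 
      by (simp add: \<rho>_mult gen_closed \<rho>_gen matrix_vector_mul_assoc[symmetric] refl_mat_mult_vec)
    then have "\<alpha> s \<bullet> (\<rho> w *v x0) = - (\<alpha> s \<bullet> (\<rho> (val us') *v x0))"
      using pairing[OF s] by (simp add: inner_diff_right)
    ultimately have "\<alpha> s \<bullet> x0 > 0" using assms by simp
    then show ?thesis using x0[OF s] by simp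
  qed
qed

lemma \<rho>_inj: "inj_on \<rho> (carrier W)"
proof (rule inj_onI)
  fix x y assume xy: "x \<in> carrier W" "y \<in> carrier W" "\<rho> x = \<rho> y"
  then have "\<rho> (inv y \<otimes> x) = \<rho> (inv y \<otimes> y)" by (simp only: \<rho>_mult inv_closed)
  then have "inv y \<otimes> x = \<one>" using xy \<rho>_faithful[of "inv y \<otimes> x"] \<rho>_one by simp
  then show "x = y" using xy by (metis inv_equality inv_inv inv_closed)
qed

end

section \<open>Polynomials of bounded degree and invariant vector fields\<close>

inductive poly_deg :: "nat \<Rightarrow> (real^'n^'n \<Rightarrow> real) \<Rightarrow> bool" where
  const: "poly_deg d (\<lambda>_. c)"
| coord: "poly_deg (Suc d) (\<lambda>A. A $ i $ j)"
| add: "poly_deg d p \<Longrightarrow> poly_deg d q \<Longrightarrow> poly_deg d (\<lambda>A. p A + q A)"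
| mult: "poly_deg d p \<Longrightarrow> poly_deg e q \<Longrightarrow> poly_deg (d + e) (\<lambda>A. p A * q A)"

lemma poly_deg_mono: "poly_deg d p \<Longrightarrow> d \<le> e \<Longrightarrow> poly_deg e p"
proof (induction arbitrary: e rule: poly_deg.induct)
  case (coord d i j)
  then obtain e' where "e = Suc e'" by (cases e) auto
  then show ?case by (simp add: poly_deg.coord)
next
  case (mult d p d' q)
  have "poly_deg (d + (e - d)) (\<lambda>A. p A * q A)"
    by (rule poly_deg.mult) (use mult in auto)
  then show ?case using mult.prems by simp
qed (auto intro: poly_deg.intros)

lemma mat_poly_imp_poly_deg: "p \<in> mat_poly \<Longrightarrow> \<exists>d. poly_deg d p"
proof (induction rule: mat_poly.induct)
  case (add p q)
  then obtain d e where "poly_deg d p" "poly_deg e q" by blast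
  then have "poly_deg (d + e) p" "poly_deg (d + e) q" by (auto elim: poly_deg_mono)
  then show ?case by (blast intro: poly_deg.add)
qed (blast intro: poly_deg.intros)+

lemma poly_deg_imp_mat_poly: "poly_deg d p \<Longrightarrow> p \<in> mat_poly"
  by (induction rule: poly_deg.induct) (auto intro: mat_poly.intros)

lemma poly_deg_cmult: "poly_deg d p \<Longrightarrow> poly_deg d (\<lambda>A. c * p A)"
  using poly_deg.mult[of 0 "\<lambda>_. c" d p] by (simp add: poly_deg.const)

lemma poly_deg_sum: "finite J \<Longrightarrow> (\<And>j. j \<in> J \<Longrightarrow> poly_deg d (f j)) \<Longrightarrow> poly_deg d (\<lambda>A. \<Sum>j\<in>J. f j A)"
  by (induction J rule: finite_induct) (auto intro: poly_deg.intros)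

lemma poly_deg_translate:
  fixes G H :: "real^'n^'n"
  shows "poly_deg d p \<Longrightarrow> poly_deg d (\<lambda>A. p (G ** A ** H))"
proof (induction rule: poly_deg.induct)
  case (coord d i j)
  have "(\<lambda>A. (G ** A ** H) $ i $ j) = (\<lambda>A. \<Sum>l\<in>UNIV. H $ l $ j * (\<Sum>k\<in>UNIV. G $ i $ k * A $ k $ l))"
    by (simp add: matrix_matrix_mult_def mult.commute)
  then show ?case by (auto intro!: poly_deg_sum poly_deg_cmult poly_deg.coord)
qed (auto intro: poly_deg.intros)

lemma poly_deg_differentiable: "poly_deg d p \<Longrightarrow> p differentiable (at A)"
proof (induction rule: poly_deg.induct)
  case (coord d i j)
  have "bounded_linear (\<lambda>A::real^'a^'a. A $ i $ j)"
    by (intro bounded_linear_intros bounded_linear_compose[OF bounded_linear_vec_nth] bounded_linear_vec_nth)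
  then show ?case using bounded_linear_imp_differentiable by blast
qed auto

section \<open>Left invariant derivations\<close>

definition left_deriv :: "real^'n^'n \<Rightarrow> (real^'n^'n \<Rightarrow> real) \<Rightarrow> real^'n^'n \<Rightarrow> real" where
  "left_deriv X p A = frechet_derivative p (at A) (A ** X)"

lemma left_deriv_eqI: "(p has_derivative D) (at A) \<Longrightarrow> left_deriv X p A = D (A ** X)"
  unfolding left_deriv_def using frechet_derivative_at by metis

lemma left_deriv_const: "left_deriv X (\<lambda>_. c) = (\<lambda>_. 0)"
  by (rule ext, rule left_deriv_eqI[where D = "\<lambda>_. 0"]) simp

lemma left_deriv_coord: "left_deriv X (\<lambda>A. A $ i $ j) = (\<lambda>A. (A ** X) $ i $ j)"
proof
  fix A :: "real^'a^'a"
  have "bounded_linear (\<lambda>A::real^'a^'a. A $ i $ j)"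
    by (intro bounded_linear_compose[OF bounded_linear_vec_nth] bounded_linear_vec_nth)
  then show "left_deriv X (\<lambda>A. A $ i $ j) A = (A ** X) $ i $ j"
    by (intro left_deriv_eqI[where D = "\<lambda>A. A $ i $ j"] bounded_linear_imp_has_derivative)
qed

lemma left_deriv_add:
  assumes "poly_deg d p" "poly_deg e q"
  shows "left_deriv X (\<lambda>A. p A + q A) = (\<lambda>A. left_deriv X p A + left_deriv X q A)"
proof
  fix A
  have "(p has_derivative frechet_derivative p (at A)) (at A)" "(q has_derivative frechet_derivative q (at A)) (at A)"
    using poly_deg_differentiable assms frechet_derivative_works by blast+
  from has_derivative_add[OF this]
  show "left_deriv X (\<lambda>A. p A + q A) A = left_deriv X p A + left_deriv X q A"
    using left_deriv_eqI by (fastforce simp: left_deriv_def)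
qed

lemma left_deriv_mult:
  assumes "poly_deg d p" "poly_deg e q"
  shows "left_deriv X (\<lambda>A. p A * q A) = (\<lambda>A. left_deriv X p A * q A + p A * left_deriv X q A)"
proof
  fix A
  have "(p has_derivative frechet_derivative p (at A)) (at A)" "(q has_derivative frechet_derivative q (at A)) (at A)"
    using poly_deg_differentiable assms frechet_derivative_works by blast+
  from has_derivative_mult[OF this]
  show "left_deriv X (\<lambda>A. p A * q A) A = left_deriv X p A * q A + p A * left_deriv X q A"
    using left_deriv_eqI by (fastforce simp: left_deriv_def)
qed

lemma poly_deg_left_deriv: "poly_deg d p \<Longrightarrow> poly_deg d (left_deriv X p)"
proof (induction rule: poly_deg.induct)
  case (coord d i j)
  have "poly_deg (Suc d) (\<lambda>A. (mat 1 ** A ** X) $ i $ j)"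
    using poly_deg_translate[OF poly_deg.coord] by blast
  then show ?case by (simp add: left_deriv_coord)
next
  case (mult d p e q)
  then show ?case by (simp add: left_deriv_mult[OF mult.hyps] poly_deg.add poly_deg.mult)
qed (auto simp: left_deriv_const left_deriv_add intro: poly_deg.intros)

lemma left_deriv_linear:
  assumes "poly_deg d p"
  shows "left_deriv (X + Y) p A = left_deriv X p A + left_deriv Y p A"
    and "left_deriv (c *\<^sub>R X) p A = c * left_deriv X p A"
    and "left_deriv 0 p A = 0"
proof -
  have l: "linear (frechet_derivative p (at A))"
    using linear_frechet_derivative poly_deg_differentiable[OF assms] by blast
  show "left_deriv (X + Y) p A = left_deriv X p A + left_deriv Y p A"
    "left_deriv (c *\<^sub>R X) p A = c * left_deriv X p A" "left_deriv 0 p A = 0"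
    unfolding left_deriv_def
    by (simp_all add: matrix_distrib linear_add[OF l] linear_scale[OF l] linear_0[OF l])
qed

text \<open>The commutator of two derivations is a derivation, because the mixed terms of the
  product rule cancel; the identity therefore only has to be checked on the coordinate
  functions.\<close>

lemma left_deriv_commutator:
  assumes "poly_deg d p"
  shows "left_deriv X (left_deriv Y p) A - left_deriv Y (left_deriv X p) A = left_deriv (X ** Y - Y ** X) p A"
  using assms
proof (induction arbitrary: A rule: poly_deg.induct)
  case (const d c)
  then show ?case by (simp add: left_deriv_const)
next
  case (coord d i j)
  have b: "bounded_linear (\<lambda>A::real^'a^'a. A $ i $ j)"
    by (intro bounded_linear_compose[OF bounded_linear_vec_nth] bounded_linear_vec_nth)
  have l: "linear (\<lambda>A::real^'a^'a. A ** Y)" for Y :: "real^'a^'a"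
    by (intro linearI) (simp_all add: matrix_distrib)
  have "bounded_linear (\<lambda>A::real^'a^'a. (A ** Y) $ i $ j)" for Y :: "real^'a^'a"
    using bounded_linear_compose[OF b] l linear_conv_bounded_linear by blast
  then have "left_deriv X (\<lambda>A. (A ** Y) $ i $ j) A = (A ** X ** Y) $ i $ j" for X Y
    by (intro left_deriv_eqI[where D = "\<lambda>A. (A ** Y) $ i $ j"] bounded_linear_imp_has_derivative)
  then show ?case by (simp add: left_deriv_coord matrix_distrib matrix_mul_assoc)
next
  case (add d p q)
  have "left_deriv Z (left_deriv Z' (\<lambda>A. p A + q A)) A = left_deriv Z (left_deriv Z' p) A + left_deriv Z (left_deriv Z' q) A" for Z Z'
    unfolding left_deriv_add[OF add.hyps]
      left_deriv_add[OF poly_deg_left_deriv[OF add.hyps(1)] poly_deg_left_deriv[OF add.hyps(2)]] ..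
  then show ?case using add.IH[of A] by (simp add: left_deriv_add[OF add.hyps])
next
  case (mult d p e q)
  note p' = poly_deg_left_deriv[OF mult.hyps(1)] and q' = poly_deg_left_deriv[OF mult.hyps(2)]
  have "left_deriv Z (left_deriv Z' (\<lambda>A. p A * q A)) A
     = left_deriv Z (left_deriv Z' p) A * q A + left_deriv Z' p A * left_deriv Z q A
       + (left_deriv Z p A * left_deriv Z' q A + p A * left_deriv Z (left_deriv Z' q) A)" for Z Z'
    unfolding left_deriv_mult[OF mult.hyps]
      left_deriv_add[OF poly_deg.mult[OF p' mult.hyps(2)] poly_deg.mult[OF mult.hyps(1) q']]
      left_deriv_mult[OF p' mult.hyps(2)] left_deriv_mult[OF mult.hyps(1) q'] ..
  then show ?case using mult.IH[of A]
    by (simp add: left_deriv_mult[OF mult.hyps] mult.IH[symmetric] algebra_simps)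
qed

text \<open>Chain rule: the velocity A X is carried to G A X H, which is (G A H)(K X H) because K is
  the inverse of H.\<close>

lemma left_deriv_translate:
  fixes G H K X A :: "real^'n^'n"
  assumes "poly_deg d p" "K ** H = mat 1"
  shows "left_deriv X (\<lambda>A. p (G ** A ** H)) A = left_deriv (K ** X ** H) p (G ** A ** H)"
proof -
  have l: "linear (\<lambda>A::real^'n^'n. G ** A ** H)"
    by (intro linearI) (simp_all add: matrix_distrib)
  have "((\<lambda>A. G ** A ** H) has_derivative (\<lambda>A. G ** A ** H)) (at A)"
    using l linear_conv_bounded_linear bounded_linear_imp_has_derivative by blast
  moreover have "(p has_derivative frechet_derivative p (at (G ** A ** H))) (at (G ** A ** H))"
    using poly_deg_differentiable assms(1) frechet_derivative_works by blast
  ultimately have "((\<lambda>A. p (G ** A ** H)) has_derivative (\<lambda>Y. frechet_derivative p (at (G ** A ** H)) (G ** Y ** H))) (at A)"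
    by (rule has_derivative_compose)
  from left_deriv_eqI[OF this, of X]
  have "left_deriv X (\<lambda>A. p (G ** A ** H)) A = frechet_derivative p (at (G ** A ** H)) (G ** (A ** X) ** H)" .
  moreover have "G ** A ** H ** (K ** X ** H) = G ** A ** (H ** K) ** X ** H"
    by (simp only: matrix_mul_assoc)
  moreover have HK: "H ** K = mat 1" using assms(2) matrix_left_right_inverse[of K H] by simp
  have "G ** A ** (H ** K) ** X ** H = G ** (A ** X) ** H"
    unfolding HK by (simp add: matrix_mul_assoc)
  ultimately show ?thesis by (simp add: left_deriv_def)
qed

text \<open>Bounding the degree replaces the Hilbert basis theorem: it suffices to find, for each \<open>d\<close>,
  enough elements to detect the polynomials of degree at most \<open>d\<close>.\<close>
definition closure_deg :: "nat \<Rightarrow> (real^'n^'n) set \<Rightarrow> (real^'n^'n) set" where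
  "closure_deg d \<Gamma> = {g. \<forall>p. poly_deg d p \<longrightarrow> (\<forall>h\<in>\<Gamma>. p h = 0) \<longrightarrow> p g = 0}"

text \<open>Derivation does not raise the degree, so such X map the polynomials of degree at most d
  vanishing on \<Gamma> to themselves; closure under brackets follows. The trace condition excludes
  the nonzero scalar matrices.\<close>

definition lie_deg :: "nat \<Rightarrow> (real^'n^'n) set \<Rightarrow> (real^'n^'n) set" where
  "lie_deg d \<Gamma> = {X. trace X = 0 \<and>
     (\<forall>p. poly_deg d p \<longrightarrow> (\<forall>h\<in>\<Gamma>. p h = 0) \<longrightarrow> (\<forall>h\<in>\<Gamma>. left_deriv X p h = 0))}"

lemma lie_degD:
  "X \<in> lie_deg d \<Gamma> \<Longrightarrow> poly_deg d p \<Longrightarrow> \<forall>h\<in>\<Gamma>. p h = 0 \<Longrightarrow> h \<in> \<Gamma> \<Longrightarrow> left_deriv X p h = 0"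
  unfolding lie_deg_def by simp

lemma closure_degD:
  "g \<in> closure_deg d \<Gamma> \<Longrightarrow> poly_deg d p \<Longrightarrow> \<forall>h\<in>\<Gamma>. p h = 0 \<Longrightarrow> p g = 0"
  unfolding closure_deg_def by simp

lemma closure_deg_superset: "\<Gamma> \<subseteq> closure_deg d \<Gamma>"
  by (auto simp: closure_deg_def)

lemma zariski_closure_GL_eq: "zariski_closure_GL \<Gamma> = {g. invertible g \<and> (\<forall>d. g \<in> closure_deg d \<Gamma>)}"
  unfolding zariski_closure_GL_def closure_deg_def
  using mat_poly_imp_poly_deg poly_deg_imp_mat_poly by blast

text \<open>Translations preserve the degree. Left translates by elements of \<Gamma> show that p
  (\<gamma> h) vanishes for all \<gamma> in \<Gamma>, and then the right translate by h gives the
  claim at g.\<close>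

lemma closure_deg_mult:
  assumes mult: "\<And>g h. g \<in> \<Gamma> \<Longrightarrow> h \<in> \<Gamma> \<Longrightarrow> g ** h \<in> \<Gamma>"
    and "g \<in> closure_deg d \<Gamma>" "h \<in> closure_deg d \<Gamma>"
  shows "g ** h \<in> closure_deg d \<Gamma>"
  unfolding closure_deg_def
proof (intro CollectI allI impI)
  fix p assume p: "poly_deg d p" "\<forall>h\<in>\<Gamma>. p h = 0"
  have "p (\<gamma> ** h) = 0" if "\<gamma> \<in> \<Gamma>" for \<gamma>
  proof -
    have "poly_deg d (\<lambda>A. p (\<gamma> ** A ** mat 1))" using p(1) by (rule poly_deg_translate)
    moreover have "\<forall>A\<in>\<Gamma>. p (\<gamma> ** A ** mat 1) = 0" using p(2) mult that by simp
    ultimately have "p (\<gamma> ** h ** mat 1) = 0" using closure_degD[OF assms(3)] by blast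
    then show ?thesis by simp
  qed
  then have "\<forall>A\<in>\<Gamma>. p (mat 1 ** A ** h) = 0" by simp
  moreover have "poly_deg d (\<lambda>A. p (mat 1 ** A ** h))" using p(1) by (rule poly_deg_translate)
  ultimately have "p (mat 1 ** g ** h) = 0" using closure_degD[OF assms(2)] by blast
  then show "p (g ** h) = 0" by simp
qed

lemma lie_degI:
  assumes "trace X = 0"
    and "\<And>p h. poly_deg d p \<Longrightarrow> \<forall>h\<in>\<Gamma>. p h = 0 \<Longrightarrow> h \<in> \<Gamma> \<Longrightarrow> left_deriv X p h = 0"
  shows "X \<in> lie_deg d \<Gamma>"
  using assms unfolding lie_deg_def by blast

lemma subspace_lie_deg: "subspace (lie_deg d \<Gamma>)"
proof (rule subspaceI)
  show "0 \<in> lie_deg d \<Gamma>"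
    by (rule lie_degI) (simp_all add: trace_def left_deriv_linear(3)[where d = d])
next
  fix X Y assume XY: "X \<in> lie_deg d \<Gamma>" "Y \<in> lie_deg d \<Gamma>"
  show "X + Y \<in> lie_deg d \<Gamma>"
  proof (rule lie_degI)
    show "trace (X + Y) = 0" using XY by (simp add: lie_deg_def trace_add)
    fix p h assume p: "poly_deg d p" "\<forall>h\<in>\<Gamma>. p h = 0" "h \<in> \<Gamma>"
    have "left_deriv X p h = 0" "left_deriv Y p h = 0"
      using lie_degD[OF XY(1) p(1) p(2) p(3)] lie_degD[OF XY(2) p(1) p(2) p(3)] .
    then show "left_deriv (X + Y) p h = 0" by (simp add: left_deriv_linear(1)[OF p(1)])
  qed
next
  fix c and X assume X: "X \<in> lie_deg d \<Gamma>"
  show "c *\<^sub>R X \<in> lie_deg d \<Gamma>"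
  proof (rule lie_degI)
    show "trace (c *\<^sub>R X) = 0" using X by (simp add: lie_deg_def trace_scaleR)
    fix p h assume p: "poly_deg d p" "\<forall>h\<in>\<Gamma>. p h = 0" "h \<in> \<Gamma>"
    have "left_deriv X p h = 0"
      using lie_degD[OF X p(1) p(2) p(3)] .
    then show "left_deriv (c *\<^sub>R X) p h = 0" by (simp add: left_deriv_linear(2)[OF p(1)])
  qed
qed

lemma lie_deg_bracket:
  assumes "X \<in> lie_deg d \<Gamma>" "Y \<in> lie_deg d \<Gamma>"
  shows "X ** Y - Y ** X \<in> lie_deg d \<Gamma>"
proof -
  have "trace (X ** Y - Y ** X) = 0" using trace_mul_sym[of X Y] by (simp only: trace_sub diff_self)
  moreover have "left_deriv (X ** Y - Y ** X) p h = 0" if p: "poly_deg d p" "\<forall>h\<in>\<Gamma>. p h = 0" "h \<in> \<Gamma>" for p h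
  proof -
    have X: "\<forall>h\<in>\<Gamma>. left_deriv X p h = 0" and Y: "\<forall>h\<in>\<Gamma>. left_deriv Y p h = 0"
      using lie_degD[OF assms(1) p(1) p(2)] lie_degD[OF assms(2) p(1) p(2)] by blast+
    have "left_deriv X (left_deriv Y p) h = 0"
      by (rule lie_degD[OF assms(1) poly_deg_left_deriv[OF p(1)] Y p(3)])
    moreover have "left_deriv Y (left_deriv X p) h = 0"
      by (rule lie_degD[OF assms(2) poly_deg_left_deriv[OF p(1)] X p(3)])
    ultimately show ?thesis using left_deriv_commutator[OF p(1), of X Y h] by simp
  qed
  ultimately show ?thesis unfolding lie_deg_def by blast
qed

lemma lie_deg_conj:
  assumes mult: "\<And>g h. g \<in> \<Gamma> \<Longrightarrow> h \<in> \<Gamma> \<Longrightarrow> g ** h \<in> \<Gamma>"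
    and X: "X \<in> lie_deg d \<Gamma>" and s: "s \<in> \<Gamma>" "s ** s = mat 1"
  shows "s ** X ** s \<in> lie_deg d \<Gamma>"
proof -
  have "trace (s ** X ** s) = trace (s ** s ** X)"
    using trace_mul_sym[of "s ** X" s] by (simp only: matrix_mul_assoc)
  then have "trace (s ** X ** s) = 0" using X s by (simp add: lie_deg_def)
  moreover have "left_deriv (s ** X ** s) p h = 0" if p: "poly_deg d p" "\<forall>h\<in>\<Gamma>. p h = 0" "h \<in> \<Gamma>" for p h
  proof -
    have "poly_deg d (\<lambda>A. p (mat 1 ** A ** s))" using p(1) by (rule poly_deg_translate)
    moreover have "\<forall>A\<in>\<Gamma>. p (mat 1 ** A ** s) = 0" using p mult s by simp
    ultimately have "left_deriv X (\<lambda>A. p (mat 1 ** A ** s)) (h ** s) = 0"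
      using lie_degD[OF X] mult[OF p(3) s(1)] by blast
    then have "left_deriv (s ** X ** s) p (mat 1 ** (h ** s) ** s) = 0"
      unfolding left_deriv_translate[OF p(1) s(2)] .
    then show ?thesis by (simp add: matrix_mul_assoc[symmetric] s)
  qed
  ultimately show ?thesis unfolding lie_deg_def by blast
qed

section \<open>Rational curves of matrices\<close>

text \<open>With a common denominator, multiplying p by q^d turns its restriction to the curve into
  a polynomial in t. Where q vanishes the value is 0 by the convention for division, hence the side
  conditions on q below.\<close>

definition rational_curve :: "real poly \<Rightarrow> ('n \<Rightarrow> 'n \<Rightarrow> real poly) \<Rightarrow> real \<Rightarrow> real^'n^'n" where
  "rational_curve q N t = (1 / poly q t) *\<^sub>R (\<chi> i j. poly (N i j) t)"

lemma rational_curve_poly: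
  assumes "poly_deg d p" "degree q \<le> e" "\<forall>i j. degree (N i j) \<le> e"
  shows "\<exists>r. degree r \<le> e * d \<and> (\<forall>t. poly q t \<noteq> 0 \<longrightarrow> poly r t = poly q t ^ d * p (rational_curve q N t))"
proof -
  have qd: "degree (q ^ d) \<le> e * d" for d
    using degree_power_le[of q d] assms(2) by (meson le_trans mult_le_mono1)
  show ?thesis
    using assms(1)
  proof (induction rule: poly_deg.induct)
    case (const d c)
    show ?case by (rule exI[of _ "smult c (q ^ d)"]) (use qd[of d] degree_smult_le[of c "q ^ d"] in \<open>auto simp: mult.commute\<close>)
  next
    case (coord d i j)
    have "degree (N i j * q ^ d) \<le> e * Suc d"
      using degree_mult_le[of "N i j" "q ^ d"] assms(3)[rule_format, of i j] qd[of d] by simp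
    then show ?case by (intro exI[of _ "N i j * q ^ d"]) (auto simp: rational_curve_def)
  next
    case (add d p1 p2)
    then obtain r1 r2 where r: "degree r1 \<le> e * d" "degree r2 \<le> e * d"
      "\<And>t. poly q t \<noteq> 0 \<Longrightarrow> poly r1 t = poly q t ^ d * p1 (rational_curve q N t)"
      "\<And>t. poly q t \<noteq> 0 \<Longrightarrow> poly r2 t = poly q t ^ d * p2 (rational_curve q N t)" by blast
    show ?case by (rule exI[of _ "r1 + r2"]) (use r in \<open>auto simp: degree_add_le algebra_simps\<close>)
  next
    case (mult d1 p1 d2 p2)
    then obtain r1 r2 where r: "degree r1 \<le> e * d1" "degree r2 \<le> e * d2"
      "\<And>t. poly q t \<noteq> 0 \<Longrightarrow> poly r1 t = poly q t ^ d1 * p1 (rational_curve q N t)"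
      "\<And>t. poly q t \<noteq> 0 \<Longrightarrow> poly r2 t = poly q t ^ d2 * p2 (rational_curve q N t)" by blast
    have "degree (r1 * r2) \<le> e * (d1 + d2)" using degree_mult_le[of r1 r2] r by (simp add: algebra_simps)
    then show ?case by (intro exI[of _ "r1 * r2"]) (auto simp: r power_add algebra_simps)
  qed
qed

text \<open>After clearing the denominator, a polynomial in t of degree at most \<open>e * d\<close>
  remains, and it has too many zeros.\<close>

lemma rational_curve_vanish:
  assumes "poly_deg d p" "degree q \<le> e" "\<forall>i j. degree (N i j) \<le> e"
    and T: "card T > e * d" "\<And>t. t \<in> T \<Longrightarrow> poly q t \<noteq> 0 \<and> p (rational_curve q N t) = 0"
    and t: "poly q t \<noteq> 0"
  shows "p (rational_curve q N t) = 0"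
proof -
  obtain r where r: "degree r \<le> e * d"
    "\<And>t. poly q t \<noteq> 0 \<Longrightarrow> poly r t = poly q t ^ d * p (rational_curve q N t)"
    using rational_curve_poly[OF assms(1-3)] by blast
  have "r = 0"
  proof (rule ccontr)
    assume "r \<noteq> 0"
    have "T \<subseteq> {t. poly r t = 0}" using T r by auto
    then have "card T \<le> card {t. poly r t = 0}" using poly_roots_finite[OF \<open>r \<noteq> 0\<close>] by (rule card_mono[rotated])
    also have "\<dots> \<le> degree r" using \<open>r \<noteq> 0\<close> by (rule card_poly_roots_bound)
    finally show False using r T by simp
  qed
  then show ?thesis using r(2)[OF t] t by simp
qed

text \<open>An integral curve of a left invariant vector field from \<open>lie_deg\<close>, up to reparametrisation, stays
  in the closure: the polynomials \<open>q^d p(M(t))\<close> form a family closed under a first order differential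
  equation, so a member of least vanishing order at 0 cannot exist.\<close>
lemma rational_curve_in_closure:
  assumes X: "X \<in> lie_deg d \<Gamma>" and q0: "poly q 0 \<noteq> 0"
    and start: "rational_curve q N 0 \<in> closure_deg d \<Gamma>"
    and ode: "\<And>t. poly q t \<noteq> 0 \<Longrightarrow> (rational_curve q N has_vector_derivative
        (c / poly q t) *\<^sub>R (rational_curve q N t ** X)) (at t)"
    and t: "poly q t \<noteq> 0"
  shows "rational_curve q N t \<in> closure_deg d \<Gamma>"
proof -
  define M where "M = rational_curve q N"
  define I where "I = {p. poly_deg d p \<and> (\<forall>h\<in>\<Gamma>. p h = 0)}"
  define R where "R = {r. \<exists>p\<in>I. \<forall>t. poly q t \<noteq> 0 \<longrightarrow> poly r t = poly q t ^ d * p (M t)}"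
  obtain e where e: "degree q \<le> e" "\<forall>i j. degree (N i j) \<le> e"
  proof
    show "degree q \<le> degree q + (\<Sum>i\<in>UNIV. \<Sum>j\<in>UNIV. degree (N i j))" by simp
    show "\<forall>i j. degree (N i j) \<le> degree q + (\<Sum>i\<in>UNIV. \<Sum>j\<in>UNIV. degree (N i j))"
    proof (intro allI)
      fix i j
      have "degree (N i j) \<le> (\<Sum>j\<in>UNIV. degree (N i j))" by (rule member_le_sum) auto
      also have "\<dots> \<le> (\<Sum>i\<in>UNIV. \<Sum>j\<in>UNIV. degree (N i j))"
        by (rule member_le_sum[of i UNIV "\<lambda>i. \<Sum>j\<in>UNIV. degree (N i j)"]) auto
      finally show "degree (N i j) \<le> degree q + (\<Sum>i\<in>UNIV. \<Sum>j\<in>UNIV. degree (N i j))" by simp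
    qed
  qed
  have q_nz: "q \<noteq> 0" using q0 by auto
  have inf: "infinite {t. poly q t \<noteq> 0}"
  proof -
    have "{t. poly q t \<noteq> 0} = - {t. poly q t = 0}" by auto
    then show ?thesis
      using poly_roots_finite[OF q_nz] infinite_UNIV_char_0[where 'a = real] by (simp add: finite_compl)
  qed
  have Dp: "left_deriv X p \<in> I" if "p \<in> I" for p
  proof -
    have p: "poly_deg d p" "\<forall>h\<in>\<Gamma>. p h = 0" using that by (simp_all add: I_def)
    then show ?thesis using lie_degD[OF X p] poly_deg_left_deriv[OF p(1)] by (simp add: I_def)
  qed
  have zero: "poly r 0 = 0" if r: "r \<in> R" for r
  proof -
    obtain p where p: "p \<in> I" "\<forall>t. poly q t \<noteq> 0 \<longrightarrow> poly r t = poly q t ^ d * p (M t)"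
      using r unfolding R_def by blast
    then have "p (M 0) = 0" using closure_degD[OF start, of p] by (simp add: I_def M_def)
    then show ?thesis using p(2) q0 by simp
  qed
  \<comment> \<open>Differentiating q^d p(M(t)) gives q r' = d q' r + c r2, where r2 comes from the
    derivative of p along X. The identity holds off the zeros of q, that is at infinitely many t,
    hence between polynomials.\<close>
  have step: "\<exists>r2\<in>R. q * pderiv r = smult (real d) (pderiv q * r) + smult c r2" if r: "r \<in> R" for r
  proof -
    obtain p where p: "p \<in> I" "\<And>t. poly q t \<noteq> 0 \<Longrightarrow> poly r t = poly q t ^ d * p (M t)"
      using r unfolding R_def by auto
    have pd: "poly_deg d (left_deriv X p)" using Dp[OF p(1)] I_def by blast
    obtain r2 where r2: "\<And>t. poly q t \<noteq> 0 \<Longrightarrow> poly r2 t = poly q t ^ d * left_deriv X p (M t)"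
      using rational_curve_poly[OF pd e] unfolding M_def by blast
    have "r2 \<in> R" using Dp[OF p(1)] r2 unfolding R_def by blast
    have "poly (q * pderiv r - (smult (real d) (pderiv q * r) + smult c r2)) t = 0" if t: "poly q t \<noteq> 0" for t
    proof -
      have "poly_deg d p" using p(1) unfolding I_def by blast
      then have "(p has_derivative frechet_derivative p (at (M t))) (at (M t))"
        using poly_deg_differentiable frechet_derivative_works by blast
      moreover have "(M has_derivative (\<lambda>x. x *\<^sub>R ((c / poly q t) *\<^sub>R (M t ** X)))) (at t)"
        using ode[OF t] unfolding M_def has_vector_derivative_def .
      ultimately have "((\<lambda>t. p (M t)) has_derivative
          (\<lambda>x. frechet_derivative p (at (M t)) (x *\<^sub>R ((c / poly q t) *\<^sub>R (M t ** X))))) (at t)"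
        by (rule has_derivative_compose[rotated])
      moreover have l: "linear (frechet_derivative p (at (M t)))"
        using linear_frechet_derivative poly_deg_differentiable[OF \<open>poly_deg d p\<close>] by blast
      then have "(\<lambda>x. frechet_derivative p (at (M t)) (x *\<^sub>R ((c / poly q t) *\<^sub>R (M t ** X))))
        = (*) (c / poly q t * left_deriv X p (M t))"
        by (auto simp: left_deriv_def linear_scale[OF l] linear.scaleR[OF l])
      ultimately have pM: "((\<lambda>t. p (M t)) has_field_derivative c / poly q t * left_deriv X p (M t)) (at t)"
        unfolding has_field_derivative_def by simp
      have "((\<lambda>t. poly q t ^ d * p (M t)) has_field_derivative
          real d * poly q t ^ (d - 1) * poly (pderiv q) t * p (M t)
          + poly q t ^ d * (c / poly q t * left_deriv X p (M t))) (at t)"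
        using DERIV_mult[OF DERIV_power[OF poly_DERIV[of q t], of d] pM] by (simp add: algebra_simps)
      moreover have "\<forall>\<^sub>F x in nhds t. poly q x ^ d * p (M x) = poly r x"
      proof -
        have "open {x. poly q x \<noteq> 0}" by (intro open_Collect_neq continuous_intros)
        then have "\<forall>\<^sub>F x in nhds t. poly q x \<noteq> 0" using t eventually_nhds by blast
        then show ?thesis by eventually_elim (simp add: p(2))
      qed
      ultimately have "((poly r) has_field_derivative
          real d * poly q t ^ (d - 1) * poly (pderiv q) t * p (M t)
          + poly q t ^ d * (c / poly q t * left_deriv X p (M t))) (at t)"
        using DERIV_cong_ev[of t t "\<lambda>t. poly q t ^ d * p (M t)" "poly r"] by auto
      then have "poly (pderiv r) t = real d * poly q t ^ (d - 1) * poly (pderiv q) t * p (M t)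
          + poly q t ^ d * (c / poly q t * left_deriv X p (M t))"
        using poly_DERIV DERIV_unique by blast
      then have "poly q t * poly (pderiv r) t = real d * (poly q t * poly q t ^ (d - 1)) * poly (pderiv q) t * p (M t)
          + c * (poly q t ^ d * left_deriv X p (M t))"
        using t by (simp add: field_simps)
      also have "real d * (poly q t * poly q t ^ (d - 1)) = real d * poly q t ^ d" by (cases d) auto
      finally show ?thesis using p(2)[OF t] r2[OF t] by (simp add: algebra_simps)
    qed
    then have "{t. poly q t \<noteq> 0} \<subseteq> {t. poly (q * pderiv r - (smult (real d) (pderiv q * r) + smult c r2)) t = 0}"
      by blast
    then have "q * pderiv r - (smult (real d) (pderiv q * r) + smult c r2) = 0"
      using inf poly_roots_finite finite_subset by blast
    then show ?thesis using \<open>r2 \<in> R\<close> by (metis eq_iff_diff_eq_0)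
  qed
  \<comment> \<open>A nonzero member s of least order n at 0 has n > 0 by \<open>zero\<close>. As q
    does not vanish at 0, the order of q s' is n - 1, whereas the other side of the differential
    equation is divisible by t^n.\<close>
  have all0: "r = 0" if "r \<in> R" for r
  proof (rule ccontr)
    assume "r \<noteq> 0"
    define n where "n = (LEAST n. \<exists>r\<in>R. r \<noteq> 0 \<and> Polynomial.order 0 r = n)"
    have ex: "\<exists>n. \<exists>r\<in>R. r \<noteq> 0 \<and> Polynomial.order 0 r = n" using that \<open>r \<noteq> 0\<close> by blast
    obtain s where s: "s \<in> R" "s \<noteq> 0" "Polynomial.order 0 s = n" using LeastI_ex[OF ex] unfolding n_def by blast
    have least: "n \<le> Polynomial.order 0 u" if "u \<in> R" "u \<noteq> 0" for u
      unfolding n_def by (rule Least_le) (use that in blast)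
    have n0: "n \<noteq> 0" using zero[OF s(1)] s Polynomial.order_root[of s 0] by auto
    have s': "pderiv s \<noteq> 0"
    proof
      assume "pderiv s = 0"
      then have "degree s = 0" by (simp add: pderiv_eq_0_iff)
      then obtain a where "s = [:a:]" using degree_eq_zeroE by blast
      then show False using zero[OF s(1)] s(2) by simp
    qed
    have ord: "n = Suc (Polynomial.order 0 (pderiv s))" using order_pderiv[OF s(2), of 0] zero[OF s(1)] s(3) by simp
    obtain r2 where r2: "r2 \<in> R" "q * pderiv s = smult (real d) (pderiv q * s) + smult c r2"
      using step[OF s(1)] by blast
    have "[:- 0, 1:] ^ n dvd s" using s Polynomial.order_1 by blast
    moreover have "[:- 0, 1:] ^ n dvd r2"
      using least[OF r2(1)] Polynomial.order_1[of 0 r2] by (cases "r2 = 0") (auto intro: dvd_trans le_imp_power_dvd)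
    ultimately have "[:- 0, 1:] ^ n dvd q * pderiv s"
      unfolding r2(2) by (intro dvd_add dvd_smult dvd_mult)
    then have "n \<le> Polynomial.order 0 (q * pderiv s)"
      using Polynomial.order_divides[of 0 n "q * pderiv s"] q_nz s' by simp
    also have "\<dots> = Polynomial.order 0 (pderiv s)" using q0 Polynomial.order_root[of q 0] q_nz s' by (simp add: Polynomial.order_mult)
    finally show False using ord by simp
  qed
  show ?thesis unfolding closure_deg_def
  proof (intro CollectI allI impI)
    fix p assume p: "poly_deg d p" "\<forall>h\<in>\<Gamma>. p h = 0"
    obtain r where r: "\<And>t. poly q t \<noteq> 0 \<Longrightarrow> poly r t = poly q t ^ d * p (M t)"
      using rational_curve_poly[OF p(1) e] unfolding M_def by blast
    have "r \<in> R" using r p unfolding R_def I_def by blast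
    then have "r = 0" by (rule all0)
    then show "p (rational_curve q N t) = 0" using r t unfolding M_def by simp
  qed
qed

text \<open>The infinitely many points that an algebraic subgroup would need are replaced by more
  than \<open>e * d\<close> points: polynomials of degree d vanishing there vanish along the whole
  curve, hence so do their derivatives. The curve starts at s, so its velocity is moved to the
  identity by s, which is its own inverse.\<close>

lemma rational_curve_velocity:
  fixes \<Gamma> :: "(real^'n^'n) set"
  assumes mult: "\<And>g h. g \<in> \<Gamma> \<Longrightarrow> h \<in> \<Gamma> \<Longrightarrow> g ** h \<in> \<Gamma>"
    and deg: "degree q \<le> e" "\<forall>i j. degree (N i j) \<le> e"
    and T: "card T > e * d" "\<And>t. t \<in> T \<Longrightarrow> poly q t \<noteq> 0 \<and> rational_curve q N t \<in> \<Gamma>"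
    and q0: "poly q 0 \<noteq> 0" and s: "rational_curve q N 0 = s" "s \<in> \<Gamma>" "s ** s = mat 1"
    and vel: "(rational_curve q N has_vector_derivative Y) (at 0)" and tr: "trace (s ** Y) = 0"
  shows "s ** Y \<in> lie_deg d \<Gamma>"
proof -
  have "left_deriv (s ** Y) p h = 0" if p: "poly_deg d p" "\<forall>h\<in>\<Gamma>. p h = 0" "h \<in> \<Gamma>" for p h
  proof -
    \<comment> \<open>Translation by h s brings the starting point s to h, where the derivative is
      wanted.\<close>
    define f where "f A = p (h ** s ** A ** mat 1)" for A :: "real^'n^'n"
    have f: "poly_deg d f" unfolding f_def using p(1) by (rule poly_deg_translate)
    have van: "f (rational_curve q N t) = 0" if "poly q t \<noteq> 0" for t
    proof (rule rational_curve_vanish[OF f deg T(1) _ that])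
      fix t assume "t \<in> T"
      then show "poly q t \<noteq> 0 \<and> f (rational_curve q N t) = 0"
        using T(2)[of t] p mult s unfolding f_def by simp
    qed
    have "(p has_derivative frechet_derivative p (at h)) (at h)"
      using poly_deg_differentiable[OF p(1)] frechet_derivative_works by blast
    moreover have l: "linear (\<lambda>A::real^'n^'n. h ** s ** A ** mat 1)"
      by (intro linearI) (simp_all add: matrix_distrib)
    then have "((\<lambda>A. h ** s ** A ** mat 1) has_derivative (\<lambda>A. h ** s ** A ** mat 1)) (at s)"
      using linear_conv_bounded_linear bounded_linear_imp_has_derivative by blast
    moreover have "h ** s ** s ** mat 1 = h" by (simp add: matrix_mul_assoc[symmetric] s)
    ultimately have "(f has_derivative (\<lambda>A. frechet_derivative p (at h) (h ** s ** A ** mat 1))) (at (rational_curve q N 0))"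
      unfolding f_def s(1) using has_derivative_compose[where f = "\<lambda>A::real^'n^'n. h ** s ** A ** mat 1" and g = p] by simp
    moreover have "(rational_curve q N has_derivative (\<lambda>x. x *\<^sub>R Y)) (at 0)"
      using vel unfolding has_vector_derivative_def .
    ultimately have "((\<lambda>t. f (rational_curve q N t)) has_derivative
       (\<lambda>x. frechet_derivative p (at h) (h ** s ** (x *\<^sub>R Y) ** mat 1))) (at 0)"
      by (rule has_derivative_compose[rotated])
    moreover have "\<forall>\<^sub>F t in nhds 0. f (rational_curve q N t) = 0"
    proof -
      have "open {x. poly q x \<noteq> 0}" by (intro open_Collect_neq continuous_intros)
      then have "\<forall>\<^sub>F x in nhds 0. poly q x \<noteq> 0" using q0 eventually_nhds by blast
      then show ?thesis by eventually_elim (simp add: van)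
    qed
    then have ev: "\<forall>\<^sub>F t in at 0. 0 = f (rational_curve q N t)" "0 = f (rational_curve q N 0)"
      by (auto simp: eventually_nhds_conv_at)
    have "((\<lambda>t. f (rational_curve q N t)) has_derivative (\<lambda>x. 0)) (at 0)"
      by (rule has_derivative_transform_eventually[OF has_derivative_const ev]) simp
    ultimately have "(\<lambda>x. frechet_derivative p (at h) (h ** s ** (x *\<^sub>R Y) ** mat 1)) = (\<lambda>x. 0)"
      by (rule has_derivative_unique)
    from fun_cong[OF this, of 1] show ?thesis by (simp add: left_deriv_def matrix_mul_assoc)
  qed
  then show ?thesis using tr unfolding lie_deg_def by blast
qed

section \<open>Lie algebras normalised by a reflection\<close>

lemmas matrix_act = matrix_vector_mult_diff_rdistrib matrix_vector_mult_add_rdistrib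
  matrix_vector_mul_assoc[symmetric] scaleR_matrix_vector_assoc[symmetric] matrix_vector_mult_scaleR
  matrix_vector_mult_diff_distrib matrix_vector_right_distrib inner_add_right inner_diff_right
  refl_mat_mult_vec

locale lie_reflection =
  fixes L :: "(real^'n^'n) set" and a v :: "real^'n"
  assumes sub: "subspace L"
    and bracket: "\<And>X Y. X \<in> L \<Longrightarrow> Y \<in> L \<Longrightarrow> X ** Y - Y ** X \<in> L"
    and conj: "\<And>X. X \<in> L \<Longrightarrow> refl_mat a v ** X ** refl_mat a v \<in> L"
    and av: "a \<bullet> v = 2"
    and irr: "\<And>U. subspace U \<Longrightarrow> (\<forall>X\<in>L. \<forall>x\<in>U. X *v x \<in> U) \<Longrightarrow> U = {0} \<or> U = UNIV"
begin

lemma va: "v \<bullet> a = 2" using av by (simp add: inner_commute)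

lemma v_nz: "v \<noteq> 0" and a_nz: "a \<noteq> 0" using av by auto

text \<open>These pairs describe the \<open>-1\<close>-eigenspace of conjugation by the reflection.\<close>
definition minus :: "real^'n \<Rightarrow> real^'n \<Rightarrow> bool" where
  "minus u \<pi> \<longleftrightarrow> a \<bullet> u = 0 \<and> \<pi> \<bullet> v = 0 \<and> outer v \<pi> + outer u a \<in> L"

lemma minusD: "minus u \<pi> \<Longrightarrow> a \<bullet> u = 0" "minus u \<pi> \<Longrightarrow> \<pi> \<bullet> v = 0" "minus u \<pi> \<Longrightarrow> outer v \<pi> + outer u a \<in> L"
  by (auto simp: minus_def)

text \<open>X - s X s is twice the odd part of X under conjugation by the reflection s; it maps v
  into the kernel of \<open>a\<close> and this kernel into the line of v.\<close>

lemma minus_part: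
  assumes "X \<in> L"
  shows "minus (X *v v - (a \<bullet> (X *v v) / 2) *\<^sub>R v) (a v* X - (a \<bullet> (X *v v) / 2) *\<^sub>R a)"
proof -
  define c where "c = a \<bullet> (X *v v)"
  have ax: "(a v* X) \<bullet> v = c" by (simp add: c_def dot_lmul_matrix)
  have "X - refl_mat a v ** X ** refl_mat a v \<in> L" using assms conj sub by (simp add: subspace_diff)
  also have "X - refl_mat a v ** X ** refl_mat a v
      = outer v (a v* X - (c / 2) *\<^sub>R a) + outer (X *v v - (c / 2) *\<^sub>R v) a"
    unfolding matrix_eq using av
    by (simp add: matrix_act dot_lmul_matrix inner_diff_left c_def[symmetric])
      (simp add: vec_eq_iff algebra_simps)
  finally show ?thesis
    unfolding minus_def c_def[symmetric] using ax av
    by (simp add: inner_diff_left inner_diff_right c_def[symmetric])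
qed

lemma minus_lin:
  assumes "minus u1 p1" "minus u2 p2"
  shows "minus (c *\<^sub>R u1 + d *\<^sub>R u2) (c *\<^sub>R p1 + d *\<^sub>R p2)"
proof -
  have "c *\<^sub>R (outer v p1 + outer u1 a) + d *\<^sub>R (outer v p2 + outer u2 a) \<in> L"
    using assms sub by (simp add: minus_def subspace_add subspace_scale)
  then have "outer v (c *\<^sub>R p1 + d *\<^sub>R p2) + outer (c *\<^sub>R u1 + d *\<^sub>R u2) a \<in> L"
    by (simp add: outer_linear algebra_simps)
  then show ?thesis using assms by (simp add: minus_def inner_add_right inner_add_left)
qed

lemma minus_0: "minus 0 0"
  using sub by (simp add: minus_def outer_linear subspace_0)

text \<open>The line of v together with all first components is invariant under L. Indeed, if Y is
  the odd element belonging to u, then Y v = 2 u, so 2 X u = [X, Y] v + Y X v, and both terms lie in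
  that subspace.\<close>

lemma minus_surj1: assumes "a \<bullet> u = 0" shows "\<exists>\<pi>. minus u \<pi>"
proof -
  define U where "U = {x. \<exists>c u \<pi>. x = c *\<^sub>R v + u \<and> minus u \<pi>}"
  have U_I: "c *\<^sub>R v + u \<in> U" if "minus u \<pi>" for c u \<pi> using that unfolding U_def by blast
  have sU: "subspace U"
  proof (rule subspaceI)
    show "0 \<in> U" using U_I[OF minus_0, of 0] by simp
    fix x y c assume "x \<in> U"
    then obtain c1 u1 p1 where x: "x = c1 *\<^sub>R v + u1" "minus u1 p1" unfolding U_def by blast
    have "c *\<^sub>R x = (c * c1) *\<^sub>R v + (c *\<^sub>R u1 + 0 *\<^sub>R u1)" using x by (simp add: algebra_simps)
    then show "c *\<^sub>R x \<in> U" using U_I[OF minus_lin[OF x(2) x(2)]] by metis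
    assume "y \<in> U"
    then obtain c2 u2 p2 where y: "y = c2 *\<^sub>R v + u2" "minus u2 p2" unfolding U_def by blast
    have "x + y = (c1 + c2) *\<^sub>R v + (1 *\<^sub>R u1 + 1 *\<^sub>R u2)" using x y by (simp add: algebra_simps)
    then show "x + y \<in> U" using U_I[OF minus_lin[OF x(2) y(2)]] by metis
  qed
  have vU: "X *v v \<in> U" if "X \<in> L" for X
    using U_I[OF minus_part[OF that], of "a \<bullet> (X *v v) / 2"] by simp
  have "\<forall>X\<in>L. \<forall>x\<in>U. X *v x \<in> U"
  proof (intro ballI)
    fix X x assume X: "X \<in> L" and "x \<in> U"
    then obtain c u \<pi> where x: "x = c *\<^sub>R v + u" "minus u \<pi>" unfolding U_def by blast
    define Y where "Y = outer v \<pi> + outer u a"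
    have Y: "Y \<in> L" using x(2) by (simp add: minus_def Y_def)
    have Yv: "Y *v v = 2 *\<^sub>R u" using minusD[OF x(2)] av
      by (simp add: Y_def matrix_vector_mult_add_rdistrib)
    have "(X ** Y - Y ** X) *v v = 2 *\<^sub>R (X *v u) - ((\<pi> \<bullet> (X *v v)) *\<^sub>R v + (a \<bullet> (X *v v)) *\<^sub>R u)"
      by (simp add: matrix_vector_mult_diff_rdistrib matrix_vector_mul_assoc[symmetric] Yv matrix_vector_mult_scaleR)
        (simp add: Y_def matrix_vector_mult_add_rdistrib)
    then have "X *v u = (1 / 2) *\<^sub>R ((X ** Y - Y ** X) *v v + ((\<pi> \<bullet> (X *v v)) *\<^sub>R v + (a \<bullet> (X *v v)) *\<^sub>R u))"
      by (simp add: algebra_simps)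
    moreover have "(\<pi> \<bullet> (X *v v)) *\<^sub>R v + (a \<bullet> (X *v v)) *\<^sub>R u \<in> U"
    proof -
      have "minus ((a \<bullet> (X *v v)) *\<^sub>R u) ((a \<bullet> (X *v v)) *\<^sub>R \<pi>)"
        using minus_lin[OF x(2) x(2), of "a \<bullet> (X *v v)" 0] by simp
      then show ?thesis by (rule U_I)
    qed
    ultimately have "X *v u \<in> U"
      using vU[OF bracket[OF X Y]] sU by (simp add: subspace_add subspace_scale)
    then show "X *v x \<in> U" using vU[OF X] sU
      by (simp add: x(1) matrix_vector_right_distrib matrix_vector_mult_scaleR subspace_add subspace_scale)
  qed
  then have "U = {0} \<or> U = UNIV" by (rule irr[OF sU])
  moreover have "v \<in> U" using U_I[OF minus_0, of 1] by simp
  ultimately have "U = UNIV" using v_nz by blast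
  then obtain c u' \<pi> where u: "u = c *\<^sub>R v + u'" "minus u' \<pi>" unfolding U_def by blast
  have "c = 0" using assms minusD(1)[OF u(2)] av unfolding u(1) by (simp add: inner_add_right)
  then show ?thesis using u by auto
qed

end

lemma orthogonal_complement_trivial:
  assumes U: "subspace (U::(real^'n) set)" and "{y. \<forall>x\<in>U. x \<bullet> y = 0} = {0}"
  shows "U = UNIV"
proof -
  have "x \<in> U" for x
  proof -
    obtain y z where yz: "y \<in> span U" "\<And>w. w \<in> span U \<Longrightarrow> orthogonal z w" "x = y + z"
      by (rule orthogonal_subspace_decomp_exists[of U x], rule that)
    have "w \<bullet> z = 0" if "w \<in> U" for w
      using yz(2)[OF span_base[OF that]] by (simp add: orthogonal_def inner_commute)
    then have "z = 0" using assms(2) by blast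
    then show ?thesis using yz(1,3) span_minimal[OF _ U, of U] by auto
  qed
  then show ?thesis by blast
qed

text \<open>Transposition exchanges the roles of vectors and covectors, so each result about first
  components yields one about second components. It reverses products, whence the exchanged bracket;
  irreducibility passes to the dual by annihilators.\<close>

lemma lie_reflection_transpose:
  assumes "lie_reflection L a v"
  shows "lie_reflection (transpose ` L) v a"
proof -
  interpret lie_reflection L a v by fact
  show ?thesis
  proof
    show "subspace (transpose ` L)"
      using sub by (intro linear_subspace_image linearI) (simp_all add: transpose_add transpose_scalar)
    fix X Y assume "X \<in> transpose ` L" "Y \<in> transpose ` L"
    then obtain X' Y' where X: "X' \<in> L" "X = transpose X'" and Y: "Y' \<in> L" "Y = transpose Y'" by blast
    have "X ** Y - Y ** X = transpose (Y' ** X' - X' ** Y')"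
      by (simp add: X Y transpose_diff matrix_transpose_mul)
    then show "X ** Y - Y ** X \<in> transpose ` L" using bracket[OF Y(1) X(1)] by blast
    have "refl_mat v a ** X ** refl_mat v a = transpose (refl_mat a v ** X' ** refl_mat a v)"
      by (simp add: X matrix_transpose_mul transpose_refl_mat matrix_mul_assoc)
    then show "refl_mat v a ** X ** refl_mat v a \<in> transpose ` L" using conj[OF X(1)] by blast
  next
    show "v \<bullet> a = 2" by (rule va)
  next
    fix U :: "(real^'a) set" assume U: "subspace U" "\<forall>X\<in>transpose ` L. \<forall>x\<in>U. X *v x \<in> U"
    define U' where "U' = {y. \<forall>x\<in>U. x \<bullet> y = 0}"
    have U': "subspace U'" unfolding U'_def by (intro subspaceI) (auto simp: inner_add_right)
    have "\<forall>X\<in>L. \<forall>y\<in>U'. X *v y \<in> U'"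
    proof (intro ballI)
      fix X y assume X: "X \<in> L" and y: "y \<in> U'"
      have "x \<bullet> (X *v y) = 0" if "x \<in> U" for x
      proof -
        have "transpose X *v x \<in> U" using U(2) X that by blast
        then have "(x v* X) \<bullet> y = 0" using y by (simp add: U'_def)
        then show ?thesis by (simp add: dot_lmul_matrix)
      qed
      then show "X *v y \<in> U'" by (simp add: U'_def)
    qed
    from irr[OF U' this] show "U = {0} \<or> U = UNIV"
    proof
      assume "U' = {0}"
      then show ?thesis using orthogonal_complement_trivial[OF U(1)] unfolding U'_def by blast
    next
      assume "U' = UNIV"
      then have "x = 0" if "x \<in> U" for x proof -
        have "x \<in> U'" using \<open>U' = UNIV\<close> by simp
        then have "x \<bullet> x = 0" using that unfolding U'_def by blast
        then show ?thesis by simp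
      qed
      then show ?thesis using subspace_0[OF U(1)] by blast
    qed
  qed
qed

context lie_reflection
begin

interpretation T: lie_reflection "transpose ` L" v a
  using lie_reflection_transpose lie_reflection_axioms .

lemma minus_transpose: "T.minus \<pi> u \<longleftrightarrow> minus u \<pi>"
proof -
  have "outer a u + outer \<pi> v \<in> transpose ` L \<longleftrightarrow> outer v \<pi> + outer u a \<in> L"
  proof
    assume "outer a u + outer \<pi> v \<in> transpose ` L"
    then obtain X where "X \<in> L" "outer a u + outer \<pi> v = transpose X" by blast
    then have "transpose (outer a u + outer \<pi> v) \<in> L" by simp
    then show "outer v \<pi> + outer u a \<in> L" by (simp add: transpose_add add.commute)
  next
    assume "outer v \<pi> + outer u a \<in> L"
    then have "transpose (outer v \<pi> + outer u a) \<in> transpose ` L" by blast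
    then show "outer a u + outer \<pi> v \<in> transpose ` L" by (simp add: transpose_add add.commute)
  qed
  then show ?thesis by (auto simp: minus_def T.minus_def inner_commute)
qed

lemma minus_surj2: assumes "\<pi> \<bullet> v = 0" shows "\<exists>u. minus u \<pi>"
  using T.minus_surj1[of \<pi>] assms by (auto simp: minus_transpose inner_commute)

text \<open>Triple brackets with one element of the form v \<otimes> p1 separate the two components
  of every odd element.\<close>

lemma minus_split:
  assumes p1: "minus 0 p1" "p1 \<noteq> 0" and up: "minus u \<pi>"
  shows "minus 0 \<pi>"
proof -
  have main: "minus 0 \<pi>" if up: "minus u \<pi>" and k: "p1 \<bullet> u \<noteq> 0" for u \<pi>
  proof -
    define k where "k = p1 \<bullet> u"
    define Y where "Y = outer v \<pi> + outer u a"
    define Y1 where "Y1 = outer v p1"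
    define Z where "Z = Y1 ** Y - Y ** Y1"
    have L: "Y \<in> L" "Y1 \<in> L" using minusD(3)[OF up] minusD(3)[OF p1(1)] by (simp_all add: Y_def Y1_def outer_linear)
    then have Z: "Z \<in> L" unfolding Z_def by (intro bracket)
    have pv: "p1 \<bullet> v = 0" "\<pi> \<bullet> v = 0" "a \<bullet> u = 0" using minusD[OF p1(1)] minusD[OF up] by auto
    have Zeq: "Z = k *\<^sub>R outer v a - 2 *\<^sub>R outer u p1"
      unfolding Z_def Y_def Y1_def matrix_eq using pv av
      by (simp add: matrix_act k_def) (simp add: vec_eq_iff algebra_simps)
    \<comment> \<open>Up to a multiple of Y1, bracketing with Z multiplies v \<otimes> \<pi> by 2k
      and u \<otimes> a by -4k. Adding 4k Y removes the second component and leaves the factor 6k on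
      the first.\<close>
    have "(Z ** Y - Y ** Z) + (4 * k) *\<^sub>R Y = (6 * k) *\<^sub>R outer v \<pi> + (2 * (\<pi> \<bullet> u)) *\<^sub>R outer v p1"
      unfolding Zeq Y_def matrix_eq using pv av
      by (simp add: matrix_act k_def) (simp add: vec_eq_iff algebra_simps)
    then have "outer v \<pi> = (1 / (6 * k)) *\<^sub>R ((Z ** Y - Y ** Z) + (4 * k) *\<^sub>R Y - (2 * (\<pi> \<bullet> u)) *\<^sub>R Y1)"
      using k by (simp add: k_def Y1_def)
    also have "\<dots> \<in> L"
      by (rule subspace_scale[OF sub], rule subspace_diff[OF sub], rule subspace_add[OF sub])
        (use bracket[OF Z L(1)] L sub in \<open>simp_all add: subspace_scale\<close>)
    finally show ?thesis using pv by (simp add: minus_def outer_linear)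
  qed
  show ?thesis
  proof (cases "p1 \<bullet> u = 0")
    case False then show ?thesis using main up by blast
  next
    case True
    \<comment> \<open>When p1 kills u, shift by an element with nonzero pairing. This one is p1,
      read as a vector, projected to the kernel of \<open>a\<close> along v; as p1 kills v, its
      pairing with p1 is p1 \<bullet> p1.\<close>
    define u0 where "u0 = p1 - ((a \<bullet> p1) / 2) *\<^sub>R v"
    have "a \<bullet> u0 = 0" using av by (simp add: u0_def inner_diff_right)
    then obtain p0 where p0: "minus u0 p0" using minus_surj1 by blast
    have "p1 \<bullet> u0 = p1 \<bullet> p1" using minusD(2)[OF p1(1)] by (simp add: u0_def inner_diff_right)
    then have k0: "p1 \<bullet> u0 \<noteq> 0" using p1(2) by simp
    have s: "minus (u + u0) (\<pi> + p0)" using minus_lin[OF up p0, of 1 1] by simp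
    have "minus 0 (\<pi> + p0)" using main[OF s] k0 True by (simp add: inner_add_right)
    moreover have "minus 0 p0" using main[OF p0 k0] .
    ultimately show ?thesis using minus_lin[of 0 "\<pi> + p0" 0 p0 1 "-1"] by simp
  qed
qed

section \<open>The case in which L contains all traceless matrices\<close>

text \<open>These matrices of rank one span sl(V), and each of them is the direction of a
  transvection. The condition does not mention \<open>a\<close> and v, so it can be passed from one
  root to another.\<close>

definition full :: bool where "full \<longleftrightarrow> (\<forall>x \<xi>. \<xi> \<bullet> x = 0 \<longrightarrow> outer x \<xi> \<in> L)"

text \<open>By \<open>minus_split\<close> both components of every odd element lie in L, and
  brackets of a first with a second component give the matrices u \<otimes> \<pi>, corrected by a
  multiple of v \<otimes> a.\<close>

lemma full_if_minus_0:
  assumes p1: "minus 0 p1" "p1 \<noteq> 0" shows full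
  unfolding full_def
proof (intro allI impI)
  fix x \<xi> :: "real^'n" assume "\<xi> \<bullet> x = 0"
  have vp: "outer v \<pi> \<in> L" if pv: "\<pi> \<bullet> v = 0" for \<pi>
  proof -
    obtain u where "minus u \<pi>" using minus_surj2[OF pv] by blast
    from minusD(3)[OF minus_split[OF p1 this]] show ?thesis by (simp add: outer_linear)
  qed
  have ua: "outer u a \<in> L" if au: "a \<bullet> u = 0" for u
  proof -
    obtain \<pi> where p: "minus u \<pi>" using minus_surj1[OF au] by blast
    have "outer v \<pi> + outer u a - outer v \<pi> \<in> L"
      using minusD(3)[OF p] vp[OF minusD(2)[OF p]] sub by (intro subspace_diff)
    then show ?thesis by simp
  qed
  define c where "c = (a \<bullet> x) / 2"
  define e where "e = (\<xi> \<bullet> v) / 2"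
  define u where "u = x - c *\<^sub>R v"
  define \<pi> where "\<pi> = \<xi> - e *\<^sub>R a"
  have au: "a \<bullet> u = 0" and pv: "\<pi> \<bullet> v = 0" using av by (simp_all add: u_def \<pi>_def c_def e_def inner_diff_right inner_diff_left)
  have x: "x = c *\<^sub>R v + u" and xi: "\<xi> = e *\<^sub>R a + \<pi>" by (simp_all add: u_def \<pi>_def)
  have "outer u a ** outer v \<pi> - outer v \<pi> ** outer u a \<in> L" by (intro bracket ua vp au pv)
  moreover have "outer u a ** outer v \<pi> - outer v \<pi> ** outer u a = 2 *\<^sub>R outer u \<pi> - (\<pi> \<bullet> u) *\<^sub>R outer v a"
    unfolding matrix_eq using av by (simp add: matrix_act) (simp add: vec_eq_iff algebra_simps inner_commute)
  \<comment> \<open>As x \<otimes> \<xi> has trace zero, the correction in the bracket is exactly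
    the multiple of v \<otimes> a that its expansion requires.\<close>
  moreover have "\<pi> \<bullet> u = - 2 * (c * e)"
    using \<open>\<xi> \<bullet> x = 0\<close> au pv av unfolding x xi by (simp add: inner_add_left inner_add_right algebra_simps)
  ultimately have "2 *\<^sub>R (outer u \<pi> + (c * e) *\<^sub>R outer v a) \<in> L" by (simp add: algebra_simps)
  then have "(1/2) *\<^sub>R (2 *\<^sub>R (outer u \<pi> + (c * e) *\<^sub>R outer v a)) \<in> L" using sub subspace_scale by blast
  then have "(outer u \<pi> + (c * e) *\<^sub>R outer v a) + (c *\<^sub>R outer v \<pi> + e *\<^sub>R outer u a) \<in> L"
    using ua[OF au] vp[OF pv] sub by (simp add: subspace_add subspace_scale)
  moreover have "outer x \<xi> = (outer u \<pi> + (c * e) *\<^sub>R outer v a) + (c *\<^sub>R outer v \<pi> + e *\<^sub>R outer u a)"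
    unfolding x xi by (simp add: outer_linear algebra_simps)
  ultimately show "outer x \<xi> \<in> L" by simp
qed

end

context lie_reflection
begin

interpretation T: lie_reflection "transpose ` L" v a
  using lie_reflection_transpose lie_reflection_axioms .

lemma full_transpose: "T.full \<Longrightarrow> full"
proof -
  assume f: T.full
  show full unfolding full_def
  proof (intro allI impI)
    fix x \<xi> :: "real^'n" assume "\<xi> \<bullet> x = 0"
    then have "outer \<xi> x \<in> transpose ` L" using f unfolding T.full_def by (simp add: inner_commute)
    then obtain X where "X \<in> L" "outer \<xi> x = transpose X" by blast
    then have "transpose (outer \<xi> x) \<in> L" by simp
    then show "outer x \<xi> \<in> L" by simp
  qed
qed

lemma full_if_minus_0': "minus u1 0 \<Longrightarrow> u1 \<noteq> 0 \<Longrightarrow> full"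
  using T.full_if_minus_0[of u1] full_transpose by (simp add: minus_transpose)

text \<open>Let w be the defect of symmetry. A triple bracket produces w v \<otimes> p1 in L up to a
  factor, and a nonzero element of this shape would make L full.\<close>

lemma minus_symmetric:
  assumes nf: "\<not> full" and 1: "minus u1 p1" and 2: "minus u2 p2"
  shows "p1 \<bullet> u2 = p2 \<bullet> u1"
proof -
  define w where "w = p1 \<bullet> u2 - p2 \<bullet> u1"
  define Y1 where "Y1 = outer v p1 + outer u1 a"
  define Y2 where "Y2 = outer v p2 + outer u2 a"
  define Z where "Z = Y1 ** Y2 - Y2 ** Y1"
  note d = minusD[OF 1] minusD[OF 2]
  have L: "Y1 \<in> L" "Y2 \<in> L" using d by (simp_all add: Y1_def Y2_def)
  then have Z: "Z \<in> L" unfolding Z_def by (intro bracket)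
  have Zeq: "Z = 2 *\<^sub>R (outer u1 p2 - outer u2 p1) + w *\<^sub>R outer v a"
    unfolding Z_def Y1_def Y2_def matrix_eq using d(1,2,4,5) av
    by (simp add: matrix_act w_def) (simp add: vec_eq_iff algebra_simps)
  \<comment> \<open>The multiples of Y1 and Y2 are chosen to cancel the part of [Z, Y1] that
    involves u1 and u2. The remaining terms cancel except for three contributions 2w.\<close>
  have "(Z ** Y1 - Y1 ** Z) - (2 * (p2 \<bullet> u1) - 2 * w) *\<^sub>R Y1 + (2 * (p1 \<bullet> u1)) *\<^sub>R Y2 = (6 * w) *\<^sub>R outer v p1"
    unfolding Zeq Y1_def Y2_def matrix_eq using d(1,2,4,5) av
    by (simp add: matrix_act w_def) (simp add: vec_eq_iff algebra_simps)
  moreover have "(Z ** Y1 - Y1 ** Z) - (2 * (p2 \<bullet> u1) - 2 * w) *\<^sub>R Y1 + (2 * (p1 \<bullet> u1)) *\<^sub>R Y2 \<in> L"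
    by (rule subspace_add[OF sub], rule subspace_diff[OF sub])
      (use bracket[OF Z L(1)] L sub in \<open>simp_all add: subspace_scale\<close>)
  ultimately have "minus 0 ((6 * w) *\<^sub>R p1)" using d(2) by (simp add: minus_def outer_linear)
  then have "(6 * w) *\<^sub>R p1 = 0" using full_if_minus_0 nf by blast
  then have "w = 0 \<or> p1 = 0" by simp
  moreover have "w = 0" if "p1 = 0"
  proof -
    have "u1 = 0" using full_if_minus_0'[of u1] 1 nf that by blast
    then show ?thesis using that by (simp add: w_def)
  qed
  ultimately show ?thesis by (auto simp: w_def)
qed

lemma wedge_minus:
  assumes nf: "\<not> full" and 1: "minus u1 p1" and 2: "minus u2 p2"
  shows "outer u1 p2 - outer u2 p1 \<in> L"
proof -
  define Y1 where "Y1 = outer v p1 + outer u1 a"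
  define Y2 where "Y2 = outer v p2 + outer u2 a"
  note d = minusD[OF 1] minusD[OF 2]
  have L: "Y1 \<in> L" "Y2 \<in> L" using d by (simp_all add: Y1_def Y2_def)
  then have "(1/2) *\<^sub>R (Y1 ** Y2 - Y2 ** Y1) \<in> L" by (simp only: subspace_scale[OF sub] bracket)
  moreover have "(1/2) *\<^sub>R (Y1 ** Y2 - Y2 ** Y1) = outer u1 p2 - outer u2 p1"
    unfolding Y1_def Y2_def matrix_eq using d(1,2,4,5) av
    by (simp add: matrix_act minus_symmetric[OF assms]) (simp add: vec_eq_iff algebra_simps)
  ultimately show ?thesis by simp
qed

end

section \<open>The invariant form in the remaining case\<close>

lemma symmetric_matrix_iff: "transpose (B::real^'n^'n) = B \<longleftrightarrow> (\<forall>x y. x \<bullet> (B *v y) = y \<bullet> (B *v x))"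
proof
  assume "transpose B = B"
  then show "\<forall>x y. x \<bullet> (B *v y) = y \<bullet> (B *v x)"
    using inner_matrix_transpose[of B] by (metis inner_commute)
next
  assume *: "\<forall>x y. x \<bullet> (B *v y) = y \<bullet> (B *v x)"
  have "(transpose B *v x) \<bullet> y = (B *v x) \<bullet> y" for x y
    using *[rule_format, of x y] inner_commute[of "B *v x" y] by (simp add: dot_lmul_matrix)
  then have "transpose B *v x = B *v x" for x
    by (metis vector_eq_rdot)
  then show "transpose B = B" by (simp add: matrix_eq)
qed

lemma matrix_eq_inner: "A = (B::real^'n^'n) \<longleftrightarrow> (\<forall>x y. x \<bullet> (A *v y) = x \<bullet> (B *v y))"
  by (metis matrix_eq vector_eq_ldot)

definition lie_invariant :: "(real^'n^'n) set \<Rightarrow> real^'n^'n \<Rightarrow> bool" where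
  "lie_invariant L B \<longleftrightarrow> (\<forall>X\<in>L. \<forall>x y. (X *v x) \<bullet> (B *v y) + x \<bullet> (B *v (X *v y)) = 0)"

text \<open>The endomorphism z \<mapsto> B(y, z) x - B(x, z) y. For B symmetric and nondegenerate,
  these span the orthogonal Lie algebra of B.\<close>

definition wedge :: "real^'n^'n \<Rightarrow> real^'n \<Rightarrow> real^'n \<Rightarrow> real^'n^'n" where
  "wedge B x y = outer x (B *v y) - outer y (B *v x)"

lemma trace_transpose: "trace (transpose A) = trace (A::real^'n^'n)"
  by (simp add: trace_def transpose_def)

context lie_reflection
begin

text \<open>The odd part of L is the graph of a symmetric map \<phi> from the kernel of
  \<open>a\<close> to the annihilator of v, and B extends \<phi>. The last clause, uniqueness among
  L-invariant forms, is there to compare the forms obtained from different reflections.\<close>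

lemma form_exists:
  assumes nf: "\<not> full" and tr: "\<And>X. X \<in> L \<Longrightarrow> trace X = 0"
  shows "\<exists>B. transpose B = B \<and> (\<forall>x. B *v x = 0 \<longrightarrow> x = 0) \<and> B *v v = - a \<and> (\<forall>x y. wedge B x y \<in> L)
     \<and> lie_invariant L B \<and> (\<forall>C. transpose C = C \<longrightarrow> lie_invariant L C \<longrightarrow> (\<exists>c. C = c *\<^sub>R B))"
proof -
  have uniq: "p = p'" if "minus u p" "minus u p'" for u p p'
  proof -
    have "minus 0 (p - p')" using minus_lin[OF that, of 1 "-1"] by simp
    then show ?thesis using full_if_minus_0[of "p - p'"] nf by auto
  qed
  define \<phi> where "\<phi> u = (THE p. minus u p)" for u
  have phiI: "\<phi> u = p" if "minus u p" for u p
    unfolding \<phi>_def using that uniq by blast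
  have phi: "minus u (\<phi> u)" if "a \<bullet> u = 0" for u
    using minus_surj1[OF that] phiI by blast
  define P where "P x = x - (a \<bullet> x / 2) *\<^sub>R v" for x
  have aP: "a \<bullet> P x = 0" for x using av by (simp add: P_def inner_diff_right)
  have x_eq: "x = (a \<bullet> x / 2) *\<^sub>R v + P x" for x by (simp add: P_def)
  \<comment> \<open>The value -a at v is what makes the odd element belonging to u equal to
    \<open>wedge B v u\<close>.\<close>
  define f where "f x = \<phi> (P x) - (a \<bullet> x / 2) *\<^sub>R a" for x
  have "linear f"
  proof (rule linearI)
    fix x y
    have "minus (P (x + y)) (\<phi> (P x) + \<phi> (P y))"
      using minus_lin[OF phi[OF aP[of x]] phi[OF aP[of y]], of 1 1]
      by (simp add: P_def inner_add_right algebra_simps add_divide_distrib)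
    then show "f (x + y) = f x + f y"
      by (simp add: f_def phiI inner_add_right algebra_simps add_divide_distrib)
  next
    fix c x
    have "minus (P (c *\<^sub>R x)) (c *\<^sub>R \<phi> (P x))"
      using minus_lin[OF phi[OF aP[of x]] phi[OF aP[of x]], of c 0]
      by (simp add: P_def algebra_simps)
    then show "f (c *\<^sub>R x) = c *\<^sub>R f x"
      by (simp add: f_def phiI algebra_simps)
  qed
  define B where "B = matrix f"
  have B: "B *v x = \<phi> (P x) - (a \<bullet> x / 2) *\<^sub>R a" for x
    using matrix_works[of f x] \<open>linear f\<close> unfolding B_def f_def linear_matrix_vector_mul_eq
    by (simp add: f_def)
  have Pv: "P v = 0" using av by (simp add: P_def)
  have Bv: "B *v v = - a" using av phiI[OF minus_0] by (simp add: B Pv)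
  have Pu: "P u = u" if "a \<bullet> u = 0" for u using that by (simp add: P_def)
  have Bu: "B *v u = \<phi> u" if "a \<bullet> u = 0" for u using that by (simp add: B Pu)
  have phv: "\<phi> u \<bullet> v = 0" if "a \<bullet> u = 0" for u using minusD(2)[OF phi[OF that]] .
  have inB: "x \<bullet> (B *v y) = P x \<bullet> \<phi> (P y) - (a \<bullet> x) * (a \<bullet> y) / 2" for x y
  proof -
    have "x \<bullet> (B *v y) = ((a \<bullet> x / 2) *\<^sub>R v + P x) \<bullet> (\<phi> (P y) - (a \<bullet> y / 2) *\<^sub>R a)"
      using x_eq[of x] by (simp add: B)
    also have "\<dots> = P x \<bullet> \<phi> (P y) - (a \<bullet> x) * (a \<bullet> y) / 2"
    proof -
      have "v \<bullet> \<phi> (P y) = 0" "P x \<bullet> a = 0"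
        using phv[OF aP[of y]] aP[of x] by (simp_all add: inner_commute)
      then show ?thesis using va
        by (simp only: inner_add_left inner_diff_right inner_scaleR_left inner_scaleR_right)
          (simp add: field_simps)
    qed
    finally show ?thesis .
  qed
  have sym: "transpose B = B"
    unfolding symmetric_matrix_iff inB
    using minus_symmetric[OF nf phi[OF aP] phi[OF aP]] by (simp add: inner_commute)
  note symD = sym[unfolded symmetric_matrix_iff, rule_format]
  have inj: "x = 0" if "B *v x = 0" for x
  proof -
    have "v \<bullet> (B *v x) = - (a \<bullet> x)" using symD[of v x] Bv by (simp add: inner_commute)
    then have ax: "a \<bullet> x = 0" using that by simp
    then have "minus x 0" using phi[OF ax] Bu[OF ax] that by simp
    then show ?thesis using full_if_minus_0' nf by blast
  qed
  have wedge: "wedge B x y \<in> L" for x y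
  proof -
    define c d u w where "c = a \<bullet> x / 2" and "d = a \<bullet> y / 2" and "u = P x" and "w = P y"
    note mu = phi[OF aP[of x]] and mw = phi[OF aP[of y]]
    have "c *\<^sub>R (outer v (\<phi> w) + outer w a) - d *\<^sub>R (outer v (\<phi> u) + outer u a) + (outer u (\<phi> w) - outer w (\<phi> u)) \<in> L"
      using minusD(3)[OF mu] minusD(3)[OF mw] wedge_minus[OF nf mu mw]
      unfolding u_def w_def
      by (intro subspace_add[OF sub, of "_ - _"] subspace_diff[OF sub, of "_ *\<^sub>R _"] subspace_scale[OF sub])
    moreover have "wedge B x y = c *\<^sub>R (outer v (\<phi> w) + outer w a) - d *\<^sub>R (outer v (\<phi> u) + outer u a) + (outer u (\<phi> w) - outer w (\<phi> u))"
    proof -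
      have "wedge B x y = outer (c *\<^sub>R v + u) (\<phi> w - d *\<^sub>R a) - outer (d *\<^sub>R v + w) (\<phi> u - c *\<^sub>R a)"
        unfolding wedge_def B using x_eq[of x] x_eq[of y] by (simp add: c_def d_def u_def w_def)
      then show ?thesis by (simp add: outer_linear algebra_simps)
    qed
    ultimately show ?thesis by simp
  qed
  have minus_wedge: "outer v (\<phi> u) + outer u a = wedge B v u" if "a \<bullet> u = 0" for u
    using that by (simp add: wedge_def Bv Bu outer_linear)
  have inv_wedge: "(wedge B p q *v x) \<bullet> (B *v y) + x \<bullet> (B *v (wedge B p q *v y)) = 0" for p q x y
    using symD[of p y] symD[of q y] symD[of p x] symD[of q x]
    by (simp add: wedge_def matrix_act inner_diff_left inner_commute[of "B *v _"])
  have inv: "(X *v x) \<bullet> (B *v y) + x \<bullet> (B *v (X *v y)) = 0" if X: "X \<in> L" for X x y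
  proof -
    define s where "s = refl_mat a v"
    \<comment> \<open>Twice the even part of X. It commutes with s, so it preserves the line of v
      and, dually, the line of \<open>a\<close>, with the same eigenvalue z.\<close>
    define Z where "Z = X + s ** X ** s"
    have Z: "Z \<in> L" using X conj[OF X] subspace_add[OF sub] by (simp add: Z_def s_def)
    have ss: "s ** s = mat 1" using av by (simp add: s_def refl_mat_square)
    have sZ: "s ** Z = Z ** s"
    proof -
      have "s ** (s ** X ** s) = X ** s" "s ** X ** s ** s = s ** X"
        using ss by (simp_all add: matrix_mul_assoc) (simp add: matrix_mul_assoc[symmetric])
      then show ?thesis by (simp add: Z_def matrix_distrib matrix_mul_assoc)
    qed
    define z where "z = a \<bullet> (Z *v v) / 2"
    have comm: "Z *v x - (a \<bullet> (Z *v x)) *\<^sub>R v = Z *v x - (a \<bullet> x) *\<^sub>R (Z *v v)" for x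
    proof -
      have "s *v (Z *v x) = Z *v (s *v x)" using sZ by (simp add: matrix_vector_mul_assoc)
      then show ?thesis by (simp add: s_def matrix_act)
    qed
    have "2 *\<^sub>R (Z *v v) = (2 * z) *\<^sub>R v" using comm[of v] av by (simp add: z_def)
    then have "(1/2) *\<^sub>R (2 *\<^sub>R (Z *v v)) = (1/2) *\<^sub>R ((2 * z) *\<^sub>R v)" by simp
    then have Zv: "Z *v v = z *\<^sub>R v" by simp
    have aZ: "a \<bullet> (Z *v x) = z * (a \<bullet> x)" for x
      using comm[of x] v_nz by (simp add: Zv mult.commute)
    \<comment> \<open>Bracketing with Z maps odd elements to odd elements. Since these form the
      graph of \<phi>, this is an equation for B: infinitesimally, Z is a similitude with factor
      2z.\<close>
    have BZ: "B *v (Z *v u) + transpose Z *v (B *v u) = (2 * z) *\<^sub>R (B *v u)" if au: "a \<bullet> u = 0" for u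
    proof -
      define Y where "Y = outer v (\<phi> u) + outer u a"
      have Y: "Y \<in> L" using minusD(3)[OF phi[OF au]] by (simp add: Y_def)
      have "Z ** Y - Y ** Z = outer v (z *\<^sub>R \<phi> u - transpose Z *v \<phi> u) + outer (Z *v u - z *\<^sub>R u) a"
        unfolding matrix_eq using aZ
        by (simp add: Y_def matrix_act Zv inner_diff_left dot_lmul_matrix) (simp add: vec_eq_iff algebra_simps)
      then have "outer v (z *\<^sub>R \<phi> u - transpose Z *v \<phi> u) + outer (Z *v u - z *\<^sub>R u) a \<in> L"
        using bracket[OF Z Y] by simp
      moreover have "a \<bullet> (Z *v u - z *\<^sub>R u) = 0" using au by (simp add: inner_diff_right aZ)
      moreover have "(z *\<^sub>R \<phi> u - transpose Z *v \<phi> u) \<bullet> v = 0"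
        using phv[OF au] by (simp add: inner_diff_left dot_lmul_matrix Zv)
      ultimately have "minus (Z *v u - z *\<^sub>R u) (z *\<^sub>R \<phi> u - transpose Z *v \<phi> u)" unfolding minus_def by blast
      from phiI[OF this] have "B *v (Z *v u - z *\<^sub>R u) = z *\<^sub>R \<phi> u - transpose Z *v \<phi> u"
        using Bu au by (simp add: aZ inner_diff_right)
      then have "B *v (Z *v u) - z *\<^sub>R (B *v u) = z *\<^sub>R (B *v u) - transpose Z *v (B *v u)"
        using Bu[OF au] by (simp add: matrix_act del: transpose_matrix_vector)
      then have "B *v (Z *v u) + transpose Z *v (B *v u) = z *\<^sub>R (B *v u) + z *\<^sub>R (B *v u)"
        by (simp add: diff_eq_eq eq_diff_eq add.commute add.left_commute del: transpose_matrix_vector)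
      then show ?thesis by (simp only: mult_2 scaleR_add_left)
    qed
    have BZv: "B *v (Z *v v) + transpose Z *v (B *v v) = (2 * z) *\<^sub>R (B *v v)"
    proof -
      have "(transpose Z *v a) \<bullet> x = (z *\<^sub>R a) \<bullet> x" for x using aZ by (simp add: dot_lmul_matrix)
      then have "transpose Z *v a = z *\<^sub>R a" by (metis vector_eq_rdot)
      then have "transpose Z *v (- a) = - (z *\<^sub>R a)"
        using matrix_vector_mult_scaleR[of "transpose Z" "-1" a] by (simp del: transpose_matrix_vector)
      then have "B *v (Z *v v) + transpose Z *v (B *v v) = z *\<^sub>R (- a) + z *\<^sub>R (- a)"
        unfolding Zv matrix_vector_mult_scaleR Bv by simp
      then show ?thesis by (simp only: mult_2 scaleR_add_left Bv)
    qed
    have BZall: "B ** Z + transpose Z ** B = (2 * z) *\<^sub>R B"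
    proof -
      define D where "D = B ** Z + transpose Z ** B - (2 * z) *\<^sub>R B"
      have "D *v u = 0" if "a \<bullet> u = 0" for u
        using BZ[OF that] by (simp add: D_def matrix_act del: transpose_matrix_vector)
      moreover have "D *v v = 0" using BZv by (simp add: D_def matrix_act del: transpose_matrix_vector)
      ultimately have "D *v x = 0" for x
        using x_eq[of x] aP[of x] by (metis add.right_neutral matrix_vector_mult_scaleR matrix_vector_right_distrib scaleR_zero_right)
      then have "D = 0" by (simp add: matrix_eq)
      then show ?thesis by (simp add: D_def)
    qed
    \<comment> \<open>Multiplying the similitude equation by the inverse of B and taking traces
      gives 2 tr Z = 2 z n, and the trace of Z is zero.\<close>
    have "z = 0"
    proof -
      obtain B' where B': "B' ** B = mat 1"
        using inj matrix_left_invertible_ker[of B] by blast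
      then have B'2: "B ** B' = mat 1" using matrix_left_right_inverse[of B' B] by simp
      have "B' ** (B ** Z) + B' ** (transpose Z ** B) = (2 * z) *\<^sub>R mat 1"
        using arg_cong[OF BZall, of "\<lambda>M. B' ** M"] B' by (simp add: matrix_distrib)
      then have "trace (B' ** (B ** Z)) + trace (B' ** (transpose Z ** B)) = 2 * z * real CARD('n)"
        by (metis trace_add trace_scaleR trace_I)
      moreover have "B' ** (B ** Z) = Z" using B' by (simp add: matrix_mul_assoc)
      moreover have "trace (B' ** (transpose Z ** B)) = trace Z"
        using trace_mul_sym[of B' "transpose Z ** B"] B'2 by (simp add: matrix_mul_assoc[symmetric] trace_transpose)
      ultimately have "2 * z * real CARD('n) = 0" using tr[OF Z] by simp
      then show ?thesis by simp
    qed
    have invZ: "(Z *v x) \<bullet> (B *v y) + x \<bullet> (B *v (Z *v y)) = 0" for x y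
    proof -
      have "B *v (Z *v y) + transpose Z *v (B *v y) = 0"
        using arg_cong[OF BZall, of "\<lambda>M. M *v y"] \<open>z = 0\<close> by (simp add: matrix_act del: transpose_matrix_vector)
      then have "x \<bullet> (B *v (Z *v y)) + x \<bullet> (transpose Z *v (B *v y)) = 0"
        by (metis inner_add_right inner_zero_right)
      then show ?thesis by (simp only: inner_matrix_transpose)
    qed
    define u where "u = X *v v - (a \<bullet> (X *v v) / 2) *\<^sub>R v"
    have mu: "minus u (a v* X - (a \<bullet> (X *v v) / 2) *\<^sub>R a)" unfolding u_def by (rule minus_part[OF X])
    have "X - s ** X ** s = wedge B v u"
      using minus_wedge[OF minusD(1)[OF mu]] phiI[OF mu]
      unfolding matrix_eq using av
      by (simp add: matrix_act dot_lmul_matrix inner_diff_left s_def) (simp add: u_def vec_eq_iff algebra_simps)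
    then have "2 *\<^sub>R X = Z + wedge B v u" unfolding Z_def by (simp add: scaleR_2 algebra_simps)
    then have "X *v x = (1/2) *\<^sub>R (Z *v x + wedge B v u *v x)" for x
      by (metis matrix_vector_mult_add_rdistrib scaleR_half_double scaleR_2 scaleR_matrix_vector_assoc)
    then have "(X *v x) \<bullet> (B *v y) + x \<bullet> (B *v (X *v y))
      = ((Z *v x) \<bullet> (B *v y) + x \<bullet> (B *v (Z *v y))) / 2
       + ((wedge B v u *v x) \<bullet> (B *v y) + x \<bullet> (B *v (wedge B v u *v y))) / 2"
      by (simp add: matrix_vector_mult_scaleR matrix_vector_right_distrib inner_add_left inner_add_right add_divide_distrib)
    then show ?thesis unfolding invZ inv_wedge by simp
  qed
  \<comment> \<open>Odd elements send v to 2u and each h in the kernel of \<open>a\<close> to a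
    multiple of v, so an invariant form is determined by its value at (v, v). The constant c
    compares that value with B(v, v) = -2.\<close>
  have uniqC: "\<exists>c. C = c *\<^sub>R B" if C: "transpose C = C" "lie_invariant L C" for C
  proof -
    note symC = C(1)[unfolded symmetric_matrix_iff, rule_format]
    define c where "c = - (v \<bullet> (C *v v)) / 2"
    have 1: "u \<bullet> (C *v v) = 0" "u \<bullet> (C *v h) = c * (u \<bullet> (B *v h))" if au: "a \<bullet> u = 0" and ah: "a \<bullet> h = 0" for u h
    proof -
      define Y where "Y = outer v (\<phi> u) + outer u a"
      have Y: "Y \<in> L" using minusD(3)[OF phi[OF au]] by (simp add: Y_def)
      have Yv: "Y *v v = 2 *\<^sub>R u" and Yh: "Y *v h = (\<phi> u \<bullet> h) *\<^sub>R v"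
        using phv[OF au] av ah by (simp_all add: Y_def matrix_act)
      have i: "(Y *v x) \<bullet> (C *v y) + x \<bullet> (C *v (Y *v y)) = 0" for x y
        using C(2) Y unfolding lie_invariant_def by blast
      show "u \<bullet> (C *v v) = 0" using i[of v v] symC[of u v] by (simp add: Yv matrix_vector_mult_scaleR)
      have "2 * (u \<bullet> (C *v h)) + (\<phi> u \<bullet> h) * (v \<bullet> (C *v v)) = 0"
        using i[of v h] by (simp add: Yv Yh matrix_vector_mult_scaleR)
      moreover have "\<phi> u \<bullet> h = u \<bullet> (B *v h)" using symD[of h u] Bu[OF au] by (simp add: inner_commute)
      ultimately show "u \<bullet> (C *v h) = c * (u \<bullet> (B *v h))" by (simp add: c_def field_simps)
    qed
    have 2: "u \<bullet> (B *v v) = 0" if "a \<bullet> u = 0" for u using that by (simp add: Bv inner_commute)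
    have vB: "v \<bullet> (B *v v) = - 2" using va by (simp add: Bv)
    have "x \<bullet> (C *v y) = x \<bullet> ((c *\<^sub>R B) *v y)" for x y
    proof -
      define d e u w where "d = a \<bullet> x / 2" and "e = a \<bullet> y / 2" and "u = P x" and "w = P y"
      have xy: "x = d *\<^sub>R v + u" "y = e *\<^sub>R v + w" using x_eq by (simp_all add: d_def e_def u_def w_def)
      have uw: "a \<bullet> u = 0" "a \<bullet> w = 0" using aP by (simp_all add: u_def w_def)
      have "x \<bullet> (C *v y) = d * e * (v \<bullet> (C *v v)) + c * (u \<bullet> (B *v w))"
        unfolding xy using 1[OF uw] 1(1)[OF uw(2,1)] symC[of w v]
        by (simp add: matrix_act inner_add_left algebra_simps)
      also have "v \<bullet> (C *v v) = c * (v \<bullet> (B *v v))" using vB by (simp add: c_def)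
      also have "d * e * (c * (v \<bullet> (B *v v))) + c * (u \<bullet> (B *v w)) = c * (x \<bullet> (B *v y))"
        unfolding xy using 2[OF uw(1)] 2[OF uw(2)] symD[of w v]
        by (simp add: matrix_act inner_add_left algebra_simps)
      finally show ?thesis by (simp add: scaleR_matrix_vector_assoc[symmetric])
    qed
    then show ?thesis using matrix_eq_inner by blast
  qed
  show ?thesis
    using sym inj Bv wedge inv uniqC unfolding lie_invariant_def by blast
qed

end

section \<open>Groups generated by reflections\<close>

lemma matrix_span_outer:
  assumes S: "subspace S" and "\<And>x y. outer x y \<in> (S :: (real^'n^'n) set)"
  shows "S = UNIV"
proof -
  have "A \<in> S" for A
  proof -
    have "A $ i $ j * (axis j 1 :: real^'n) $ k = (if k = j then A $ i $ j else 0)" for i j k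
      by (simp add: axis_def)
    then have "(\<Sum>j\<in>UNIV. outer (column j A) (axis j 1)) $ i $ k = A $ i $ k" for i k
      by (simp add: outer_def column_def)
    then have A: "A = (\<Sum>j\<in>UNIV. outer (column j A) (axis j 1))" by (simp add: vec_eq_iff)
    show ?thesis by (subst A) (rule subspace_sum[OF S assms(2)])
  qed
  then show ?thesis by blast
qed

lemma finite_if_finite_coordinates:
  fixes Y :: "('a::euclidean_space) set"
  assumes "span G = UNIV" and fin: "\<And>g. g \<in> G \<Longrightarrow> finite ((\<lambda>y. y \<bullet> g) ` Y)"
  shows "finite Y"
proof -
  obtain B where B: "B \<subseteq> G" "independent B" "G \<subseteq> span B" using maximal_independent_subset[of G] by blast
  have spB: "span B = UNIV" using B(3) assms(1) span_mono span_span by (metis top.extremum_uniqueI)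
  have fB: "finite B" using B(2) independent_bound by blast
  define f where "f y = (\<lambda>g\<in>B. y \<bullet> g)" for y
  have "f ` Y \<subseteq> PiE B (\<lambda>g. (\<lambda>y. y \<bullet> g) ` Y)" by (auto simp: f_def)
  moreover have "finite (PiE B (\<lambda>g. (\<lambda>y. y \<bullet> g) ` Y))"
    using fB fin B(1) by (intro finite_PiE) auto
  ultimately have "finite (f ` Y)" using finite_subset by blast
  moreover have "inj_on f Y"
  proof (rule inj_onI)
    fix x y assume "f x = f y"
    then have "f x g = f y g" for g by simp
    then have eq: "(x - y) \<bullet> g = 0" if "g \<in> B" for g
      using that by (metis f_def inner_diff_left restrict_apply' right_minus_eq)
    have "orthogonal (x - y) (x - y)"
      by (rule orthogonal_to_span[of _ B]) (use eq spB in \<open>auto simp: orthogonal_def\<close>)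
    then show "x = y" by (simp add: orthogonal_def)
  qed
  ultimately show ?thesis by (rule finite_imageD)
qed

lemma inner_outer: "outer w b \<bullet> outer a v = (w \<bullet> a) * (b \<bullet> v)"
  by (simp add: inner_vec_def outer_def sum_product) (intro sum.cong HOL.refl, simp)

section \<open>Finitely many pairings force finitely many reflections\<close>

text \<open>A reflection determines its root only up to replacing (a, v) by (c a, v / c), and
  \<open>roots\<close> contains all these pairs. Finiteness is therefore stated for v \<otimes> a
  and for the pairings, which do not change. Irreducibility is required under the reflections in
  \<Gamma>.\<close>

locale reflection_group =
  fixes \<Gamma> :: "(real^'n^'n) set" and roots :: "((real^'n) \<times> (real^'n)) set"
  defines roots_def: "roots \<equiv> {(a, v). a \<bullet> v = 2 \<and> refl_mat a v \<in> \<Gamma>}"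
  assumes one: "mat 1 \<in> \<Gamma>" and mult: "\<And>g h. g \<in> \<Gamma> \<Longrightarrow> h \<in> \<Gamma> \<Longrightarrow> g ** h \<in> \<Gamma>"
    and irreducible: "\<And>U. subspace U \<Longrightarrow> (\<And>a v x. (a, v) \<in> roots \<Longrightarrow> x \<in> U \<Longrightarrow> x - (a \<bullet> x) *\<^sub>R v \<in> U)
          \<Longrightarrow> U = {0} \<or> U = UNIV"
    and roots_nonempty: "roots \<noteq> {}"
begin

lemma rootsD: "(a, v) \<in> roots \<Longrightarrow> a \<bullet> v = 2" "(a, v) \<in> roots \<Longrightarrow> refl_mat a v \<in> \<Gamma>"
  by (auto simp: roots_def)

lemma rootsI: "a \<bullet> v = 2 \<Longrightarrow> refl_mat a v \<in> \<Gamma> \<Longrightarrow> (a, v) \<in> roots"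
  by (auto simp: roots_def)

lemma root_conj:
  assumes "(a, v) \<in> roots" "(b, w) \<in> roots"
  shows "(b - (b \<bullet> v) *\<^sub>R a, w - (a \<bullet> w) *\<^sub>R v) \<in> roots"
proof (rule rootsI)
  show "(b - (b \<bullet> v) *\<^sub>R a) \<bullet> (w - (a \<bullet> w) *\<^sub>R v) = 2"
    using rootsD(1)[OF assms(1)] rootsD(1)[OF assms(2)] by (simp add: inner_diff_left inner_diff_right)
  show "refl_mat (b - (b \<bullet> v) *\<^sub>R a) (w - (a \<bullet> w) *\<^sub>R v) \<in> \<Gamma>"
    unfolding refl_mat_conj[OF rootsD(1)[OF assms(1)], symmetric]
    using rootsD(2) assms mult by blast
qed

text \<open>The annihilator of E is invariant under the reflections, and it is not everything since
  E contains b0.\<close>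

lemma irreducible_dual:
  assumes E: "subspace E" and inv: "\<And>a v b. (a, v) \<in> roots \<Longrightarrow> b \<in> E \<Longrightarrow> b - (b \<bullet> v) *\<^sub>R a \<in> E"
    and "b0 \<in> E" "b0 \<noteq> 0"
  shows "E = UNIV"
proof -
  define U where "U = {y. \<forall>x\<in>E. x \<bullet> y = 0}"
  have U: "subspace U" unfolding U_def by (intro subspaceI) (auto simp: inner_add_right)
  have "y - (a \<bullet> y) *\<^sub>R v \<in> U" if r: "(a, v) \<in> roots" and y: "y \<in> U" for a v y
  proof -
    have "x \<bullet> (y - (a \<bullet> y) *\<^sub>R v) = (x - (x \<bullet> v) *\<^sub>R a) \<bullet> y" for x
      by (simp add: inner_diff_left inner_diff_right)
    then show ?thesis using inv[OF r] y unfolding U_def by simp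
  qed
  then have "U = {0} \<or> U = UNIV" by (rule irreducible[OF U])
  moreover have "U \<noteq> UNIV"
  proof
    assume "U = UNIV"
    then have "b0 \<in> U" by simp
    then have "b0 \<bullet> b0 = 0" using assms(3) unfolding U_def by blast
    then show False using assms(4) by simp
  qed
  ultimately show ?thesis using orthogonal_complement_trivial[OF E] unfolding U_def by blast
qed

lemma nonzero_root: "(a, v) \<in> roots \<Longrightarrow> a \<noteq> 0" "(a, v) \<in> roots \<Longrightarrow> v \<noteq> 0"
  using rootsD(1) by fastforce+

text \<open>The root covectors that are not orthogonal to a fixed root have an invariant span.\<close>
lemma nonorthogonal_covectors_span:
  assumes r1: "(a1, v1) \<in> roots" and K: "subspace K"
    and "\<And>a v. (a, v) \<in> roots \<Longrightarrow> a1 \<bullet> v \<noteq> 0 \<Longrightarrow> a \<in> K"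
  shows "K = UNIV"
proof -
  define E0 where "E0 = {a. \<exists>v. (a, v) \<in> roots \<and> a1 \<bullet> v \<noteq> 0}"
  have gen: "a \<in> span E0" if "(a, v) \<in> roots" "a1 \<bullet> v \<noteq> 0" for a v
    using that unfolding E0_def by (blast intro: span_base)
  have "span E0 = UNIV"
  proof (rule irreducible_dual)
    show "subspace (span E0)" by simp
    show "a1 \<in> span E0" using gen[OF r1] rootsD(1)[OF r1] by simp
    show "a1 \<noteq> 0" using nonzero_root r1 by blast
    fix a v b assume r: "(a, v) \<in> roots" and "b \<in> span E0"
    from this(2) show "b - (b \<bullet> v) *\<^sub>R a \<in> span E0"
    proof (induction b rule: span_induct_alt)
      case base then show ?case by (simp add: span_zero)
    next
      case (step c x y)
      obtain z where z: "(x, z) \<in> roots" "a1 \<bullet> z \<noteq> 0" using step(1) unfolding E0_def by blast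
      \<comment> \<open>If v is orthogonal to a1, reflecting keeps the pairing of the root with a1;
        otherwise the covector of the reflecting root itself belongs to the generating set.\<close>
      have "x - (x \<bullet> v) *\<^sub>R a \<in> span E0"
      proof (cases "a1 \<bullet> v = 0")
        case True
        have "(x - (x \<bullet> v) *\<^sub>R a, z - (a \<bullet> z) *\<^sub>R v) \<in> roots" by (rule root_conj[OF r z(1)])
        moreover have "a1 \<bullet> (z - (a \<bullet> z) *\<^sub>R v) \<noteq> 0" using True z by (simp add: inner_diff_right)
        ultimately show ?thesis by (rule gen)
      next
        case False
        then show ?thesis using gen[OF r] gen[OF z] by (simp add: span_diff span_scale)
      qed
      then have "c *\<^sub>R (x - (x \<bullet> v) *\<^sub>R a) + (y - (y \<bullet> v) *\<^sub>R a) \<in> span E0"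
        using step(2) by (simp only: span_add span_scale)
      then show ?case by (simp add: inner_add_left algebra_simps)
    qed
  qed
  moreover have "span E0 \<subseteq> K" using assms(3) K by (intro span_minimal) (auto simp: E0_def)
  ultimately show ?thesis by blast
qed

text \<open>For such a number p, the product of the two reflections has trace n - 4 + p; on a plane
  spanned by v and w it has trace p - 2 and determinant 1.\<close>

definition pairings :: "real set" where
  "pairings = {(a \<bullet> w) * (b \<bullet> v) | a v b w. (a, v) \<in> roots \<and> (b, w) \<in> roots}"

text \<open>The matrices a2 \<otimes> v1 with a1(v2) nonzero span all matrices, so it suffices to
  bound the values a2(w) b(v1). Such a value is no pairing, but multiplied by a1(v2) it closes up to
  a product along a 3-cycle, which satisfies a quadratic equation with coefficients from a finite
  set.\<close>

lemma finite_reflections: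
  assumes fin: "finite pairings"
  shows "finite {outer w b | b w. (b, w) \<in> roots}" (is "finite ?Y")
proof (rule finite_if_finite_coordinates)
  have pI: "(a \<bullet> w) * (b \<bullet> v) \<in> pairings" if "(a, v) \<in> roots" "(b, w) \<in> roots" for a v b w
    unfolding pairings_def using that by blast
  define G where "G = {outer a2 v1 | a1 v1 a2 v2. (a1, v1) \<in> roots \<and> (a2, v2) \<in> roots \<and> a1 \<bullet> v2 \<noteq> 0}"
  have 1: "outer \<beta> v1 \<in> span G" if r1: "(a1, v1) \<in> roots" for a1 v1 \<beta>
  proof -
    have "{\<beta>. outer \<beta> v1 \<in> span G} = UNIV"
    proof (rule nonorthogonal_covectors_span[OF r1])
      show "subspace {\<beta>. outer \<beta> v1 \<in> span G}"
        by (rule subspaceI) (simp_all add: outer_linear span_zero span_add span_scale)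
      show "a \<in> {\<beta>. outer \<beta> v1 \<in> span G}" if "(a, v) \<in> roots" "a1 \<bullet> v \<noteq> 0" for a v
        using that r1 unfolding G_def by (blast intro: span_base)
    qed
    then show ?thesis by blast
  qed
  have "{x. \<forall>\<beta>. outer \<beta> x \<in> span G} = UNIV" (is "?U = UNIV")
  proof -
    have sU: "subspace ?U"
      by (rule subspaceI) (simp_all add: outer_linear span_zero span_add span_scale)
    have "x - (a \<bullet> x) *\<^sub>R v \<in> ?U" if "(a, v) \<in> roots" "x \<in> ?U" for a v x
      using that 1 by (simp add: outer_linear span_diff span_scale)
    then have "?U = {0} \<or> ?U = UNIV" by (rule irreducible[OF sU])
    moreover obtain a v where r: "(a, v) \<in> roots" using roots_nonempty by auto
    moreover have "v \<in> ?U" using 1[OF r] by simp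
    ultimately show ?thesis using nonzero_root(2)[OF r] by blast
  qed
  then have "outer \<beta> x \<in> span G" for \<beta> x by blast
  then show "span G = UNIV" using matrix_span_outer[of "span G"] by simp
  fix g assume "g \<in> G"
  then obtain a1 v1 a2 v2 where g: "g = outer a2 v1" and r: "(a1, v1) \<in> roots" "(a2, v2) \<in> roots" and nz: "a1 \<bullet> v2 \<noteq> 0"
    unfolding G_def by blast
  define S where "S = {x + y * z - u | x y z u. x \<in> pairings \<and> y \<in> pairings \<and> z \<in> pairings \<and> u \<in> pairings}"
  define Q where "Q = {x * y * z | x y z. x \<in> pairings \<and> y \<in> pairings \<and> z \<in> pairings}"
  have "S \<subseteq> (\<lambda>(x,y,z,u). x + y * z - u) ` (pairings \<times> pairings \<times> pairings \<times> pairings)"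
  proof
    fix t assume "t \<in> S"
    then obtain x y z u where "t = x + y * z - u" "x \<in> pairings" "y \<in> pairings" "z \<in> pairings" "u \<in> pairings"
      unfolding S_def by blast
    then show "t \<in> (\<lambda>(x,y,z,u). x + y * z - u) ` (pairings \<times> pairings \<times> pairings \<times> pairings)"
      by (intro image_eqI[of _ _ "(x, y, z, u)"]) simp_all
  qed
  then have fS: "finite S" by (rule finite_subset) (simp add: fin)
  have "Q \<subseteq> (\<lambda>(x,y,z). x * y * z) ` (pairings \<times> pairings \<times> pairings)"
  proof
    fix t assume "t \<in> Q"
    then obtain x y z where "t = x * y * z" "x \<in> pairings" "y \<in> pairings" "z \<in> pairings"
      unfolding Q_def by blast
    then show "t \<in> (\<lambda>(x,y,z). x * y * z) ` (pairings \<times> pairings \<times> pairings)"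
      by (intro image_eqI[of _ _ "(x, y, z)"]) simp_all
  qed
  then have fQ: "finite Q" by (rule finite_subset) (simp add: fin)
  define C where "C = (\<Union>s\<in>S. \<Union>q\<in>Q. {c. poly [:q, - s, 1:] c = 0})"
  have fC: "finite C" unfolding C_def using fS fQ by (intro finite_UN_I poly_roots_finite) auto
  have "(\<lambda>y. y \<bullet> g) ` ?Y \<subseteq> (\<lambda>c. c / (a1 \<bullet> v2)) ` C"
  proof
    fix t assume "t \<in> (\<lambda>y. y \<bullet> g) ` ?Y"
    then obtain b w where bw: "(b, w) \<in> roots" "t = outer w b \<bullet> g" by blast
    have t: "t = (a2 \<bullet> w) * (b \<bullet> v1)"
      unfolding bw(2) g inner_outer by (simp add: inner_commute)
    \<comment> \<open>the sum and the product of the two orientations of the 3-cycle are polynomials in pairings\<close>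
    define c c' where "c = (a1 \<bullet> v2) * ((a2 \<bullet> w) * (b \<bullet> v1))" and "c' = (a1 \<bullet> w) * (b \<bullet> v2) * (a2 \<bullet> v1)"
    \<comment> \<open>Reflect the second root in the first and pair it with (b, w). In the expansion
      both orientations of the 3-cycle occur with a minus sign, next to polynomials in
      pairings.\<close>
    have "((a2 - (a2 \<bullet> v1) *\<^sub>R a1) \<bullet> w) * (b \<bullet> (v2 - (a1 \<bullet> v2) *\<^sub>R v1)) \<in> pairings"
      using pI[OF root_conj[OF r] bw(1)] .
    moreover have "c + c' = (a2 \<bullet> w) * (b \<bullet> v2) + ((a1 \<bullet> v2) * (a2 \<bullet> v1)) * ((a1 \<bullet> w) * (b \<bullet> v1))
       - ((a2 - (a2 \<bullet> v1) *\<^sub>R a1) \<bullet> w) * (b \<bullet> (v2 - (a1 \<bullet> v2) *\<^sub>R v1))"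
      by (simp add: c_def c'_def inner_diff_left inner_diff_right algebra_simps)
    ultimately have s: "c + c' \<in> S"
      unfolding S_def using pI[OF r(2) bw(1)] pI[OF r(1) bw(1)] pI[OF r] by blast
    have "c * c' = ((a1 \<bullet> v2) * (a2 \<bullet> v1)) * ((a2 \<bullet> w) * (b \<bullet> v2)) * ((a1 \<bullet> w) * (b \<bullet> v1))"
      by (simp add: c_def c'_def)
    then have q: "c * c' \<in> Q" unfolding Q_def using pI[OF r(2) bw(1)] pI[OF r(1) bw(1)] pI[OF r] by blast
    have "poly [:c * c', - (c + c'), 1:] c = 0" by (simp add: algebra_simps)
    then have "c \<in> C" unfolding C_def using s q by blast
    moreover have "t = c / (a1 \<bullet> v2)" using nz by (simp add: t c_def)
    ultimately show "t \<in> (\<lambda>c. c / (a1 \<bullet> v2)) ` C" by blast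
  qed
  then show "finite ((\<lambda>y. y \<bullet> g) ` ?Y)" using fC finite_surj by blast
qed

end

text \<open>If \<open>g\<close> is a matrix of size two with determinant 1 and trace \<open>p - 2\<close>, then
  \<open>g^k = cheb p k * g - cheb p (k - 1)\<close>.\<close>
fun cheb :: "real \<Rightarrow> nat \<Rightarrow> real" where
  "cheb p 0 = 0"
| "cheb p (Suc 0) = 1"
| "cheb p (Suc (Suc k)) = (p - 2) * cheb p (Suc k) - cheb p k"

lemma cheb_4: "cheb 4 k = real k"
  by (induction "4::real" k rule: cheb.induct) auto

lemma cheb_poly: "\<exists>r. \<forall>p. cheb p k = poly r p"
proof (induction "0::real" k rule: cheb.induct)
  case 1 show ?case by (rule exI[of _ 0]) simp
next
  case 2 show ?case by (rule exI[of _ 1]) simp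
next
  case (3 k)
  then obtain r1 r2 where "\<And>p. cheb p (Suc k) = poly r1 p" "\<And>p. cheb p k = poly r2 p" by blast
  then show ?case by (intro exI[of _ "[:-2, 1:] * r1 - r2"]) (simp add: algebra_simps)
qed

text \<open>At p = 4 the values are \<open>cheb 4 k = k\<close>, so none of the polynomials
  concerned is zero.\<close>

lemma finite_cheb_zeros: "finite {p. \<exists>k. 0 < k \<and> k \<le> N \<and> cheb p k = 0}"
  and finite_cheb_zeros2: "finite {p. \<exists>k\<le>N. cheb p (Suc k) + cheb p k = 0}"
proof -
  have "finite {p. cheb p k = 0}" if "0 < k" for k
  proof -
    obtain r where r: "\<And>p. cheb p k = poly r p" using cheb_poly by blast
    have "r \<noteq> 0" using r[of 4] that by (auto simp: cheb_4)
    then show ?thesis unfolding r by (rule poly_roots_finite)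
  qed
  then have "finite (\<Union>k\<in>{1..N}. {p. cheb p k = 0})" by (intro finite_UN_I) auto
  then show "finite {p. \<exists>k. 0 < k \<and> k \<le> N \<and> cheb p k = 0}" by (rule rev_finite_subset) fastforce
  have "finite {p. cheb p (Suc k) + cheb p k = 0}" for k
  proof -
    obtain r1 r2 where r: "\<And>p. cheb p (Suc k) = poly r1 p" "\<And>p. cheb p k = poly r2 p" using cheb_poly by metis
    have "poly (r1 + r2) 4 \<noteq> 0" using r[of 4] cheb_4[of "Suc k"] cheb_4[of k] by simp
    then have "r1 + r2 \<noteq> 0" by (metis poly_0)
    then show ?thesis unfolding r poly_add[symmetric] by (rule poly_roots_finite)
  qed
  then have "finite (\<Union>k\<le>N. {p. cheb p (Suc k) + cheb p k = 0})" by (intro finite_UN_I) auto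
  then show "finite {p. \<exists>k\<le>N. cheb p (Suc k) + cheb p k = 0}" by (rule rev_finite_subset) fastforce
qed

text \<open>The 2 by 2 determinant formed from consecutive terms of two solutions is constant, as
  the recurrence has determinant 1.\<close>

lemma cheb_cross: "cheb p (Suc j) * cheb p (j + k) - cheb p j * cheb p (Suc (j + k)) = cheb p k"
proof (induction j)
  case (Suc j)
  then show ?case by (simp add: algebra_simps)
qed simp

section \<open>Velocities of pencils of reflections\<close>

context reflection_group
begin

text \<open>The reflections in x v + y w that preserve the quadratic form of the dihedral group form
  a rational curve of degree 2 in the slope y / x. More than 2d of its points must lie in \<Gamma>;
  they are the conjugates with k = 0, ..., 2d. The two conditions on \<open>cheb\<close> make their
  slopes distinct and finite.\<close>

lemma pencil_velocity:
  assumes r: "(a, v) \<in> roots" "(b, w) \<in> roots"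
    and p: "p = (a \<bullet> w) * (b \<bullet> v)" "p \<noteq> 0"
    and cheb: "\<And>k. 0 < k \<Longrightarrow> k \<le> 2 * d \<Longrightarrow> cheb p k \<noteq> 0" "\<And>k. k \<le> 2 * d \<Longrightarrow> cheb p (Suc k) + cheb p k \<noteq> 0"
  shows "(a \<bullet> w) *\<^sub>R outer v b - (b \<bullet> v) *\<^sub>R outer w a \<in> lie_deg d \<Gamma>"
proof -
  define \<alpha> \<beta> where "\<alpha> = a \<bullet> w" and "\<beta> = b \<bullet> v"
  have ab: "\<alpha> \<noteq> 0" "\<beta> \<noteq> 0" "p = \<alpha> * \<beta>" using p by (auto simp: \<alpha>_def \<beta>_def)
  have av: "a \<bullet> v = 2" "b \<bullet> w = 2" using rootsD(1) r by auto
  \<comment> \<open>\<open>q\<close> is half the quadratic form on \<open>\<langle>v, w\<rangle>\<close> preserved by both reflections, \<open>R x y\<close> its reflection in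
    \<open>x v + y w\<close>, and \<open>xs k, ys k\<close> are the coordinates of the image of \<open>v\<close> under the \<open>k\<close>-th power of their product\<close>
  define q where "q x y = \<beta> * x * x + \<alpha> * \<beta> * x * y + \<alpha> * y * y" for x y
  define R where "R x y = refl_mat ((1 / q x y) *\<^sub>R ((\<beta> * x) *\<^sub>R a + (\<alpha> * y) *\<^sub>R b)) (x *\<^sub>R v + y *\<^sub>R w)" for x y
  define xs ys where "xs k = cheb p (Suc k) + cheb p k" and "ys k = - \<beta> * cheb p k" for k
  have step_a: "refl_mat a v ** R x y ** refl_mat a v = R (- x - \<alpha> * y) y" and qa: "q (- x - \<alpha> * y) y = q x y" for x y
  proof -
    show qa: "q (- x - \<alpha> * y) y = q x y" by (simp add: q_def algebra_simps)
    show "refl_mat a v ** R x y ** refl_mat a v = R (- x - \<alpha> * y) y"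
      unfolding R_def refl_mat_conj[OF av(1)] qa
      by (rule arg_cong2[of _ _ _ _ refl_mat])
        (simp_all add: vec_eq_iff inner_add_left inner_add_right av \<alpha>_def[symmetric] \<beta>_def[symmetric] diff_divide_distrib add_divide_distrib algebra_simps)
  qed
  have step_b: "refl_mat b w ** R x y ** refl_mat b w = R x (- \<beta> * x - y)" and qb: "q x (- \<beta> * x - y) = q x y" for x y
  proof -
    show qb: "q x (- \<beta> * x - y) = q x y" by (simp add: q_def algebra_simps)
    show "refl_mat b w ** R x y ** refl_mat b w = R x (- \<beta> * x - y)"
      unfolding R_def refl_mat_conj[OF av(2)] qb
      by (rule arg_cong2[of _ _ _ _ refl_mat])
        (simp_all add: vec_eq_iff inner_add_left inner_add_right av \<alpha>_def[symmetric] \<beta>_def[symmetric] diff_divide_distrib add_divide_distrib algebra_simps)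
  qed
  have R10: "R 1 0 = refl_mat a v" using ab by (simp add: R_def q_def)
  have xy: "R (xs k) (ys k) \<in> \<Gamma> \<and> q (xs k) (ys k) = \<beta>" for k
  proof (induction k)
    case 0
    then show ?case using R10 rootsD(2)[OF r(1)] by (simp add: xs_def ys_def q_def)
  next
    case (Suc k)
    have y: "ys (Suc k) = - \<beta> * xs k - ys k" by (simp add: xs_def ys_def algebra_simps)
    have x: "xs (Suc k) = - xs k - \<alpha> * ys (Suc k)" by (simp add: xs_def ys_def ab(3) algebra_simps)
    have "R (xs (Suc k)) (ys (Suc k))
      = refl_mat a v ** (refl_mat b w ** R (xs k) (ys k) ** refl_mat b w) ** refl_mat a v"
      unfolding step_b step_a y[symmetric] x[symmetric] ..
    then have "R (xs (Suc k)) (ys (Suc k)) \<in> \<Gamma>" using Suc mult rootsD(2)[OF r(1)] rootsD(2)[OF r(2)] by simp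
    moreover have "q (xs (Suc k)) (ys (Suc k)) = \<beta>" unfolding x qa y qb using Suc by blast
    ultimately show ?case by blast
  qed
  \<comment> \<open>The slope of the k-th root. Its denominator is nonzero by the second condition
    on \<open>cheb\<close>; distinctness uses the first condition and
    \<open>cheb_cross\<close>.\<close>
  define t where "t k = ys k / xs k" for k
  have xnz: "xs k \<noteq> 0" if "k \<le> 2 * d" for k using cheb(2)[OF that] by (simp add: xs_def)
  have qt: "q 1 (t k) = \<beta> / (xs k * xs k)" if "k \<le> 2 * d" for k
  proof -
    have "q (xs k) (ys k) = (xs k * xs k) * q 1 (t k)" using xnz[OF that] by (simp add: q_def t_def field_simps)
    then show ?thesis using xy[of k] xnz[OF that] by (simp add: field_simps)
  qed
  have Rt: "R 1 (t k) = R (xs k) (ys k)" if "k \<le> 2 * d" for k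
  proof -
    have "refl_mat ((1 / q 1 (t k)) *\<^sub>R ((\<beta> * 1) *\<^sub>R a + (\<alpha> * t k) *\<^sub>R b)) (1 *\<^sub>R v + t k *\<^sub>R w)
      = refl_mat ((1 / \<beta>) *\<^sub>R ((\<beta> * xs k) *\<^sub>R a + (\<alpha> * ys k) *\<^sub>R b)) (xs k *\<^sub>R v + ys k *\<^sub>R w)"
      unfolding qt[OF that] using xnz[OF that] ab
      by (simp add: refl_mat_def outer_def vec_eq_iff t_def field_simps)
    then show ?thesis using xy[of k] unfolding R_def by simp
  qed
  have inj: "inj_on t {..2 * d}"
  proof -
    have "t j \<noteq> t (j + k)" if "0 < k" "j + k \<le> 2 * d" for j k
    proof
      assume "t j = t (j + k)"
      then have "ys j * xs (j + k) = ys (j + k) * xs j"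
        using xnz[of j] xnz[of "j + k"] that by (simp add: t_def frac_eq_eq)
      then have "\<beta> * (cheb p (Suc j) * cheb p (j + k) - cheb p j * cheb p (Suc (j + k))) = 0"
        by (simp add: xs_def ys_def algebra_simps)
      then show False using cheb(1)[of k] that ab unfolding cheb_cross by simp
    qed
    then have "t j \<noteq> t k" if "j < k" "k \<le> 2 * d" for j k
      using that by (metis add_diff_inverse_nat less_imp_le_nat not_less zero_less_diff)
    then show ?thesis by (intro inj_onI) (metis atMost_iff linorder_neqE_nat)
  qed
  define qp where "qp = [:\<beta>, \<alpha> * \<beta>, \<alpha>:]"
  define N where "N i j = smult ((mat 1 :: real^'n^'n) $ i $ j) qp
     - [:v $ i * \<beta> * a $ j, v $ i * \<alpha> * b $ j + w $ i * \<beta> * a $ j, w $ i * \<alpha> * b $ j:]" for i j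
  have qp: "poly qp t = q 1 t" for t by (simp add: qp_def q_def algebra_simps)
  have curve: "rational_curve qp N t = R 1 t" if "q 1 t \<noteq> 0" for t
    unfolding rational_curve_def qp using that
    by (simp add: vec_eq_iff N_def qp R_def refl_mat_def outer_def field_simps)
  have d2: "degree qp \<le> 2" by (simp add: qp_def)
  have "(1 / \<beta>) *\<^sub>R (\<alpha> *\<^sub>R outer v b - \<beta> *\<^sub>R outer w a) \<in> lie_deg d \<Gamma>"
  proof -
    define s where "s = refl_mat a v"
    \<comment> \<open>The derivative at 0 of 1 - (\<beta> v \<otimes> a + x (\<alpha> v \<otimes> b
      + \<beta> w \<otimes> a) + x^2 \<alpha> w \<otimes> b) / (\<beta> + \<alpha> \<beta> x +
      \<alpha> x^2).\<close>
    define Y where "Y = \<alpha> *\<^sub>R outer v a - outer w a - (\<alpha> / \<beta>) *\<^sub>R outer v b"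
    have sY: "s ** Y = (1 / \<beta>) *\<^sub>R (\<alpha> *\<^sub>R outer v b - \<beta> *\<^sub>R outer w a)"
      unfolding matrix_eq using av ab
      by (simp add: matrix_act s_def Y_def \<alpha>_def[symmetric]) (simp add: vec_eq_iff field_simps)
    have "s ** Y \<in> lie_deg d \<Gamma>"
    proof (rule rational_curve_velocity[where q = qp and N = N and e = 2 and T = "t ` {..2 * d}"])
      show "card (t ` {..2 * d}) > 2 * d" using card_image[OF inj] by simp
      show "\<forall>i j. degree (N i j) \<le> 2"
      proof (intro allI)
        fix i j
        have "degree (smult ((mat 1 :: real^'n^'n) $ i $ j) qp) \<le> 2" using d2 degree_smult_le le_trans by blast
        then show "degree (N i j) \<le> 2" unfolding N_def by (intro degree_diff_le) auto
      qed
      show "poly qp x \<noteq> 0 \<and> rational_curve qp N x \<in> \<Gamma>" if x: "x \<in> t ` {..2 * d}" for x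
      proof -
        obtain k where k: "k \<le> 2 * d" "x = t k" using x by auto
        have "q 1 x \<noteq> 0" using qt[OF k(1)] xnz[OF k(1)] ab k(2) by simp
        then show ?thesis using curve Rt[OF k(1)] xy[of k] k(2) by (simp add: qp)
      qed
      show "poly qp 0 \<noteq> 0" using ab by (simp add: qp_def)
      then show "rational_curve qp N 0 = s" using curve[of 0] R10 by (simp add: qp s_def)
      show "s \<in> \<Gamma>" using rootsD(2)[OF r(1)] by (simp add: s_def)
      show "s ** s = mat 1" using av by (simp add: s_def refl_mat_square)
      have "trace (\<alpha> *\<^sub>R outer v b - \<beta> *\<^sub>R outer w a) = 0"
        by (simp add: trace_sub trace_scaleR trace_outer \<alpha>_def \<beta>_def)
      then show "trace (s ** Y) = 0" unfolding sY trace_scaleR by simp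
      define A1 A2 where "A1 = outer v (\<alpha> *\<^sub>R b) + outer w (\<beta> *\<^sub>R a)" and "A2 = outer w (\<alpha> *\<^sub>R b)"
      define M where "M x = mat 1 - (1 / poly qp x) *\<^sub>R (outer v (\<beta> *\<^sub>R a) + x *\<^sub>R A1 + (x * x) *\<^sub>R A2)" for x
      have M: "M x = rational_curve qp N x" if "poly qp x \<noteq> 0" for x
        unfolding rational_curve_def M_def A1_def A2_def using that
        by (simp add: vec_eq_iff N_def outer_def field_simps)
      have q': "((\<lambda>x. 1 / poly qp x) has_real_derivative - \<alpha> / \<beta>) (at 0)"
        using ab by (auto intro!: derivative_eq_intros simp: qp_def field_simps)
      have "((\<lambda>x. outer v (\<beta> *\<^sub>R a) + x *\<^sub>R A1 + (x * x) *\<^sub>R A2) has_vector_derivative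
          0 + (0 *\<^sub>R 0 + 1 *\<^sub>R A1) + ((0 * 0) *\<^sub>R 0 + (1 * 0 + 1 * 0) *\<^sub>R A2)) (at 0)"
        by (rule has_vector_derivative_add[OF has_vector_derivative_add[OF has_vector_derivative_const
            has_vector_derivative_scaleR[OF DERIV_ident has_vector_derivative_const]]
            has_vector_derivative_scaleR[OF DERIV_mult[OF DERIV_ident DERIV_ident] has_vector_derivative_const]])
      then have "((\<lambda>x. outer v (\<beta> *\<^sub>R a) + x *\<^sub>R A1 + (x * x) *\<^sub>R A2) has_vector_derivative A1) (at 0)"
        by simp
      from has_vector_derivative_diff[OF has_vector_derivative_const has_vector_derivative_scaleR[OF q' this]]
      have "(M has_vector_derivative 0 - ((1 / poly qp 0) *\<^sub>R A1 + (- \<alpha> / \<beta>) *\<^sub>R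
          (outer v (\<beta> *\<^sub>R a) + 0 *\<^sub>R A1 + (0 * 0) *\<^sub>R A2))) (at 0)"
        unfolding M_def by blast
      moreover have "0 - ((1 / poly qp 0) *\<^sub>R A1 + (- \<alpha> / \<beta>) *\<^sub>R
          (outer v (\<beta> *\<^sub>R a) + 0 *\<^sub>R A1 + (0 * 0) *\<^sub>R A2)) = Y"
        using ab by (simp add: Y_def qp_def A1_def outer_linear vec_eq_iff field_simps)
      ultimately have "(M has_vector_derivative Y) (at 0)" by simp
      moreover have "\<forall>\<^sub>F x in at 0. M x = rational_curve qp N x"
      proof -
        have "open {x. poly qp x \<noteq> 0}" by (intro open_Collect_neq continuous_intros)
        then have "\<forall>\<^sub>F x in nhds 0. poly qp x \<noteq> 0" using \<open>poly qp 0 \<noteq> 0\<close> eventually_nhds by blast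
        then have "\<forall>\<^sub>F x in at 0. poly qp x \<noteq> 0" by (simp add: eventually_nhds_conv_at)
        then show ?thesis by eventually_elim (rule M)
      qed
      ultimately show "(rational_curve qp N has_vector_derivative Y) (at 0)"
        unfolding has_vector_derivative_def
        by (rule has_derivative_transform_eventually) (simp_all add: M \<open>poly qp 0 \<noteq> 0\<close>)
    qed (use d2 mult in auto)
    then show ?thesis unfolding sY .
  qed
  then have "\<beta> *\<^sub>R ((1 / \<beta>) *\<^sub>R (\<alpha> *\<^sub>R outer v b - \<beta> *\<^sub>R outer w a)) \<in> lie_deg d \<Gamma>"
    using subspace_scale[OF subspace_lie_deg] by blast
  then show ?thesis using ab by (simp add: \<alpha>_def \<beta>_def)
qed

end

section \<open>Reducible Lie algebras and systems of lines\<close>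

context reflection_group
begin

lemma reflection_invariant_ex:
  assumes "subspace U" "x0 \<in> U" "x0 \<noteq> 0" "U \<noteq> UNIV"
  obtains a v x where "(a, v) \<in> roots" "x \<in> U" "refl_mat a v *v x \<notin> U"
  using irreducible[OF assms(1)] assms unfolding refl_mat_mult_vec by blast

text \<open>A minimal \<open>L\<close>-invariant subspace and its image under a reflection that moves it meet trivially,
  although the reflection fixes a hyperplane; hence the subspace is a line. The same argument applied
  to weight spaces shows that they are lines.\<close>
lemma reducible_imp_monomial:
  assumes conj: "\<And>a v X. (a, v) \<in> roots \<Longrightarrow> X \<in> L \<Longrightarrow> refl_mat a v ** X ** refl_mat a v \<in> L"
    and U0: "subspace U0" "\<forall>X\<in>L. \<forall>x\<in>U0. X *v x \<in> U0" "U0 \<noteq> {0}" "U0 \<noteq> UNIV"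
    and X0: "X0 \<in> L" "\<And>c. \<exists>x. X0 *v x \<noteq> c *\<^sub>R x"
  shows "\<exists>b. finite b \<and> 0 \<notin> b \<and> span b = UNIV \<and>
    (\<forall>(a, v) \<in> roots. \<forall>x\<in>b. \<exists>y\<in>b. \<exists>c. refl_mat a v *v x = c *\<^sub>R y)"
proof -
  have sXs: "X *v (refl_mat a v *v x) = refl_mat a v *v ((refl_mat a v ** X ** refl_mat a v) *v x)"
    if "(a, v) \<in> roots" for a v X x
    using refl_mat_involutive[OF rootsD(1)[OF that]] by (simp add: matrix_vector_mul_assoc[symmetric])
  have fix_ker: "refl_mat a v *v x = x" if "a \<bullet> x = 0" for a v x using that by (simp add: refl_mat_mult_vec)
  define E where "E = {x. x \<noteq> 0 \<and> (\<forall>X\<in>L. \<exists>c. X *v x = c *\<^sub>R x)}"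
  have "\<exists>x. x \<in> E"
  proof -
    define Q where "Q U \<longleftrightarrow> subspace U \<and> (\<forall>X\<in>L. \<forall>x\<in>U. X *v x \<in> U) \<and> U \<noteq> {0} \<and> U \<noteq> UNIV" for U :: "(real^'n) set"
    have "Q U0" using U0 by (simp add: Q_def)
    then obtain U where QU: "Q U" and least: "\<And>U'. Q U' \<Longrightarrow> dim U \<le> dim U'"
      using ex_has_least_nat[of Q U0 dim] by blast
    have U: "subspace U" "\<And>X x. X \<in> L \<Longrightarrow> x \<in> U \<Longrightarrow> X *v x \<in> U" "U \<noteq> {0}" "U \<noteq> UNIV" using QU by (auto simp: Q_def)
    obtain x where x: "x \<in> U" "x \<noteq> 0" using U subspace_0 by blast
    obtain a v x1 where r: "(a, v) \<in> roots" and x1: "x1 \<in> U" "refl_mat a v *v x1 \<notin> U"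
      using reflection_invariant_ex[OF U(1) x U(4)] by blast
    define W where "W = {y \<in> U. refl_mat a v *v y \<in> U}"
    have sW: "subspace W"
      unfolding W_def using U(1) by (intro subspaceI) (auto simp: matrix_vector_right_distrib matrix_vector_mult_scaleR subspace_0 subspace_add subspace_scale)
    have invW: "\<forall>X\<in>L. \<forall>y\<in>W. X *v y \<in> W"
    proof (intro ballI)
      fix X y assume X: "X \<in> L" and y: "y \<in> W"
      have "refl_mat a v *v (X *v y) = (refl_mat a v ** X ** refl_mat a v) *v (refl_mat a v *v y)"
        using refl_mat_involutive[OF rootsD(1)[OF r]] by (simp add: matrix_vector_mul_assoc[symmetric])
      then show "X *v y \<in> W" using U(2)[OF X] U(2)[OF conj[OF r X]] y by (simp add: W_def)
    qed
    have "W = {0}"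
    proof (rule ccontr)
      assume nz: "W \<noteq> {0}"
      have "W \<subset> U" using x1 by (auto simp: W_def)
      then have "Q W" using sW invW nz unfolding Q_def by blast
      then have "dim U \<le> dim W" by (rule least)
      then have "W = U" using subspace_dim_equal[OF sW U(1)] \<open>W \<subset> U\<close> by blast
      then show False using \<open>W \<subset> U\<close> by blast
    qed
    moreover have kW: "y \<in> W" if "y \<in> U" "a \<bullet> y = 0" for y using that fix_ker[of a y v] by (simp add: W_def)
    ultimately have k0: "y = 0" if "y \<in> U" "a \<bullet> y = 0" for y using that by blast
    have ax: "a \<bullet> x \<noteq> 0" using k0 x by blast
    have line: "\<exists>c. y = c *\<^sub>R x" if y: "y \<in> U" for y
    proof -
      have "y - ((a \<bullet> y) / (a \<bullet> x)) *\<^sub>R x \<in> U" using x y U(1) by (simp add: subspace_diff subspace_scale)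
      moreover have "a \<bullet> (y - ((a \<bullet> y) / (a \<bullet> x)) *\<^sub>R x) = 0" using ax by (simp add: inner_diff_right)
      ultimately have "y - ((a \<bullet> y) / (a \<bullet> x)) *\<^sub>R x = 0" by (rule k0)
      then show ?thesis by (intro exI[of _ "(a \<bullet> y) / (a \<bullet> x)"]) simp
    qed
    have "x \<in> E" unfolding E_def using x line U(2) by blast
    then show ?thesis by blast
  qed
  then obtain e where e: "e \<in> E" by blast
  have E_inv: "refl_mat a v *v x \<in> E" if r: "(a, v) \<in> roots" and x: "x \<in> E" for a v x
  proof -
    have "refl_mat a v *v x \<noteq> 0"
      using refl_mat_involutive[OF rootsD(1)[OF r], of x] x by (auto simp: E_def)
    moreover have "\<exists>c. X *v (refl_mat a v *v x) = c *\<^sub>R (refl_mat a v *v x)" if X: "X \<in> L" for X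
    proof -
      obtain c where "(refl_mat a v ** X ** refl_mat a v) *v x = c *\<^sub>R x"
        using x conj[OF r X] unfolding E_def by blast
      then show ?thesis unfolding sXs[OF r] by (intro exI[of _ c]) (simp add: matrix_vector_mult_scaleR)
    qed
    ultimately show ?thesis by (simp add: E_def)
  qed
  have spE: "span E = UNIV"
  proof -
    have "x - (a \<bullet> x) *\<^sub>R v \<in> span E" if r: "(a, v) \<in> roots" and "x \<in> span E" for a v x
      using that(2)
    proof (induction x rule: span_induct_alt)
      case base then show ?case by (simp add: span_zero)
    next
      case (step c x y)
      have "x - (a \<bullet> x) *\<^sub>R v \<in> span E"
        using E_inv[OF r step(1)] unfolding refl_mat_mult_vec by (rule span_base)
      then have "c *\<^sub>R (x - (a \<bullet> x) *\<^sub>R v) + (y - (a \<bullet> y) *\<^sub>R v) \<in> span E"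
        using step(2) by (simp only: span_add span_scale)
      then show ?case by (simp add: inner_add_right algebra_simps)
    qed
    then have "span E = {0} \<or> span E = UNIV" by (rule irreducible[OF subspace_span])
    then show ?thesis using span_base[OF e] e unfolding E_def by blast
  qed
  have weight_line: "\<exists>c. y = c *\<^sub>R x"
    if x: "x \<in> E" and y: "\<And>X c. X \<in> L \<Longrightarrow> X *v x = c *\<^sub>R x \<Longrightarrow> X *v y = c *\<^sub>R y" for x y
  proof -
    define V where "V = {y. \<forall>X\<in>L. \<forall>c. X *v x = c *\<^sub>R x \<longrightarrow> X *v y = c *\<^sub>R y}"
    have sV: "subspace V"
      unfolding V_def by (intro subspaceI) (auto simp: matrix_vector_right_distrib matrix_vector_mult_scaleR algebra_simps)
    have xV: "x \<in> V" and yV: "y \<in> V" using y unfolding V_def by auto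
    have x0: "x \<noteq> 0" using x by (simp add: E_def)
    \<comment> \<open>If the weight space of x were everything, the nonscalar matrix X0 would act as
      a scalar.\<close>
    have "V \<noteq> UNIV"
    proof
      assume V: "V = UNIV"
      obtain c where c: "X0 *v x = c *\<^sub>R x" using x X0(1) unfolding E_def by blast
      have "X0 *v z = c *\<^sub>R z" for z
      proof -
        have "z \<in> V" using V by simp
        then show ?thesis using c X0(1) unfolding V_def by blast
      qed
      then show False using X0(2)[of c] by blast
    qed
    then obtain a v y1 where r: "(a, v) \<in> roots" and y1: "y1 \<in> V" "refl_mat a v *v y1 \<notin> V"
      using reflection_invariant_ex[OF sV xV x0] by blast
    \<comment> \<open>A nonzero vector z of the weight space fixed by the reflection shows that
      conjugating X does not change its eigenvalue on V. Then the reflection would map y1 back into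
      V.\<close>
    have k0: "z = 0" if z: "z \<in> V" "a \<bullet> z = 0" for z
    proof (rule ccontr)
      assume z0: "z \<noteq> 0"
      have "X *v (refl_mat a v *v y1) = c *\<^sub>R (refl_mat a v *v y1)" if X: "X \<in> L" "X *v x = c *\<^sub>R x" for X c
      proof -
        define X' where "X' = refl_mat a v ** X ** refl_mat a v"
        have X': "X' \<in> L" using conj[OF r X(1)] by (simp add: X'_def)
        obtain c' where c': "X' *v x = c' *\<^sub>R x" using x X' unfolding E_def by blast
        have "X *v z = c *\<^sub>R z" using z(1) X unfolding V_def by blast
        then have "X' *v z = c *\<^sub>R z"
          using fix_ker[OF z(2)] by (simp add: X'_def matrix_vector_mul_assoc[symmetric] matrix_vector_mult_scaleR)
        moreover have "X' *v z = c' *\<^sub>R z" using z(1) X' c' unfolding V_def by blast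
        ultimately have "c' = c" using z0 by simp
        then have "X' *v y1 = c *\<^sub>R y1" using y1(1) X' c' unfolding V_def by blast
        then show ?thesis unfolding sXs[OF r] X'_def[symmetric] by (simp add: matrix_vector_mult_scaleR)
      qed
      then show False using y1(2) unfolding V_def by blast
    qed
    have ax: "a \<bullet> x \<noteq> 0" using k0[OF xV] x0 by blast
    have "y - ((a \<bullet> y) / (a \<bullet> x)) *\<^sub>R x \<in> V" using xV yV sV by (simp add: subspace_diff subspace_scale)
    moreover have "a \<bullet> (y - ((a \<bullet> y) / (a \<bullet> x)) *\<^sub>R x) = 0" using ax by (simp add: inner_diff_right)
    ultimately have "y - ((a \<bullet> y) / (a \<bullet> x)) *\<^sub>R x = 0" by (rule k0)
    then show ?thesis by (intro exI[of _ "(a \<bullet> y) / (a \<bullet> x)"]) simp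
  qed
  obtain b where b: "b \<subseteq> E" "independent b" "E \<subseteq> span b" using maximal_independent_subset[of E] by blast
  have fb: "finite b" using b(2) independent_bound by blast
  have spb: "span b = UNIV" using b(3) spE span_mono span_span by (metis top.extremum_uniqueI)
  \<comment> \<open>Expand a common eigenvector in the basis b. By independence it has the same
    weight as every basis vector that occurs, and weight spaces are lines.\<close>
  have E_line: "\<exists>y\<in>b. \<exists>c. x = c *\<^sub>R y" if x: "x \<in> E" for x
  proof -
    obtain r where xr: "x = (\<Sum>y\<in>b. r y *\<^sub>R y)" using spb span_finite[OF fb] by blast
    have "\<exists>y\<in>b. r y \<noteq> 0"
    proof (rule ccontr)
      assume "\<not> ?thesis"
      then have "x = 0" unfolding xr by (intro sum.neutral) auto
      then show False using x by (simp add: E_def)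
    qed
    then obtain y where y: "y \<in> b" "r y \<noteq> 0" by blast
    have "X *v x = c *\<^sub>R x" if X: "X \<in> L" and c: "X *v y = c *\<^sub>R y" for X c
    proof -
      obtain cx where cx: "X *v x = cx *\<^sub>R x" using x X unfolding E_def by blast
      have "\<forall>z\<in>b. \<exists>k. X *v z = k *\<^sub>R z" using b(1) X unfolding E_def by blast
      then obtain k where k: "\<And>z. z \<in> b \<Longrightarrow> X *v z = k z *\<^sub>R z" by metis
      have "X *v x = (\<Sum>z\<in>b. (r z * k z) *\<^sub>R z)"
      proof -
        have "X *v x = (\<Sum>z\<in>b. X *v (r z *\<^sub>R z))"
          unfolding xr by (rule linear_sum[OF matrix_vector_mul_linear])
        also have "\<dots> = (\<Sum>z\<in>b. (r z * k z) *\<^sub>R z)"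
          by (rule sum.cong) (simp_all add: matrix_vector_mult_scaleR k)
        finally show ?thesis .
      qed
      moreover have "cx *\<^sub>R x = (\<Sum>z\<in>b. (cx * r z) *\<^sub>R z)" by (subst xr) (simp add: scaleR_sum_right)
      ultimately have "(\<Sum>z\<in>b. (r z * k z) *\<^sub>R z) = (\<Sum>z\<in>b. (cx * r z) *\<^sub>R z)" using cx by simp
      then have "(\<Sum>z\<in>b. (r z * k z - cx * r z) *\<^sub>R z) = 0"
        by (simp only: scaleR_left_diff_distrib sum_subtractf diff_self)
      from independentD[OF b(2) fb order_refl this y(1)] have "r y * k y - cx * r y = 0" .
      then have "k y = cx" using y(2) by (simp add: mult.commute)
      moreover have "y \<noteq> 0" using y(1) b(1) unfolding E_def by blast
      ultimately have "c = cx" using c k[OF y(1)] by simp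
      then show ?thesis using cx by simp
    qed
    then have "\<exists>c. x = c *\<^sub>R y" using weight_line[of y x] y(1) b(1) by blast
    then show ?thesis using y(1) by blast
  qed
  have "0 \<notin> b" using b(1) by (auto simp: E_def)
  moreover have "\<forall>(a, v) \<in> roots. \<forall>x\<in>b. \<exists>y\<in>b. \<exists>c. refl_mat a v *v x = c *\<^sub>R y"
    using E_inv E_line b(1) by blast
  ultimately show ?thesis using fb spb by blast
qed

end

section \<open>Generators of the special linear and the orthogonal group\<close>

lemma orthogonal_functional:
  assumes U: "subspace U" and x: "x \<notin> U"
  obtains \<xi> :: "real^'n" where "\<And>u. u \<in> U \<Longrightarrow> \<xi> \<bullet> u = 0" "\<xi> \<bullet> x = 1"
proof -
  obtain y z where yz: "y \<in> span U" "\<And>w. w \<in> span U \<Longrightarrow> orthogonal z w" "x = y + z"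
    by (rule orthogonal_subspace_decomp_exists[of U x], rule that)
  have yU: "y \<in> U" using yz(1) span_minimal[OF _ U, of U] by auto
  have zu: "z \<bullet> u = 0" if "u \<in> U" for u using yz(2)[OF span_base[OF that]] by (simp add: orthogonal_def)
  have "z \<noteq> 0" using yz(3) yU x by auto
  then have zz: "z \<bullet> z \<noteq> 0" by simp
  have zx: "z \<bullet> x = z \<bullet> z" using zu[OF yU] by (simp add: yz(3) inner_add_right)
  show thesis
    by (rule that[of "(1 / (z \<bullet> z)) *\<^sub>R z"]) (use zu zx zz in auto)
qed

lemma span_insert_subspace:
  assumes "subspace U" shows "span (insert x U) = {u + c *\<^sub>R x | u c. u \<in> U}"
proof -
  have "span U = U" using assms span_eq_iff by blast
  show ?thesis
  proof (intro equalityI subsetI)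
    fix y assume "y \<in> span (insert x U)"
    then obtain c where "y - c *\<^sub>R x \<in> U" using span_insert[of x U] \<open>span U = U\<close> by auto
    then show "y \<in> {u + c *\<^sub>R x | u c. u \<in> U}" by (auto intro!: exI[of _ "y - c *\<^sub>R x"])
  next
    fix y assume "y \<in> {u + c *\<^sub>R x | u c. u \<in> U}"
    then show "y \<in> span (insert x U)" by (auto intro!: span_add span_scale intro: span_base)
  qed
qed

lemma dim_span_insert_less:
  fixes U :: "(real^'n) set"
  assumes "subspace U" "x \<notin> U"
  shows "dim U < dim (span (insert x U))"
proof -
  have "U \<subset> span (insert x U)" using assms(2) by (auto intro: span_base)
  moreover have "span U = U" using assms(1) span_eq_iff by blast
  ultimately show ?thesis using dim_psubset[of U "span (insert x U)"] by (metis span_span)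
qed

text \<open>Induction on the codimension of a pointwise fixed subspace.\<close>
lemma SL_generated_by_transvections:
  fixes T :: "(real^'n^'n) set"
  assumes one: "mat 1 \<in> T" and mult: "\<And>g h. g \<in> T \<Longrightarrow> h \<in> T \<Longrightarrow> g ** h \<in> T"
    and trans: "\<And>x \<xi>. \<xi> \<bullet> x = 0 \<Longrightarrow> mat 1 + outer x \<xi> \<in> T"
    and det: "det g = 1"
  shows "g \<in> T"
proof -
  have main: "g \<in> T" if "subspace U" "\<And>u. u \<in> U \<Longrightarrow> g *v u = u" "det g = 1" "CARD('n) - dim U = k" for U g k
    using that
  proof (induction k arbitrary: U g rule: less_induct)
    case (less k)
    note U = less.prems(1) and fixU = less.prems(2) and detg = less.prems(3)
    have inv: "h \<in> T" if "\<xi> \<bullet> z = 0" "(mat 1 + outer z \<xi>) ** h \<in> T" for h z \<xi>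
    proof -
      have "mat 1 + outer (- z) \<xi> \<in> T" using that(1) by (intro trans) simp
      then have "(mat 1 + outer (- z) \<xi>) ** ((mat 1 + outer z \<xi>) ** h) \<in> T" using that(2) by (rule mult)
      moreover have "(mat 1 + outer (- z) \<xi>) ** (mat 1 + outer z \<xi>) = mat 1"
        unfolding matrix_eq using that(1) by (simp add: matrix_act)
      ultimately show ?thesis by (metis matrix_mul_assoc matrix_mul_lid)
    qed
    \<comment> \<open>Here a functional exists that kills U and x - h x but not x. It defines a
      transvection that fixes U and takes h x back to x, so the fixed subspace grows.\<close>
    have caseA: "h \<in> T" if fixh: "\<And>u. u \<in> U \<Longrightarrow> h *v u = u" and deth: "det h = 1"
      and x: "x \<notin> U" "x \<notin> span (insert (x - h *v x) U)" for h x
    proof -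
      define z where "z = x - h *v x"
      obtain \<xi> where xi: "\<And>u. u \<in> span (insert z U) \<Longrightarrow> \<xi> \<bullet> u = 0" "\<xi> \<bullet> x = 1"
        using orthogonal_functional[OF subspace_span] x(2) unfolding z_def by blast
      have xz: "\<xi> \<bullet> z = 0" by (intro xi(1) span_base) simp
      have xu: "\<xi> \<bullet> u = 0" if "u \<in> U" for u using that by (intro xi(1) span_base) simp
      have xh: "\<xi> \<bullet> (h *v x) = 1" using xz xi(2) by (simp add: z_def inner_diff_right)
      define h' where "h' = (mat 1 + outer z \<xi>) ** h"
      have "h' *v x = x" by (simp add: h'_def matrix_act xh) (simp add: z_def)
      moreover have "h' *v u = u" if "u \<in> U" for u using that by (simp add: h'_def matrix_act fixh xu)
      ultimately have fix': "h' *v u = u" if "u \<in> span (insert x U)" for u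
        using that unfolding span_insert_subspace[OF U] by (auto simp: matrix_vector_right_distrib matrix_vector_mult_scaleR)
      have "dim U < dim (span (insert x U))" by (rule dim_span_insert_less[OF U x(1)])
      moreover have "dim (span (insert x U)) \<le> CARD('n)" using dim_subset_UNIV_cart by blast
      ultimately have "CARD('n) - dim (span (insert x U)) < k" using less.prems(4) by linarith
      moreover have "det h' = 1" using deth xz by (simp add: h'_def det_mul det_id_plus_outer)
      ultimately have "h' \<in> T" using less.IH[of _ "span (insert x U)" h'] fix' subspace_span by blast
      then show ?thesis using inv[OF xz] unfolding h'_def by blast
    qed
    show ?case
    proof (cases "U = UNIV")
      case True
      then have "g = mat 1" using fixU by (simp add: matrix_eq)
      then show ?thesis using one by simp
    next
      case False
      then obtain x where x: "x \<notin> U" by blast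
      show ?thesis
      proof (cases "x \<in> span (insert (x - g *v x) U)")
        case False
        then show ?thesis using caseA[OF fixU detg x] by blast
      next
        case True
        then obtain u k where uk: "u \<in> U" "x = u + k *\<^sub>R (x - g *v x)" unfolding span_insert_subspace[OF U] by blast
        have k0: "k \<noteq> 0" using uk x by auto
        \<comment> \<open>In the remaining case x is an eigenvector of g modulo U, with eigenvalue c
          different from 1.\<close>
        define c where "c = 1 - 1 / k"
        define u' where "u' = (1 / k) *\<^sub>R u"
        have u': "u' \<in> U" using uk(1) U by (simp add: u'_def subspace_scale)
        have "k *\<^sub>R (g *v x) = u + k *\<^sub>R x - x" using uk(2) by (simp add: algebra_simps)
        then have "(1 / k) *\<^sub>R (k *\<^sub>R (g *v x)) = (1 / k) *\<^sub>R (u + k *\<^sub>R x - x)" by simp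
        then have gx: "g *v x = c *\<^sub>R x + u'" using k0 by (simp add: c_def u'_def algebra_simps)
        have c1: "c \<noteq> 1" using k0 by (simp add: c_def)
        show ?thesis
        proof (cases "span (insert x U) = UNIV")
          \<comment> \<open>U is a hyperplane, so the determinant of g would be c.\<close>
          case True
          obtain \<xi> where xi: "\<And>u. u \<in> U \<Longrightarrow> \<xi> \<bullet> u = 0" "\<xi> \<bullet> x = 1" using orthogonal_functional[OF U x] by blast
          have "g *v y = (mat 1 + outer (g *v x - x) \<xi>) *v y" for y
          proof -
            have "y \<in> span (insert x U)" using True by simp
            then obtain w e where w: "w \<in> U" and y: "y = w + e *\<^sub>R x" unfolding span_insert_subspace[OF U] by blast
            have "g *v y = w + e *\<^sub>R (g *v x)"
              unfolding y using fixU[OF w] by (simp only: matrix_vector_right_distrib matrix_vector_mult_scaleR)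
            moreover have "\<xi> \<bullet> y = e" unfolding y using xi(1)[OF w] xi(2) by (simp add: inner_add_right)
            moreover have "y + e *\<^sub>R (g *v x - x) = w + e *\<^sub>R (g *v x)"
              unfolding y by (simp only: scaleR_diff_right) simp
            moreover have "(mat 1 + outer (g *v x - x) \<xi>) *v y = y + (\<xi> \<bullet> y) *\<^sub>R (g *v x - x)"
              by (simp only: matrix_vector_mult_add_rdistrib matrix_vector_mul_lid outer_mult_vec)
            ultimately show ?thesis by (simp only:)
          qed
          then have eq: "g = mat 1 + outer (g *v x - x) \<xi>" unfolding matrix_eq by blast
          have "det g = 1 + \<xi> \<bullet> (g *v x - x)" by (rule HOL.trans[OF arg_cong[OF eq, of det] det_id_plus_outer])
          also have "\<dots> = c" using xi u' by (simp add: gx inner_diff_right inner_add_right)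
          finally show ?thesis using detg c1 by simp
        next
          case False
          then obtain y where y: "y \<notin> span (insert x U)" by blast
          have xy: "x \<notin> span (insert y U)"
          proof
            assume "x \<in> span (insert y U)"
            then obtain w e where w: "w \<in> U" "x = w + e *\<^sub>R y" unfolding span_insert_subspace[OF U] by blast
            then have "e \<noteq> 0" using x by auto
            then have "y = (- (1 / e)) *\<^sub>R w + (1 / e) *\<^sub>R x" using w(2) by (simp add: algebra_simps)
            moreover have "(- (1 / e)) *\<^sub>R w \<in> U" using U w(1) subspace_scale by blast
            ultimately show False using y unfolding span_insert_subspace[OF U] by blast
          qed
          obtain \<alpha> where al: "\<And>u. u \<in> span (insert y U) \<Longrightarrow> \<alpha> \<bullet> u = 0" "\<alpha> \<bullet> x = 1"
            using orthogonal_functional[OF subspace_span xy] by blast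
          have ay: "\<alpha> \<bullet> y = 0" by (intro al(1) span_base) simp
          have au: "\<alpha> \<bullet> u = 0" if "u \<in> U" for u using that by (intro al(1) span_base) simp
          \<comment> \<open>A preliminary transvection moves g x by c y, out of the span of U and x,
            so that \<open>caseA\<close> becomes applicable. Invertibility of g gives that c is
            nonzero.\<close>
          define g1 where "g1 = (mat 1 + outer y \<alpha>) ** g"
          have g1x: "g1 *v x = c *\<^sub>R x + u' + c *\<^sub>R y"
            using al(2) au[OF u'] by (simp add: g1_def matrix_act gx scaleR_add_right)
          have c0: "c \<noteq> 0"
          proof
            assume "c = 0"
            then have "g *v (x - u') = 0" using gx fixU[OF u'] by (simp add: matrix_vector_mult_diff_distrib)
            moreover have "invertible g" using detg by (simp add: invertible_det_nz)
            ultimately have "x - u' = 0" by (metis invertible_def matrix_left_invertible_ker)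
            then show False using x u' by simp
          qed
          have "x \<notin> span (insert (x - g1 *v x) U)"
          proof
            assume "x \<in> span (insert (x - g1 *v x) U)"
            then obtain w e where w: "w \<in> U" "x = w + e *\<^sub>R (x - g1 *v x)" unfolding span_insert_subspace[OF U] by blast
            then have e0: "e \<noteq> 0" using x by auto
            have "(e * c) *\<^sub>R y = (w - e *\<^sub>R u') + (e - e * c - 1) *\<^sub>R x"
              using w(2) unfolding g1x by (simp add: algebra_simps)
            then have "(1 / (e * c)) *\<^sub>R ((e * c) *\<^sub>R y) = (1 / (e * c)) *\<^sub>R ((w - e *\<^sub>R u') + (e - e * c - 1) *\<^sub>R x)" by simp
            then have "y = (1 / (e * c)) *\<^sub>R (w - e *\<^sub>R u') + ((1 / (e * c)) * (e - e * c - 1)) *\<^sub>R x"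
              using e0 c0 by (simp add: scaleR_add_right)
            moreover have "(1 / (e * c)) *\<^sub>R (w - e *\<^sub>R u') \<in> U" using U w(1) u' by (simp add: subspace_scale subspace_diff)
            ultimately show False using y unfolding span_insert_subspace[OF U] by blast
          qed
          moreover have "g1 *v u = u" if "u \<in> U" for u using that by (simp add: g1_def matrix_act fixU au)
          moreover have "det g1 = 1" using detg ay by (simp add: g1_def det_mul det_id_plus_outer)
          ultimately have "g1 \<in> T" using caseA[of g1 x] x by blast
          then show ?thesis using inv[OF ay] unfolding g1_def by blast
        qed
      qed
    qed
  qed
  show ?thesis by (rule main[of "{0}"]) (use det in auto)
qed

lemma preserves_form_iff: "preserves_form B g \<longleftrightarrow> (\<forall>x y. (g *v x) \<bullet> (B *v (g *v y)) = x \<bullet> (B *v y))"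
  unfolding preserves_form_def matrix_eq_inner
  by (simp only: matrix_vector_mul_assoc[symmetric] inner_matrix_transpose[symmetric])
   
definition form_refl :: "real^'n^'n \<Rightarrow> real^'n \<Rightarrow> real^'n^'n" where
  "form_refl B x = refl_mat ((2 / (x \<bullet> (B *v x))) *\<^sub>R (B *v x)) x"

text \<open>The Cartan--Dieudonne theorem without its bound on the number of reflections.\<close>
lemma orth_generated_by_reflections:
  fixes T :: "(real^'n^'n) set"
  assumes sym: "transpose B = B" and nondeg: "\<And>x. B *v x = 0 \<Longrightarrow> x = 0"
    and one: "mat 1 \<in> T" and mult: "\<And>g h. g \<in> T \<Longrightarrow> h \<in> T \<Longrightarrow> g ** h \<in> T"
    and refl: "\<And>x. x \<bullet> (B *v x) \<noteq> 0 \<Longrightarrow> form_refl B x \<in> T"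
    and g: "preserves_form B g"
  shows "g \<in> T"
proof -
  define F where "F x y = x \<bullet> (B *v y)" for x y
  have F_sym: "F x y = F y x" for x y using sym unfolding symmetric_matrix_iff F_def by blast
  have F_lin: "F (x + y) z = F x z + F y z" "F z (x + y) = F z x + F z y" "F (x - y) z = F x z - F y z"
    "F z (x - y) = F z x - F z y" "F (c *\<^sub>R x) z = c * F x z" "F z (c *\<^sub>R x) = c * F z x" for x y z c
    by (simp_all add: F_def matrix_act inner_add_left inner_diff_left)
  have r_act: "form_refl B e *v y = y - (2 * F e y / F e e) *\<^sub>R e" for e y
    using F_sym[of y e] by (simp add: form_refl_def refl_mat_mult_vec F_def inner_commute)
  have r_F: "F (form_refl B e *v y) (form_refl B e *v z) = F y z" if "F e e \<noteq> 0" for e y z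
    using that F_sym[of y e] unfolding r_act by (simp add: F_lin field_simps)
  have r_sq: "form_refl B e ** form_refl B e = mat 1" if "F e e \<noteq> 0" for e
    unfolding form_refl_def by (rule refl_mat_square) (use that in \<open>simp add: F_def inner_commute\<close>)
  \<comment> \<open>The condition on projections says that U together with its F-orthogonal
    complement is the whole space; it replaces nondegeneracy of F on U and survives adjoining an
    anisotropic vector orthogonal to U.\<close>
  have main: "g \<in> T" if "subspace U" "\<And>u. u \<in> U \<Longrightarrow> g *v u = u" "\<And>x y. F (g *v x) (g *v y) = F x y"
    "\<And>x. \<exists>u\<in>U. \<forall>w\<in>U. F (x - u) w = 0" "CARD('n) - dim U = k" for U g k
    using that
  proof (induction k arbitrary: U g rule: less_induct)
    case (less k)
    note U = less.prems(1) and fixU = less.prems(2) and gF = less.prems(3) and proj = less.prems(4)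
    show ?case
    proof (cases "U = UNIV")
      case True
      then have "g = mat 1" using fixU by (simp add: matrix_eq)
      then show ?thesis using one by simp
    next
      case False
      then obtain x0 where x0: "x0 \<notin> U" by blast
      obtain u0 where u0: "u0 \<in> U" "\<forall>w\<in>U. F (x0 - u0) w = 0" using proj by blast
      define y where "y = x0 - u0"
      have y: "y \<noteq> 0" "\<And>w. w \<in> U \<Longrightarrow> F y w = 0" using x0 u0 by (auto simp: y_def)
      \<comment> \<open>An anisotropic vector orthogonal to U: if y is isotropic, take z' orthogonal
        to U with F(z', y) nonzero; then z' or z' + y is anisotropic.\<close>
      obtain x where x: "F x x \<noteq> 0" "\<And>w. w \<in> U \<Longrightarrow> F x w = 0"
      proof (cases "F y y = 0")
        case False
        then show thesis using that y by blast
      next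
        case True
        have "B *v y \<noteq> 0" using nondeg y(1) by blast
        then have "F (B *v y) y \<noteq> 0" by (simp add: F_def)
        then obtain z where z: "F z y \<noteq> 0" by blast
        obtain uz where uz: "uz \<in> U" "\<forall>w\<in>U. F (z - uz) w = 0" using proj by blast
        define z' where "z' = z - uz"
        have z'y: "F z' y \<noteq> 0" using z y(2)[OF uz(1)] F_sym[of uz y] by (simp add: z'_def F_lin)
        show thesis
        proof (cases "F z' z' = 0")
          case False
          then show thesis using that[of z'] uz by (simp add: z'_def)
        next
          case z0: True
          have "F (z' + y) (z' + y) = 2 * F z' y" using True z0 F_sym[of y z'] by (simp add: F_lin)
          then show thesis using that[of "z' + y"] z'y uz y by (simp add: F_lin z'_def)
        qed
      qed
      have xU: "x \<notin> U" using x by blast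
      define U' where "U' = span (insert x U)"
      have U': "U' = {u + c *\<^sub>R x | u c. u \<in> U}" unfolding U'_def by (rule span_insert_subspace[OF U])
      have proj': "\<exists>u\<in>U'. \<forall>w\<in>U'. F (p - u) w = 0" for p
      proof -
        obtain u where u: "u \<in> U" "\<forall>w\<in>U. F (p - u) w = 0" using proj by blast
        define c where "c = F p x / F x x"
        have "F u x = 0" using x(2)[OF u(1)] F_sym by simp
        then have "F (p - (u + c *\<^sub>R x)) x = 0" using x(1) by (simp add: F_lin c_def)
        moreover have "F (p - (u + c *\<^sub>R x)) w = 0" if "w \<in> U" for w
          using u(2) x(2)[OF that] that by (simp add: F_lin diff_eq_eq)
        ultimately have "\<forall>w\<in>U'. F (p - (u + c *\<^sub>R x)) w = 0" unfolding U' by (auto simp: F_lin(2,6))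
        moreover have "u + c *\<^sub>R x \<in> U'" unfolding U' using u(1) by blast
        ultimately show ?thesis by blast
      qed
      have "dim U < dim U'" unfolding U'_def by (rule dim_span_insert_less[OF U xU])
      moreover have "dim U' \<le> CARD('n)" using dim_subset_UNIV_cart by blast
      ultimately have smaller: "CARD('n) - dim U' < k" using less.prems(5) by linarith
      have step: "h \<in> T" if "\<And>u. u \<in> U \<Longrightarrow> h *v u = u" "h *v x = x" "\<And>x y. F (h *v x) (h *v y) = F x y" for h
      proof -
        have "h *v u = u" if "u \<in> U'" for u
          using that \<open>\<And>u. u \<in> U \<Longrightarrow> h *v u = u\<close> \<open>h *v x = x\<close>
          unfolding U' by (auto simp: matrix_vector_right_distrib matrix_vector_mult_scaleR)
        moreover have "subspace U'" by (simp add: U'_def)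
        ultimately show ?thesis using less.IH[OF smaller, of U' h] that(3) proj' by blast
      qed
      define x' where "x' = g *v x"
      have x'x': "F x' x' = F x x" by (simp add: x'_def gF)
      have x'U: "F x' w = 0" if "w \<in> U" for w
        using gF[of x w] fixU[OF that] x(2)[OF that] by (simp add: x'_def)
      show ?thesis
      \<comment> \<open>The values of the form at x' - x and x' + x add up to 4 F(x, x), so one of
        the two vectors is anisotropic. Reflecting in x' - x takes x' to x; reflecting in x' + x
        takes it to -x, and the reflection in x corrects the sign.\<close>
      proof (cases "F (x' - x) (x' - x) = 0")
        case False
        define e where "e = x' - x"
        have ee: "F e e \<noteq> 0" using False by (simp add: e_def)
        have "F e e = 2 * F e x'" using x'x' F_sym[of x x'] by (simp add: e_def F_lin)
        then have "2 * F e x' / F e e = 1" using ee by simp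
        then have "form_refl B e *v x' = x" by (simp add: r_act) (simp add: e_def)
        moreover have "form_refl B e *v u = u" if "u \<in> U" for u
          using x(2)[OF that] x'U[OF that] by (simp add: r_act e_def F_lin)
        ultimately have "form_refl B e ** g \<in> T"
          by (intro step) (simp_all add: matrix_vector_mul_assoc[symmetric] fixU x'_def[symmetric] r_F[OF ee] gF)
        then have "form_refl B e ** (form_refl B e ** g) \<in> T" using mult refl ee by (simp add: F_def)
        then show ?thesis by (simp add: matrix_mul_assoc r_sq[OF ee])
      next
        case True
        define e where "e = x' + x"
        have "F e e + F (x' - x) (x' - x) = 4 * F x x" using x'x' F_sym[of x x'] by (simp add: e_def F_lin)
        then have ee: "F e e \<noteq> 0" using x(1) True by simp
        have "F e e = 2 * F e x'" using x'x' F_sym[of x x'] by (simp add: e_def F_lin)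
        then have "2 * F e x' / F e e = 1" using ee by simp
        then have "form_refl B e *v x' = - x" by (simp add: r_act) (simp add: e_def)
        moreover have "form_refl B x *v (- x) = x" using x(1) F_lin(6)[of x "-1" x] by (simp add: r_act scaleR_2)
        moreover have "form_refl B e *v u = u" "form_refl B x *v u = u" if "u \<in> U" for u
          using x(2)[OF that] x'U[OF that] by (simp_all add: r_act e_def F_lin)
        ultimately have "form_refl B x ** form_refl B e ** g \<in> T"
          by (intro step) (simp_all add: matrix_vector_mul_assoc[symmetric] fixU x'_def[symmetric] r_F[OF ee] r_F[OF x(1)] gF)
        then have "form_refl B e ** (form_refl B x ** (form_refl B x ** form_refl B e ** g)) \<in> T"
          using mult refl ee x(1) by (simp add: F_def)
        moreover have "form_refl B e ** (form_refl B x ** (form_refl B x ** form_refl B e ** g))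
          = form_refl B e ** ((form_refl B x ** form_refl B x) ** form_refl B e) ** g"
          by (simp add: matrix_mul_assoc)
        ultimately show ?thesis by (simp add: r_sq[OF ee] r_sq[OF x(1)])
      qed
    qed
  qed
  show ?thesis
  proof (rule main[of "{0}"])
    show "F (g *v x) (g *v y) = F x y" for x y using g unfolding preserves_form_iff F_def by blast
    show "\<exists>u\<in>{0}. \<forall>w\<in>{0}. F (x - u) w = 0" for x by (simp add: F_def)
  qed auto
qed

section \<open>Integration of elements of the Lie algebra\<close>

text \<open>The square of x \<otimes> \<xi> is zero, so its one-parameter group is affine in t and
  has denominator 1.\<close>

lemma transvection_in_closure:
  fixes \<Gamma> :: "(real^'n^'n) set"
  assumes one: "mat 1 \<in> \<Gamma>" and X: "outer x \<xi> \<in> lie_deg d \<Gamma>" and orth: "\<xi> \<bullet> x = 0"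
  shows "mat 1 + outer x \<xi> \<in> closure_deg d \<Gamma>"
proof -
  define N where "N i j = [:(mat 1 :: real^'n^'n) $ i $ j, outer x \<xi> $ i $ j:]" for i j
  have curve: "rational_curve [:1:] N = (\<lambda>t. mat 1 + t *\<^sub>R outer x \<xi>)"
    by (rule ext) (simp add: rational_curve_def N_def vec_eq_iff)
  have sq: "outer x \<xi> ** outer x \<xi> = 0"
    unfolding matrix_eq using orth by (simp add: matrix_act)
  have "rational_curve [:1:] N 1 \<in> closure_deg d \<Gamma>"
  proof (rule rational_curve_in_closure[OF X])
    show "rational_curve [:1:] N 0 \<in> closure_deg d \<Gamma>"
      unfolding curve using one closure_deg_superset by auto
    have "((\<lambda>t. mat 1 + t *\<^sub>R outer x \<xi>) has_vector_derivative 0 + (t *\<^sub>R 0 + 1 *\<^sub>R outer x \<xi>)) (at t)" for t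
      by (rule has_vector_derivative_add[OF has_vector_derivative_const
            has_vector_derivative_scaleR[OF DERIV_ident has_vector_derivative_const]])
    then show "(rational_curve [:1:] N has_vector_derivative (1 / poly [:1:] t) *\<^sub>R
        (rational_curve [:1:] N t ** outer x \<xi>)) (at t)" for t
      unfolding curve by (simp add: matrix_distrib sq)
  qed simp_all
  then show ?thesis unfolding curve by simp
qed

text \<open>Along the line u(t) = v + t (y - v), the element \<open>wedge B (u t) z\<close> with z =
  y - v does not depend on t. So the reflections in u(t) integrate one fixed element, at speed 2 /
  q(t). Crossing isotropic vectors, where q vanishes, is harmless, since the closure argument is
  algebraic; the form may thus have opposite signs at v and y.\<close>

lemma form_refl_in_closure:
  fixes \<Gamma> :: "(real^'n^'n) set"
  assumes sym: "transpose B = B" and v: "v \<bullet> (B *v v) \<noteq> 0" and y: "y \<bullet> (B *v y) \<noteq> 0"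
    and start: "form_refl B v \<in> closure_deg d \<Gamma>" and X: "wedge B v y \<in> lie_deg d \<Gamma>"
  shows "form_refl B y \<in> closure_deg d \<Gamma>"
proof -
  note symD = sym[unfolded symmetric_matrix_iff, rule_format]
  define z where "z = y - v"
  define u where "u t = v + t *\<^sub>R z" for t
  define q where "q = [:v \<bullet> (B *v v), 2 * (v \<bullet> (B *v z)), z \<bullet> (B *v z):]"
  have q: "poly q t = u t \<bullet> (B *v u t)" for t
    using symD[of z v] by (simp add: q_def u_def matrix_act inner_add_left algebra_simps)
  define N where "N i j = smult ((mat 1 :: real^'n^'n) $ i $ j) q
     - smult 2 [:v $ i * (B *v v) $ j, v $ i * (B *v z) $ j + z $ i * (B *v v) $ j, z $ i * (B *v z) $ j:]" for i j
  have curve: "rational_curve q N t = mat 1 - (2 / poly q t) *\<^sub>R outer (u t) (B *v u t)" if "poly q t \<noteq> 0" for t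
    unfolding rational_curve_def using that
    by (simp add: vec_eq_iff N_def outer_def u_def matrix_act field_simps)
  have refl_curve: "rational_curve q N t = form_refl B (u t)" if "poly q t \<noteq> 0" for t
    unfolding curve[OF that] form_refl_def refl_mat_def q by (simp add: outer_linear)
  have Xz: "wedge B v y = wedge B (u t) z" for t
    by (simp add: wedge_def u_def z_def matrix_act outer_linear algebra_simps)
  have "rational_curve q N 1 \<in> closure_deg d \<Gamma>"
  proof (rule rational_curve_in_closure[OF X, where c = 2])
    show q0: "poly q 0 \<noteq> 0" using v by (simp add: q_def)
    show "rational_curve q N 0 \<in> closure_deg d \<Gamma>"
      unfolding refl_curve[OF q0] using start by (simp add: u_def)
    show "poly q 1 \<noteq> 0" unfolding q using y by (simp add: u_def z_def)
    fix t assume qt: "poly q t \<noteq> 0"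
    define k where "k = 2 * (z \<bullet> (B *v u t))"
    have q': "(poly q has_real_derivative k) (at t)"
    proof -
      have "poly (pderiv q) t = k"
        using symD[of z v] by (simp add: q_def pderiv_pCons k_def u_def matrix_act algebra_simps)
      then show ?thesis using poly_DERIV by metis
    qed
    have inv_q: "((\<lambda>t. 2 / poly q t) has_real_derivative - (2 * k) / (poly q t)\<^sup>2) (at t)"
      using DERIV_divide[OF DERIV_const q' qt, of 2] by (simp add: power2_eq_square)
    have outer_u: "outer (u s) (B *v u s) = outer v (B *v v) + s *\<^sub>R (outer v (B *v z) + outer z (B *v v)) + (s * s) *\<^sub>R outer z (B *v z)" for s
      by (simp add: u_def matrix_act outer_linear algebra_simps)
    have "((\<lambda>s. outer v (B *v v) + s *\<^sub>R (outer v (B *v z) + outer z (B *v v)) + (s * s) *\<^sub>R outer z (B *v z))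
        has_vector_derivative 0 + (t *\<^sub>R 0 + 1 *\<^sub>R (outer v (B *v z) + outer z (B *v v))) + ((t * t) *\<^sub>R 0 + (1 * t + 1 * t) *\<^sub>R outer z (B *v z))) (at t)"
      by (rule has_vector_derivative_add[OF has_vector_derivative_add[OF has_vector_derivative_const
              has_vector_derivative_scaleR[OF DERIV_ident has_vector_derivative_const]]
              has_vector_derivative_scaleR[OF DERIV_mult[OF DERIV_ident DERIV_ident] has_vector_derivative_const]])
    moreover have "0 + (t *\<^sub>R 0 + 1 *\<^sub>R (outer v (B *v z) + outer z (B *v v))) + ((t * t) *\<^sub>R 0 + (1 * t + 1 * t) *\<^sub>R outer z (B *v z))
       = outer (u t) (B *v z) + outer z (B *v u t)"
      by (simp add: u_def matrix_act outer_linear vec_eq_iff algebra_simps)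
    ultimately have du: "((\<lambda>s. outer (u s) (B *v u s)) has_vector_derivative outer (u t) (B *v z) + outer z (B *v u t)) (at t)"
      unfolding outer_u by simp
    have "((\<lambda>s. mat 1 - (2 / poly q s) *\<^sub>R outer (u s) (B *v u s)) has_vector_derivative
       0 - ((2 / poly q t) *\<^sub>R (outer (u t) (B *v z) + outer z (B *v u t)) + (- (2 * k) / (poly q t)\<^sup>2) *\<^sub>R outer (u t) (B *v u t))) (at t)"
      by (rule has_vector_derivative_diff[OF has_vector_derivative_const has_vector_derivative_scaleR[OF inv_q du]])
    moreover have "0 - ((2 / poly q t) *\<^sub>R (outer (u t) (B *v z) + outer z (B *v u t)) + (- (2 * k) / (poly q t)\<^sup>2) *\<^sub>R outer (u t) (B *v u t))
      = (2 / poly q t) *\<^sub>R (rational_curve q N t ** wedge B v y)"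
    proof -
      have RX: "rational_curve q N t ** wedge B v y
         = (k / poly q t) *\<^sub>R outer (u t) (B *v u t) - (outer (u t) (B *v z) + outer z (B *v u t))"
      proof -
        have "(mat 1 - (2 / poly q t) *\<^sub>R outer (u t) (B *v u t)) *v (wedge B (u t) z *v x)
          = ((k / poly q t) *\<^sub>R outer (u t) (B *v u t) - (outer (u t) (B *v z) + outer z (B *v u t))) *v x" for x
        proof -
          have 1: "(B *v u t) \<bullet> u t = poly q t" "(B *v u t) \<bullet> z = k / 2" by (simp_all add: q k_def inner_commute)
          show ?thesis
            using qt by (simp add: wedge_def matrix_act 1) (simp add: vec_eq_iff field_simps)
        qed
        then show ?thesis unfolding matrix_eq curve[OF qt] Xz[of t] by (simp add: matrix_vector_mul_assoc[symmetric])
      qed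
      show ?thesis unfolding RX using qt by (simp add: vec_eq_iff field_simps power2_eq_square)
    qed
    ultimately have "((\<lambda>s. mat 1 - (2 / poly q s) *\<^sub>R outer (u s) (B *v u s)) has_vector_derivative
       (2 / poly q t) *\<^sub>R (rational_curve q N t ** wedge B v y)) (at t)" by simp
    moreover have "\<forall>\<^sub>F s in at t. mat 1 - (2 / poly q s) *\<^sub>R outer (u s) (B *v u s) = rational_curve q N s"
    proof -
      have "open {x. poly q x \<noteq> 0}" by (intro open_Collect_neq continuous_intros)
      then have "\<forall>\<^sub>F x in nhds t. poly q x \<noteq> 0" using qt eventually_nhds by blast
      then have "\<forall>\<^sub>F x in at t. poly q x \<noteq> 0" by (simp add: eventually_nhds_conv_at)
      then show ?thesis by eventually_elim (simp add: curve)
    qed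
    ultimately show "(rational_curve q N has_vector_derivative (2 / poly q t) *\<^sub>R (rational_curve q N t ** wedge B v y)) (at t)"
      unfolding has_vector_derivative_def
      by (rule has_derivative_transform_eventually) (simp_all add: curve[OF qt])
  qed
  moreover have "poly q 1 \<noteq> 0" unfolding q using y by (simp add: u_def z_def)
  ultimately show ?thesis by (simp add: refl_curve u_def z_def)
qed

section \<open>The dichotomy in each degree\<close>

context reflection_group
begin

definition monomial :: bool where
  "monomial \<longleftrightarrow> (\<exists>b. finite b \<and> 0 \<notin> b \<and> span b = UNIV \<and>
    (\<forall>(a, v) \<in> roots. \<forall>x\<in>b. \<exists>y\<in>b. \<exists>c. refl_mat a v *v x = c *\<^sub>R y))"

text \<open>Only finitely many p are bad: the zeros of the relevant \<open>cheb\<close> values, 0,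
  and 4. A scalar X has trace zero, hence vanishes, and X = 0 forces p = 4 unless p = 0.\<close>

lemma lie_deg_nonscalar:
  assumes "infinite pairings"
  obtains X where "X \<in> lie_deg d \<Gamma>" "\<And>c. \<exists>x. X *v x \<noteq> c *\<^sub>R x"
proof -
  define bad where "bad = {0, 4} \<union> {p. \<exists>k. 0 < k \<and> k \<le> 2 * d \<and> cheb p k = 0}
    \<union> {p. \<exists>k\<le>2 * d. cheb p (Suc k) + cheb p k = 0}"
  have "finite bad" unfolding bad_def using finite_cheb_zeros finite_cheb_zeros2 by simp
  then obtain p where p: "p \<in> pairings" "p \<notin> bad" using assms by (meson finite_subset subsetI)
  then obtain a v b w where r: "(a, v) \<in> roots" "(b, w) \<in> roots" and pe: "p = (a \<bullet> w) * (b \<bullet> v)"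
    unfolding pairings_def by blast
  define X where "X = (a \<bullet> w) *\<^sub>R outer v b - (b \<bullet> v) *\<^sub>R outer w a"
  have X: "X \<in> lie_deg d \<Gamma>"
    unfolding X_def by (rule pencil_velocity[OF r pe]) (use p(2) in \<open>auto simp: bad_def\<close>)
  have "\<exists>x. X *v x \<noteq> c *\<^sub>R x" for c
  proof (rule ccontr)
    assume "\<not> ?thesis"
    then have "X = c *\<^sub>R mat 1" unfolding matrix_eq by (simp add: scaleR_matrix_vector_assoc[symmetric])
    moreover have "trace X = 0" using X by (simp add: lie_deg_def)
    ultimately have "X = 0" by (simp add: trace_scaleR trace_I)
    then have "X *v v = 0" by simp
    then have e: "(b \<bullet> v) *\<^sub>R ((a \<bullet> w) *\<^sub>R v - 2 *\<^sub>R w) = 0"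
      using rootsD(1)[OF r(1)] by (simp add: X_def matrix_act algebra_simps)
    have "b \<bullet> v \<noteq> 0" using p(2) pe by (auto simp: bad_def)
    then have "b \<bullet> ((a \<bullet> w) *\<^sub>R v - 2 *\<^sub>R w) = 0" using e by (metis inner_zero_right scaleR_eq_0_iff)
    then have "p = 4" using rootsD(1)[OF r(2)] by (simp add: pe inner_diff_right)
    then show False using p(2) by (simp add: bad_def)
  qed
  then show thesis using that X by blast
qed

lemma lie_deg_refl_conj:
  "(a, v) \<in> roots \<Longrightarrow> X \<in> lie_deg d \<Gamma> \<Longrightarrow> refl_mat a v ** X ** refl_mat a v \<in> lie_deg d \<Gamma>"
  by (rule lie_deg_conj) (auto intro: mult simp: rootsD refl_mat_square)

definition root_form :: "real^'n^'n \<Rightarrow> bool" where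
  "root_form B \<longleftrightarrow> transpose B = B \<and> (\<forall>x. B *v x = 0 \<longrightarrow> x = 0) \<and>
     (\<forall>(a, v) \<in> roots. v \<bullet> (B *v v) \<noteq> 0 \<and> form_refl B v = refl_mat a v)"

text \<open>The form is built from one reflection. Any other reflection yields an L-invariant form
  as well, proportional to the first by uniqueness; so every reflection in \<Gamma> is the
  orthogonal reflection of the same form.\<close>

lemma lie_deg_dichotomy:
  assumes inf: "infinite pairings" and nm: "\<not> monomial"
  shows "(\<forall>x \<xi>. \<xi> \<bullet> x = 0 \<longrightarrow> outer x \<xi> \<in> lie_deg d \<Gamma>) \<or>
    (\<exists>B. root_form B \<and> (\<forall>x y. wedge B x y \<in> lie_deg d \<Gamma>))"
proof -
  obtain X0 where X0: "X0 \<in> lie_deg d \<Gamma>" "\<And>c. \<exists>x. X0 *v x \<noteq> c *\<^sub>R x"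
    using lie_deg_nonscalar[OF inf] by blast
  have irr: "U = {0} \<or> U = UNIV" if "subspace U" "\<forall>X\<in>lie_deg d \<Gamma>. \<forall>x\<in>U. X *v x \<in> U" for U
    using reducible_imp_monomial[OF lie_deg_refl_conj that _ _ X0] nm unfolding monomial_def by blast
  have lr: "lie_reflection (lie_deg d \<Gamma>) a v" if "(a, v) \<in> roots" for a v
  proof (rule lie_reflection.intro)
    show "refl_mat a v ** X ** refl_mat a v \<in> lie_deg d \<Gamma>" if "X \<in> lie_deg d \<Gamma>" for X
      by (rule lie_deg_refl_conj) fact+
    show "a \<bullet> v = 2" using that by (rule rootsD)
  qed (fact subspace_lie_deg, fact lie_deg_bracket, fact irr)
  have tr: "trace X = 0" if "X \<in> lie_deg d \<Gamma>" for X using that by (simp add: lie_deg_def)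
  obtain a v where r: "(a, v) \<in> roots" using roots_nonempty by auto
  interpret lie_reflection "lie_deg d \<Gamma>" a v by (rule lr[OF r])
  show ?thesis
  proof (cases full)
    case True
    then show ?thesis unfolding full_def by blast
  next
    case False
    obtain B where B: "transpose B = B" "\<forall>x. B *v x = 0 \<longrightarrow> x = 0" "\<forall>x y. wedge B x y \<in> lie_deg d \<Gamma>"
      "\<forall>C. transpose C = C \<longrightarrow> lie_invariant (lie_deg d \<Gamma>) C \<longrightarrow> (\<exists>c. C = c *\<^sub>R B)"
      using form_exists[OF False tr] by blast
    have "v' \<bullet> (B *v v') \<noteq> 0 \<and> form_refl B v' = refl_mat a' v'" if r': "(a', v') \<in> roots" for a' v'
    proof -
      interpret R: lie_reflection "lie_deg d \<Gamma>" a' v' by (rule lr[OF r'])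
      \<comment> \<open>Fullness depends on the Lie algebra only, so it fails at the other root
        too.\<close>
      have "\<not> R.full" using False unfolding full_def R.full_def .
      then obtain C where C: "transpose C = C" "C *v v' = - a'" "lie_invariant (lie_deg d \<Gamma>) C"
        using R.form_exists[OF _ tr] by blast
      then obtain c where "C = c *\<^sub>R B" using B(4) by blast
      then have c: "c *\<^sub>R (B *v v') = - a'" using C(2) by (simp add: scaleR_matrix_vector_assoc)
      then have c0: "c \<noteq> 0" using R.a_nz by auto
      have "c * (v' \<bullet> (B *v v')) = - 2" using arg_cong[OF c, of "\<lambda>x. v' \<bullet> x"] R.va by simp
      then have vB: "v' \<bullet> (B *v v') = - 2 / c" using c0 by (simp add: field_simps)
      have "(2 / (v' \<bullet> (B *v v'))) *\<^sub>R (B *v v') = - (c *\<^sub>R (B *v v'))" using c0 by (simp add: vB)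
      then have "(2 / (v' \<bullet> (B *v v'))) *\<^sub>R (B *v v') = a'" using c by simp
      then show ?thesis using vB c0 by (simp add: form_refl_def)
    qed
    then show ?thesis using B unfolding root_form_def by blast
  qed
qed

lemma closure_deg_dichotomy:
  assumes inf: "infinite pairings" and nm: "\<not> monomial"
  shows "(\<forall>g. det g = 1 \<longrightarrow> g \<in> closure_deg d \<Gamma>) \<or>
    (\<exists>B. root_form B \<and> (\<forall>g. preserves_form B g \<longrightarrow> g \<in> closure_deg d \<Gamma>))"
  using lie_deg_dichotomy[OF assms, of d]
proof
  assume full: "\<forall>x \<xi>. \<xi> \<bullet> x = 0 \<longrightarrow> outer x \<xi> \<in> lie_deg d \<Gamma>"
  have "g \<in> closure_deg d \<Gamma>" if "det g = 1" for g
  proof (rule SL_generated_by_transvections[OF _ _ _ that])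
    show "mat 1 \<in> closure_deg d \<Gamma>" using one closure_deg_superset by blast
    show "mat 1 + outer x \<xi> \<in> closure_deg d \<Gamma>" if "\<xi> \<bullet> x = 0" for x \<xi>
      using transvection_in_closure[OF one _ that] full that by blast
  qed (rule closure_deg_mult[OF mult])
  then show ?thesis by blast
next
  assume "\<exists>B. root_form B \<and> (\<forall>x y. wedge B x y \<in> lie_deg d \<Gamma>)"
  then obtain B where B: "root_form B" "\<And>x y. wedge B x y \<in> lie_deg d \<Gamma>" by blast
  obtain a v where r: "(a, v) \<in> roots" using roots_nonempty by auto
  have v: "v \<bullet> (B *v v) \<noteq> 0" "form_refl B v = refl_mat a v" and sym: "transpose B = B"
    and nd: "\<And>x. B *v x = 0 \<Longrightarrow> x = 0"
    using B(1) r unfolding root_form_def by auto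
  have start: "form_refl B v \<in> closure_deg d \<Gamma>"
    unfolding v(2) using rootsD(2)[OF r] closure_deg_superset by blast
  have "g \<in> closure_deg d \<Gamma>" if "preserves_form B g" for g
  proof (rule orth_generated_by_reflections[OF sym])
    show "x = 0" if "B *v x = 0" for x using nd that .
    show "preserves_form B g" by fact
    show "mat 1 \<in> closure_deg d \<Gamma>" using one closure_deg_superset by blast
    show "form_refl B x \<in> closure_deg d \<Gamma>" if "x \<bullet> (B *v x) \<noteq> 0" for x
      by (rule form_refl_in_closure[OF sym v(1) that start B(2)])
  qed (rule closure_deg_mult[OF mult])
  then show ?thesis using B(1) by blast
qed

lemma SL_pm_in_closure:
  assumes "\<And>g. det g = 1 \<Longrightarrow> g \<in> closure_deg d \<Gamma>" and g: "det g = 1 \<or> det g = - 1"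
  shows "g \<in> closure_deg d \<Gamma>"
proof (cases "det g = 1")
  case False
  obtain a v where r: "(a, v) \<in> roots" using roots_nonempty by auto
  have "det (refl_mat a v ** g) = 1" using g False by (simp add: det_mul det_refl_mat rootsD(1)[OF r])
  then have "refl_mat a v ** g \<in> closure_deg d \<Gamma>" by (rule assms(1))
  moreover have "refl_mat a v \<in> closure_deg d \<Gamma>" using rootsD(2)[OF r] closure_deg_superset by blast
  ultimately have "refl_mat a v ** (refl_mat a v ** g) \<in> closure_deg d \<Gamma>"
    using closure_deg_mult[OF mult] by blast
  then show ?thesis by (simp add: matrix_mul_assoc refl_mat_square rootsD(1)[OF r])
qed (use assms(1) in blast)

lemma root_form_preserves:
  assumes "root_form B" "(a, v) \<in> roots" shows "preserves_form B (refl_mat a v)"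
proof -
  have B: "transpose B = B" "v \<bullet> (B *v v) \<noteq> 0" "form_refl B v = refl_mat a v"
    using assms unfolding root_form_def by auto
  have s: "x \<bullet> (B *v v) = (B *v v) \<bullet> x" "v \<bullet> (B *v x) = (B *v v) \<bullet> x" for x
    using B(1)[unfolded symmetric_matrix_iff, rule_format, of v x] by (simp_all add: inner_commute)
  show ?thesis
    unfolding preserves_form_iff B(3)[symmetric] form_refl_def using B(2)
    by (simp add: refl_mat_mult_vec matrix_act inner_diff_left s field_simps)
qed

text \<open>Invariance under one reflection makes both C v and B v multiples of its covector. So C
  and a multiple of B agree at v, and the subspace where they agree is invariant under all
  reflections.\<close>

lemma root_form_unique:
  assumes B: "root_form B"
    and C: "\<And>a v. (a, v) \<in> roots \<Longrightarrow> preserves_form C (refl_mat a v)" "transpose C = C"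
  shows "\<exists>c. C = c *\<^sub>R B"
proof -
  have swap: "D *v (refl_mat a v *v x) = refl_mat v a *v (D *v x)"
    if "(a, v) \<in> roots" "preserves_form D (refl_mat a v)" for a v D x
  proof -
    have "refl_mat v a ** D ** refl_mat a v = D"
      using that(2) unfolding preserves_form_def transpose_refl_mat .
    then have "refl_mat v a ** D = refl_mat v a ** (refl_mat v a ** D ** refl_mat a v)" by simp
    also have "\<dots> = (refl_mat v a ** refl_mat v a) ** D ** refl_mat a v" by (simp add: matrix_mul_assoc)
    also have "\<dots> = D ** refl_mat a v"
      using rootsD(1)[OF that(1)] by (simp add: refl_mat_square inner_commute)
    finally show ?thesis by (simp add: matrix_vector_mul_assoc)
  qed
  note pB = root_form_preserves[OF B]
  obtain a v where r: "(a, v) \<in> roots" using roots_nonempty by auto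
  have line: "D *v v = ((v \<bullet> (D *v v)) / 2) *\<^sub>R a" if "preserves_form D (refl_mat a v)" for D
  proof -
    have "refl_mat a v *v v = - v" using rootsD(1)[OF r] by (simp add: refl_mat_mult_vec scaleR_2)
    moreover have "D *v (- v) = - (D *v v)" using matrix_vector_mult_scaleR[of D "-1" v] by simp
    ultimately have "- (D *v v) = refl_mat v a *v (D *v v)"
      using swap[OF r that, of v] by simp
    then have h: "- (D *v v) = D *v v - (v \<bullet> (D *v v)) *\<^sub>R a"
      unfolding refl_mat_mult_vec .
    have "(2 *\<^sub>R (D *v v)) $ i = ((v \<bullet> (D *v v)) *\<^sub>R a) $ i" for i
      using arg_cong[OF h, of "\<lambda>x. x $ i"] by simp
    then have "2 *\<^sub>R (D *v v) = (v \<bullet> (D *v v)) *\<^sub>R a" unfolding vec_eq_iff by blast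
    then have "(1/2) *\<^sub>R (2 *\<^sub>R (D *v v)) = (1/2) *\<^sub>R ((v \<bullet> (D *v v)) *\<^sub>R a)" by simp
    then show ?thesis by simp
  qed
  define c where "c = (v \<bullet> (C *v v)) / (v \<bullet> (B *v v))"
  have vB: "v \<bullet> (B *v v) \<noteq> 0" using B r unfolding root_form_def by auto
  define U where "U = {x. C *v x = c *\<^sub>R (B *v x)}"
  have sU: "subspace U" unfolding U_def
    by (intro subspaceI) (auto simp: matrix_vector_right_distrib matrix_vector_mult_scaleR scaleR_add_right)
  have "v \<in> U"
  proof -
    have "c *\<^sub>R (B *v v) = (c * ((v \<bullet> (B *v v)) / 2)) *\<^sub>R a"
      by (subst line[OF pB[OF r]]) simp
    also have "c * ((v \<bullet> (B *v v)) / 2) = (v \<bullet> (C *v v)) / 2" using vB by (simp add: c_def)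
    also have "\<dots> *\<^sub>R a = C *v v" by (rule line[OF C(1)[OF r], symmetric])
    finally show ?thesis by (simp add: U_def)
  qed
  moreover have "x - (a' \<bullet> x) *\<^sub>R v' \<in> U" if r': "(a', v') \<in> roots" and x: "x \<in> U" for a' v' x
  proof -
    have "C *v (refl_mat a' v' *v x) = refl_mat v' a' *v (C *v x)" by (rule swap[OF r' C(1)[OF r']])
    also have "\<dots> = c *\<^sub>R (refl_mat v' a' *v (B *v x))" using x by (simp add: U_def matrix_vector_mult_scaleR)
    also have "\<dots> = c *\<^sub>R (B *v (refl_mat a' v' *v x))" by (simp only: swap[OF r' pB[OF r']])
    finally show ?thesis by (simp add: U_def refl_mat_mult_vec)
  qed
  ultimately have "U = UNIV" using irreducible[OF sU] nonzero_root(2)[OF r] by blast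
  then have "C = c *\<^sub>R B" unfolding matrix_eq by (auto simp: U_def scaleR_matrix_vector_assoc)
  then show ?thesis by blast
qed

text \<open>Schur's lemma over the reals: commuting with v \<otimes> a makes v an eigenvector, and
  its eigenspace is invariant under the reflections.\<close>

lemma commuting_is_scalar:
  assumes comm: "\<And>a v. (a, v) \<in> roots \<Longrightarrow> g ** outer v a = outer v a ** g"
  shows "\<exists>c. g = c *\<^sub>R mat 1"
proof -
  obtain a v where r: "(a, v) \<in> roots" using roots_nonempty by auto
  have eq: "(a' \<bullet> x) *\<^sub>R (g *v v') = (a' \<bullet> (g *v x)) *\<^sub>R v'" if "(a', v') \<in> roots" for a' v' x
    using arg_cong[OF comm[OF that], of "\<lambda>M. M *v x"]
    by (simp add: matrix_vector_mul_assoc[symmetric] matrix_vector_mult_scaleR)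
  define c where "c = (a \<bullet> (g *v v)) / 2"
  have "(1/2) *\<^sub>R ((a \<bullet> v) *\<^sub>R (g *v v)) = (1/2) *\<^sub>R ((a \<bullet> (g *v v)) *\<^sub>R v)" using eq[OF r, of v] by simp
  then have gv: "g *v v = c *\<^sub>R v" using rootsD(1)[OF r] by (simp add: c_def)
  define U where "U = {x. g *v x = c *\<^sub>R x}"
  have sU: "subspace U" unfolding U_def
    by (intro subspaceI) (auto simp: matrix_vector_right_distrib matrix_vector_mult_scaleR scaleR_add_right)
  have "x - (a' \<bullet> x) *\<^sub>R v' \<in> U" if r': "(a', v') \<in> roots" and x: "x \<in> U" for a' v' x
  proof -
    have "g *v (x - (a' \<bullet> x) *\<^sub>R v') = g *v x - (a' \<bullet> (g *v x)) *\<^sub>R v'"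
      using eq[OF r', of x] by (simp add: matrix_vector_mult_diff_distrib matrix_vector_mult_scaleR)
    then show ?thesis using x by (simp add: U_def scaleR_diff_right mult.commute)
  qed
  then have "U = UNIV" using irreducible[OF sU] nonzero_root(2)[OF r] gv unfolding U_def by blast
  then have "g = c *\<^sub>R mat 1" unfolding matrix_eq by (auto simp: U_def scaleR_matrix_vector_assoc[symmetric])
  then show ?thesis by blast
qed

end

section \<open>The Zariski closure\<close>

text \<open>Each fibre of f lies in one right coset of H, so finitely many values leave finitely
  many cosets; f need not be a homomorphism.\<close>

lemma virtually_abelianI:
  fixes W (structure)
  assumes "group W" and H: "subgroup H W" and ab: "\<And>x y. x \<in> H \<Longrightarrow> y \<in> H \<Longrightarrow> x \<otimes> y = y \<otimes> x"
    and fin: "finite (f ` carrier W)"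
    and f: "\<And>x y. x \<in> carrier W \<Longrightarrow> y \<in> carrier W \<Longrightarrow> f x = f y \<Longrightarrow> x \<otimes> inv y \<in> H"
  shows "virtually_abelian W"
proof -
  interpret group W by fact
  define c where "c k = H #> (SOME x. x \<in> carrier W \<and> f x = k)" for k
  have "H #> x = c (f x)" if x: "x \<in> carrier W" for x
  proof -
    define y where "y = (SOME y. y \<in> carrier W \<and> f y = f x)"
    have y: "y \<in> carrier W" "f y = f x"
      using someI[of "\<lambda>y. y \<in> carrier W \<and> f y = f x" x] x unfolding y_def by auto
    have "y = (y \<otimes> inv x) \<otimes> x" using x y by (simp add: m_assoc)
    then have "y \<in> H #> x" unfolding r_coset_def using f[OF y(1) x y(2)] by blast
    then show ?thesis unfolding c_def y_def[symmetric] using repr_independence[OF _ x H] by blast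
  qed
  then have "rcosets H \<subseteq> c ` f ` carrier W" unfolding RCOSETS_def by auto
  then have "finite (rcosets H)" using fin finite_subset by blast
  then show ?thesis unfolding virtually_abelian_def using H ab by blast
qed

lemma mat_poly_sum: "finite J \<Longrightarrow> (\<And>j. j \<in> J \<Longrightarrow> f j \<in> mat_poly) \<Longrightarrow> (\<lambda>A. \<Sum>j\<in>J. f j A) \<in> mat_poly"
  by (induction J rule: finite_induct) (auto intro: mat_poly.intros)

lemma mat_poly_prod: "finite J \<Longrightarrow> (\<And>j. j \<in> J \<Longrightarrow> f j \<in> mat_poly) \<Longrightarrow> (\<lambda>A. \<Prod>j\<in>J. f j A) \<in> mat_poly"
  by (induction J rule: finite_induct) (auto intro: mat_poly.intros)

lemma det_mat_poly: "(\<lambda>A::real^'n^'n. det A) \<in> mat_poly"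
  unfolding det_def by (intro mat_poly_sum mat_poly.mult mat_poly.const mat_poly_prod mat_poly.coord) (simp_all add: finite_permutations)

lemma zariski_closure_GL_subset_orth_group:
  assumes "\<And>g. g \<in> G \<Longrightarrow> preserves_form B g"
  shows "zariski_closure_GL G \<subseteq> orth_group (B :: real^'n^'n)"
proof
  fix g assume g: "g \<in> zariski_closure_GL G"
  have "(transpose g ** B ** g) $ i $ j = B $ i $ j" for i j
  proof -
    define p where "p A = (\<Sum>k\<in>UNIV. (\<Sum>l\<in>UNIV. A $ l $ i * B $ l $ k) * A $ k $ j) + - (B $ i $ j)" for A :: "real^'n^'n"
    have p: "p A = (transpose A ** B ** A) $ i $ j - B $ i $ j" for A
      by (simp add: p_def matrix_matrix_mult_def transpose_def)
    have "p \<in> mat_poly" unfolding p_def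
      by (intro mat_poly.add mat_poly.mult mat_poly_sum mat_poly.coord mat_poly.const finite)
    moreover have "\<forall>h\<in>G. p h = 0" using assms by (simp add: p preserves_form_def)
    ultimately have "p g = 0" using g unfolding zariski_closure_GL_def by blast
    then show ?thesis by (simp add: p)
  qed
  then have "transpose g ** B ** g = B" by (simp add: vec_eq_iff)
  then show "g \<in> orth_group B" using g by (simp add: orth_group_def preserves_form_def zariski_closure_GL_def)
qed

lemma zariski_closure_GL_subset_SL_pm:
  assumes "\<And>g. g \<in> G \<Longrightarrow> det g = 1 \<or> det g = - 1"
  shows "zariski_closure_GL G \<subseteq> (SL_pm :: (real^'n^'n) set)"
proof
  fix g :: "real^'n^'n" assume g: "g \<in> zariski_closure_GL G"
  define p where "p A = det A * det A + - 1" for A :: "real^'n^'n"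
  have "p \<in> mat_poly" unfolding p_def by (intro mat_poly.add mat_poly.mult det_mat_poly mat_poly.const)
  moreover have "\<forall>h\<in>G. p h = 0"
  proof
    fix h assume "h \<in> G"
    from assms[OF this] show "p h = 0" by (elim disjE) (simp_all add: p_def)
  qed
  ultimately have "p g = 0" using g unfolding zariski_closure_GL_def by blast
  then have "(det g - 1) * (det g + 1) = 0" by (simp add: p_def algebra_simps)
  then have "det g = 1 \<or> det g = - 1" by (auto simp: eq_neg_iff_add_eq_0)
  then show "g \<in> SL_pm" using g by (simp add: SL_pm_def zariski_closure_GL_def)
qed

lemma preserves_form_mult: "preserves_form B g \<Longrightarrow> preserves_form B h \<Longrightarrow> preserves_form B (g ** h)"
  unfolding preserves_form_iff by (simp add: matrix_vector_mul_assoc[symmetric])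

section \<open>The image of the Coxeter group\<close>

locale irreducible_coxeter_reflections = coxeter_reflections W S m gen \<rho> \<alpha> v x0
  for W (structure) and S :: "'s set" and m :: "'s \<Rightarrow> 's \<Rightarrow> enat" and gen :: "'s \<Rightarrow> 'a"
    and \<rho> :: "'a \<Rightarrow> real^'n^'n" and \<alpha> v :: "'s \<Rightarrow> real^'n" and x0 :: "real^'n" +
  assumes irr: "irreducible_rep W \<rho>" and not_va: "\<not> virtually_abelian W"
begin

lemma word_induct:
  assumes "w \<in> carrier W" "P \<one>" "\<And>s x. s \<in> S \<Longrightarrow> x \<in> carrier W \<Longrightarrow> P x \<Longrightarrow> P (gen s \<otimes> x)"
  shows "P w"
proof -
  obtain u where u: "set u \<subseteq> S" "val u = w" using val_surj[OF assms(1)] .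
  have "P (val u)" using u(1) by (induction u) (simp_all add: assms(2,3))
  then show ?thesis using u by simp
qed

abbreviation "Rt \<equiv> {(a, v). a \<bullet> v = 2 \<and> refl_mat a v \<in> \<rho> ` carrier W}"

lemma simple_root: "s \<in> S \<Longrightarrow> (\<alpha> s, v s) \<in> Rt"
  using pairing \<rho>_gen gen_closed by (auto intro!: image_eqI[of _ _ "gen s"])

lemma \<rho>_inv: "x \<in> carrier W \<Longrightarrow> \<rho> (inv x) ** \<rho> x = mat 1" "x \<in> carrier W \<Longrightarrow> \<rho> x ** \<rho> (inv x) = mat 1"
  using \<rho>_mult[of "inv x" x] \<rho>_mult[of x "inv x"] \<rho>_one by simp_all

lemma S_nonempty: "S \<noteq> {}"
proof
  assume S: "S = {}"
  have "x = \<one>" if "x \<in> carrier W" for x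
    using that by (rule word_induct) (simp_all add: S)
  then have c: "carrier W = {\<one>}" by auto
  have "virtually_abelian W"
  proof (rule virtually_abelianI[OF is_group subgroup_self])
    show "finite ((\<lambda>_. ()) ` carrier W)" by simp
    show "x \<otimes> y = y \<otimes> x" if "x \<in> carrier W" "y \<in> carrier W" for x y using that unfolding c by simp
    show "x \<otimes> inv y \<in> carrier W" if "x \<in> carrier W" "y \<in> carrier W" for x y using that by simp
  qed
  then show False using not_va by blast
qed

sublocale R: reflection_group "\<rho> ` carrier W" Rt
proof -
  show "reflection_group (\<rho> ` carrier W)"
  proof
  show "mat 1 \<in> \<rho> ` carrier W" using \<rho>_one by (metis image_eqI one_closed)
  show "g ** h \<in> \<rho> ` carrier W" if "g \<in> \<rho> ` carrier W" "h \<in> \<rho> ` carrier W" for g h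
    using that by (auto simp: \<rho>_mult[symmetric])
  show "Rt \<noteq> {}" using S_nonempty simple_root by blast
  fix U assume U: "subspace U" and inv: "\<And>a v x. (a, v) \<in> Rt \<Longrightarrow> x \<in> U \<Longrightarrow> x - (a \<bullet> x) *\<^sub>R v \<in> U"
  have "\<forall>x\<in>U. \<rho> g *v x \<in> U" if "g \<in> carrier W" for g
  proof (rule word_induct[OF that])
    show "\<forall>x\<in>U. \<rho> \<one> *v x \<in> U" by (simp add: \<rho>_one)
    show "\<forall>x\<in>U. \<rho> (gen s \<otimes> y) *v x \<in> U" if "s \<in> S" "y \<in> carrier W" "\<forall>x\<in>U. \<rho> y *v x \<in> U" for s y
      using that inv[OF simple_root[OF that(1)]]
      by (simp add: \<rho>_mult gen_closed \<rho>_gen matrix_vector_mul_assoc[symmetric] refl_mat_mult_vec)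
  qed
  then show "U = {0} \<or> U = UNIV" using irr U unfolding irreducible_rep_def by blast
  qed
qed (rule reflexive)

text \<open>Finitely many pairings leave finitely many matrices w \<otimes> b, which the group
  permutes by conjugation. Elements acting in the same way differ by a matrix commuting with all of
  them, a scalar; by faithfulness the scalar elements commute in W.\<close>

lemma infinite_pairings: "infinite R.pairings"
proof
  assume fin_p: "finite R.pairings"
  define Y where "Y = {outer w b | b w. (b, w) \<in> Rt}"
  have fY: "finite Y" unfolding Y_def by (rule R.finite_reflections[OF fin_p])
  \<comment> \<open>Conjugating with the inverse on the left makes equal values of f at x and y say
    that x times the inverse of y commutes with Y, as right cosets require.\<close>
  define f where "f x = (\<lambda>y\<in>Y. \<rho> (inv x) ** y ** \<rho> x)" for x
  define H where "H = {x \<in> carrier W. \<exists>c. \<rho> x = c *\<^sub>R mat 1}"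
  have "\<rho> (inv x) ** y ** \<rho> x \<in> Y" if x: "x \<in> carrier W" and y: "y \<in> Y" for x y
  proof -
    obtain b w where bw: "y = outer w b" "b \<bullet> w = 2" and "refl_mat b w \<in> \<rho> ` carrier W"
      using y unfolding Y_def by blast
    then obtain g where g: "g \<in> carrier W" "refl_mat b w = \<rho> g" by blast
    have "(b v* \<rho> x) \<bullet> (\<rho> (inv x) *v w) = b \<bullet> ((\<rho> x ** \<rho> (inv x)) *v w)"
      by (simp add: dot_lmul_matrix matrix_vector_mul_assoc)
    then have 1: "(b v* \<rho> x) \<bullet> (\<rho> (inv x) *v w) = 2" using bw by (simp add: \<rho>_inv x)
    have e: "\<rho> (inv x) ** outer w b ** \<rho> x = outer (\<rho> (inv x) *v w) (b v* \<rho> x)"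
      by (simp add: matrix_mult_outer outer_matrix_mult)
    have "refl_mat (b v* \<rho> x) (\<rho> (inv x) *v w) = \<rho> (inv x) ** \<rho> g ** \<rho> x"
      unfolding g(2)[symmetric] refl_mat_def e[symmetric] by (simp add: matrix_distrib \<rho>_inv x)
    also have "\<dots> = \<rho> (inv x \<otimes> g \<otimes> x)" using x g by (simp add: \<rho>_mult)
    finally have "refl_mat (b v* \<rho> x) (\<rho> (inv x) *v w) \<in> \<rho> ` carrier W" using x g by blast
    then show ?thesis unfolding bw(1) e Y_def using 1 by blast
  qed
  then have "f ` carrier W \<subseteq> PiE Y (\<lambda>_. Y)" by (auto simp: f_def)
  then have fin: "finite (f ` carrier W)" using finite_PiE[OF fY, of "\<lambda>_. Y"] fY finite_subset by blast
  have "virtually_abelian W"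
  proof (rule virtually_abelianI[OF is_group _ _ fin])
    show "subgroup H W"
    proof (rule subgroupI)
      show "H \<subseteq> carrier W" by (auto simp: H_def)
      have "\<one> \<in> H" unfolding H_def \<rho>_one by (auto simp: \<rho>_one intro: exI[of _ 1])
      then show "H \<noteq> {}" by blast
      show "inv x \<in> H" if "x \<in> H" for x
      proof -
        obtain c where x: "x \<in> carrier W" and c: "\<rho> x = c *\<^sub>R mat 1" using \<open>x \<in> H\<close> unfolding H_def by blast
        have "c *\<^sub>R \<rho> (inv x) = (mat 1 :: real^'n^'n)" using \<rho>_inv(1)[OF x] by (simp add: c matrix_distrib)
        \<comment> \<open>\<open>undefined\<close> serves as an arbitrary index; the diagonal entry
          of the identity there is 1.\<close>
        moreover from arg_cong[OF this, of "\<lambda>M. M $ undefined $ undefined"] have "c \<noteq> 0"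
          by (auto simp: mat_def)
        ultimately have "\<rho> (inv x) = (1 / c) *\<^sub>R mat 1" by (simp add: eq_vector_fraction_iff)
        then show ?thesis using x unfolding H_def by blast
      qed
      show "x \<otimes> y \<in> H" if "x \<in> H" "y \<in> H" for x y
      proof -
        obtain c e where "x \<in> carrier W" "y \<in> carrier W" "\<rho> x = c *\<^sub>R mat 1" "\<rho> y = e *\<^sub>R mat 1"
          using \<open>x \<in> H\<close> \<open>y \<in> H\<close> unfolding H_def by blast
        then show ?thesis unfolding H_def by (auto simp: \<rho>_mult matrix_distrib)
      qed
    qed
    show "x \<otimes> y = y \<otimes> x" if "x \<in> H" "y \<in> H" for x y
    proof -
      have xy: "x \<in> carrier W" "y \<in> carrier W" using that by (auto simp: H_def)
      have "\<rho> (x \<otimes> y) = \<rho> (y \<otimes> x)" using that by (auto simp: H_def \<rho>_mult matrix_distrib)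
      then show ?thesis using \<rho>_inj xy by (simp add: inj_on_eq_iff)
    qed
    show "x \<otimes> inv y \<in> H" if x: "x \<in> carrier W" and y: "y \<in> carrier W" and "f x = f y" for x y
    proof -
      have "\<rho> (x \<otimes> inv y) ** z = z ** \<rho> (x \<otimes> inv y)" if z: "z \<in> Y" for z
      proof -
        have "\<rho> (inv x) ** z ** \<rho> x = \<rho> (inv y) ** z ** \<rho> y"
          using fun_cong[OF \<open>f x = f y\<close>, of z] z by (simp add: f_def)
        then have "\<rho> x ** (\<rho> (inv x) ** z ** \<rho> x) ** \<rho> (inv y) = \<rho> x ** (\<rho> (inv y) ** z ** \<rho> y) ** \<rho> (inv y)" by simp
        moreover have "\<rho> x ** (\<rho> (inv x) ** z ** \<rho> x) ** \<rho> (inv y) = (\<rho> x ** \<rho> (inv x)) ** z ** (\<rho> x ** \<rho> (inv y))"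
          "\<rho> x ** (\<rho> (inv y) ** z ** \<rho> y) ** \<rho> (inv y) = (\<rho> x ** \<rho> (inv y)) ** z ** (\<rho> y ** \<rho> (inv y))"
          by (simp_all add: matrix_mul_assoc)
        ultimately show ?thesis using x y by (simp add: \<rho>_inv \<rho>_mult)
      qed
      then have "\<exists>c. \<rho> (x \<otimes> inv y) = c *\<^sub>R mat 1"
        by (intro R.commuting_is_scalar) (auto simp: Y_def)
      then show ?thesis using x y by (simp add: H_def)
    qed
  qed
  then show False using not_va by blast
qed

text \<open>The group permutes the finitely many lines spanned by b. Elements preserving every line
  are simultaneously diagonal, hence commute, and faithfulness makes W virtually abelian.\<close>

lemma not_monomial: "\<not> R.monomial"
proof
  assume "R.monomial"
  then obtain b where b: "finite b" "0 \<notin> b" "span b = UNIV"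
    and lines: "\<forall>(a, v)\<in>Rt. \<forall>x\<in>b. \<exists>y\<in>b. \<exists>c. refl_mat a v *v x = c *\<^sub>R y"
    unfolding R.monomial_def by (elim exE conjE) (rule that)
  have perm0: "\<exists>y\<in>b. \<exists>c. refl_mat a v *v x = c *\<^sub>R y" if "(a, v) \<in> Rt" "x \<in> b" for a v x
    using bspec[OF lines that(1)] that(2) by simp
  have perm: "\<forall>x\<in>b. \<exists>y\<in>b. \<exists>c. \<rho> g *v x = c *\<^sub>R y" if "g \<in> carrier W" for g
  proof (rule word_induct[OF that])
    show "\<forall>x\<in>b. \<exists>y\<in>b. \<exists>c. \<rho> \<one> *v x = c *\<^sub>R y"
      unfolding \<rho>_one matrix_vector_mul_lid by (metis scaleR_one)
    fix s g assume s: "s \<in> S" and g: "g \<in> carrier W" and IH: "\<forall>x\<in>b. \<exists>y\<in>b. \<exists>c. \<rho> g *v x = c *\<^sub>R y"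
    show "\<forall>x\<in>b. \<exists>y\<in>b. \<exists>c. \<rho> (gen s \<otimes> g) *v x = c *\<^sub>R y"
    proof
      fix x assume "x \<in> b"
      then obtain y c where y: "y \<in> b" "\<rho> g *v x = c *\<^sub>R y" using IH by blast
      obtain z e where z: "z \<in> b" "refl_mat (\<alpha> s) (v s) *v y = e *\<^sub>R z" using perm0[OF simple_root[OF s] y(1)] by blast
      have "\<rho> (gen s \<otimes> g) *v x = (c * e) *\<^sub>R z"
        using y z s g by (simp add: \<rho>_mult gen_closed \<rho>_gen matrix_vector_mul_assoc[symmetric] matrix_vector_mult_scaleR)
      then show "\<exists>y\<in>b. \<exists>c. \<rho> (gen s \<otimes> g) *v x = c *\<^sub>R y" using z(1) by blast
    qed
  qed
  have cancel: "\<rho> (inv g) *v (\<rho> g *v x) = x" "\<rho> g *v (\<rho> (inv g) *v x) = x" if "g \<in> carrier W" for g x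
    by (simp_all add: matrix_vector_mul_assoc \<rho>_inv that)
  \<comment> \<open>The line to which the inverse of g takes that of x. If f agrees at g and h, then
    g times the inverse of h preserves every line, whatever representatives were chosen.\<close>
  define f where "f g = (\<lambda>x\<in>b. SOME y. y \<in> b \<and> (\<exists>c. \<rho> (inv g) *v x = c *\<^sub>R y))" for g
  have f: "f g x \<in> b \<and> (\<exists>c. \<rho> (inv g) *v x = c *\<^sub>R f g x)" if "g \<in> carrier W" "x \<in> b" for g x
  proof -
    have "\<exists>y. y \<in> b \<and> (\<exists>c. \<rho> (inv g) *v x = c *\<^sub>R y)" using perm[of "inv g"] that by blast
    from someI_ex[OF this] show ?thesis using that(2) by (simp add: f_def)
  qed
  have "f ` carrier W \<subseteq> PiE b (\<lambda>_. b)"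
  proof
    fix k assume "k \<in> f ` carrier W"
    then obtain g where g: "g \<in> carrier W" "k = f g" by blast
    show "k \<in> PiE b (\<lambda>_. b)"
      unfolding g(2) by (rule PiE_I) (use f[OF g(1)] in blast, simp add: f_def)
  qed
  then have fin: "finite (f ` carrier W)" using finite_PiE[OF b(1), of "\<lambda>_. b"] b(1) finite_subset by blast
  define H where "H = {g \<in> carrier W. \<forall>x\<in>b. \<exists>c. \<rho> g *v x = c *\<^sub>R x}"
  have nz: "c \<noteq> 0" if "g \<in> carrier W" "x \<in> b" "\<rho> g *v x = c *\<^sub>R y" for g x c y
    using cancel(1)[OF that(1), of x] that b(2) by auto
  have "virtually_abelian W"
  proof (rule virtually_abelianI[OF is_group _ _ fin])
    show "subgroup H W"
    proof (rule subgroupI)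
      show "H \<subseteq> carrier W" by (auto simp: H_def)
      have "\<one> \<in> H" unfolding H_def \<rho>_one by (auto simp: \<rho>_one intro: exI[of _ 1])
      then show "H \<noteq> {}" by blast
      show "inv g \<in> H" if g: "g \<in> H" for g
      proof -
        have gW: "g \<in> carrier W" using g by (simp add: H_def)
        have "\<exists>c. \<rho> (inv g) *v x = c *\<^sub>R x" if x: "x \<in> b" for x
        proof -
          obtain c where c: "\<rho> g *v x = c *\<^sub>R x" using g x unfolding H_def by blast
          have "x = c *\<^sub>R (\<rho> (inv g) *v x)"
            using cancel(1)[OF gW, of x] by (simp add: c matrix_vector_mult_scaleR)
          then have "(1 / c) *\<^sub>R x = (1 / c) *\<^sub>R (c *\<^sub>R (\<rho> (inv g) *v x))" by simp
          then have "\<rho> (inv g) *v x = (1 / c) *\<^sub>R x" using nz[OF gW x c] by simp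
          then show ?thesis by blast
        qed
        then show ?thesis using gW by (simp add: H_def)
      qed
      show "g \<otimes> h \<in> H" if gh: "g \<in> H" "h \<in> H" for g h
      proof -
        have W: "g \<in> carrier W" "h \<in> carrier W" using gh by (simp_all add: H_def)
        have "\<exists>c. \<rho> (g \<otimes> h) *v x = c *\<^sub>R x" if x: "x \<in> b" for x
        proof -
          obtain c d where "\<rho> g *v x = c *\<^sub>R x" "\<rho> h *v x = d *\<^sub>R x" using gh x unfolding H_def by blast
          then have "\<rho> (g \<otimes> h) *v x = (d * c) *\<^sub>R x"
            using W by (simp add: \<rho>_mult matrix_vector_mul_assoc[symmetric] matrix_vector_mult_scaleR)
          then show ?thesis by blast
        qed
        then show ?thesis using W by (simp add: H_def)
      qed
    qed
    show "g \<otimes> h = h \<otimes> g" if gh: "g \<in> H" "h \<in> H" for g h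
    proof -
      have W: "g \<in> carrier W" "h \<in> carrier W" using gh by (simp_all add: H_def)
      have "\<rho> (g \<otimes> h) *v x = \<rho> (h \<otimes> g) *v x" if x: "x \<in> b" for x
      proof -
        obtain c d where "\<rho> g *v x = c *\<^sub>R x" "\<rho> h *v x = d *\<^sub>R x" using gh x unfolding H_def by blast
        then show ?thesis
          using W by (simp add: \<rho>_mult matrix_vector_mul_assoc[symmetric] matrix_vector_mult_scaleR mult.commute)
      qed
      then have "\<rho> (g \<otimes> h) *v x = \<rho> (h \<otimes> g) *v x" if "x \<in> span b" for x
        using that linear_eq_on_span[OF matrix_vector_mul_linear matrix_vector_mul_linear] by blast
      then have "\<rho> (g \<otimes> h) = \<rho> (h \<otimes> g)" unfolding matrix_eq b(3) by blast
      then show ?thesis using \<rho>_inj W by (simp add: inj_on_eq_iff)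
    qed
    show "g \<otimes> inv h \<in> H" if W: "g \<in> carrier W" "h \<in> carrier W" and fgh: "f g = f h" for g h
    proof -
      have "\<exists>c. \<rho> (g \<otimes> inv h) *v x = c *\<^sub>R x" if x: "x \<in> b" for x
      proof -
        obtain c where c: "\<rho> (inv g) *v x = c *\<^sub>R f g x" using f[OF W(1) x] by blast
        obtain d where d: "\<rho> (inv h) *v x = d *\<^sub>R f g x" using f[OF W(2) x] fgh by auto
        have c0: "c \<noteq> 0" using nz[OF _ x c] W by simp
        have "x = c *\<^sub>R (\<rho> g *v f g x)" using cancel(2)[OF W(1), of x] by (simp add: c matrix_vector_mult_scaleR)
        then have "(1 / c) *\<^sub>R x = (1 / c) *\<^sub>R (c *\<^sub>R (\<rho> g *v f g x))" by simp
        then have "\<rho> g *v f g x = (1 / c) *\<^sub>R x" using c0 by simp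
        then have "\<rho> (g \<otimes> inv h) *v x = (d * (1 / c)) *\<^sub>R x"
          using W by (simp add: \<rho>_mult matrix_vector_mul_assoc[symmetric] d matrix_vector_mult_scaleR)
        then show ?thesis by blast
      qed
      then show ?thesis using W by (simp add: H_def)
    qed
  qed
  then show False using not_va by blast
qed

lemma det_\<rho>: "x \<in> carrier W \<Longrightarrow> det (\<rho> x) = 1 \<or> det (\<rho> x) = - 1"
  using val_surj det_\<rho>_val by (metis neg_one_even_power neg_one_odd_power)

lemma preserves_form_\<rho>:
  assumes "\<And>a v. (a, v) \<in> Rt \<Longrightarrow> preserves_form B (refl_mat a v)" "x \<in> carrier W"
  shows "preserves_form B (\<rho> x)"
proof (rule word_induct[OF assms(2)])
  show "preserves_form B (\<rho> \<one>)" by (simp add: \<rho>_one preserves_form_iff)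
  show "preserves_form B (\<rho> (gen s \<otimes> x))" if "s \<in> S" "x \<in> carrier W" "preserves_form B (\<rho> x)" for s x
    using preserves_form_mult[OF assms(1)[OF simple_root[OF that(1)]] that(3)] that
    by (simp add: \<rho>_mult gen_closed \<rho>_gen)
qed

text \<open>Both alternatives of the dichotomy are compatible with B. In the first one, the radical
  of B is invariant, so B is nondegenerate and its isometries have determinant 1 or -1; in the
  second one, B is a multiple of the form found.\<close>

lemma closure_with_form:
  assumes B: "B \<noteq> 0" "transpose B = B" "\<And>x. x \<in> carrier W \<Longrightarrow> preserves_form B (\<rho> x)"
  shows "zariski_closure_GL (\<rho> ` carrier W) = orth_group B"
proof
  show "zariski_closure_GL (\<rho> ` carrier W) \<subseteq> orth_group B"
    by (rule zariski_closure_GL_subset_orth_group) (use B in auto)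
  have pB: "preserves_form B (refl_mat a v)" if "(a, v) \<in> Rt" for a v using that B(3) by auto
  have "g \<in> closure_deg d (\<rho> ` carrier W)" if inv: "invertible g" and pg: "preserves_form B g" for g d
    using R.closure_deg_dichotomy[OF infinite_pairings not_monomial, of d]
  proof
    assume SL: "\<forall>g. det g = 1 \<longrightarrow> g \<in> closure_deg d (\<rho> ` carrier W)"
    define U where "U = {x. B *v x = 0}"
    have sU: "subspace U" unfolding U_def
      by (intro subspaceI) (auto simp: matrix_vector_right_distrib matrix_vector_mult_scaleR)
    have "x - (a \<bullet> x) *\<^sub>R v \<in> U" if r: "(a, v) \<in> Rt" and x: "x \<in> U" for a v x
    proof -
      have "(refl_mat a v *v y) \<bullet> (B *v (refl_mat a v *v x)) = 0" for y
        using pB[OF r] x unfolding preserves_form_iff U_def by simp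
      then have "y \<bullet> (B *v (refl_mat a v *v x)) = 0" for y
        using refl_mat_involutive[OF R.rootsD(1)[OF r], of y] by metis
      then have "B *v (refl_mat a v *v x) = 0" by (metis inner_eq_zero_iff)
      then show ?thesis by (simp add: U_def refl_mat_mult_vec)
    qed
    then have "U = {0} \<or> U = UNIV" by (rule R.irreducible[OF sU])
    moreover have "U \<noteq> UNIV" using B(1) unfolding U_def matrix_eq by auto
    ultimately have "B *v x = 0 \<Longrightarrow> x = 0" for x by (auto simp: U_def)
    then obtain B' where "B' ** B = mat 1" using matrix_left_invertible_ker[of B] by blast
    then have "det B' * det B = 1" by (metis det_I det_mul)
    then have "det B \<noteq> 0" by auto
    moreover have "det g * det B * det g = det B"
      using pg unfolding preserves_form_def by (metis det_mul det_transpose)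
    ultimately have "(det g - 1) * (det g + 1) = 0" by (simp add: algebra_simps)
    then have "det g = 1 \<or> det g = - 1" by (auto simp: eq_neg_iff_add_eq_0)
    then show ?thesis by (rule R.SL_pm_in_closure[rotated]) (use SL in blast)
  next
    assume "\<exists>F. R.root_form F \<and> (\<forall>g. preserves_form F g \<longrightarrow> g \<in> closure_deg d (\<rho> ` carrier W))"
    then obtain F where F: "R.root_form F" "\<And>g. preserves_form F g \<Longrightarrow> g \<in> closure_deg d (\<rho> ` carrier W)" by blast
    obtain c where c: "B = c *\<^sub>R F" using R.root_form_unique[OF F(1) pB B(2)] by blast
    then have "c \<noteq> 0" using B(1) by auto
    then have "preserves_form F g" using pg unfolding c preserves_form_def by (simp add: matrix_distrib)
    then show ?thesis by (rule F(2))
  qed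
  then show "orth_group B \<subseteq> zariski_closure_GL (\<rho> ` carrier W)"
    unfolding orth_group_def zariski_closure_GL_eq by blast
qed

text \<open>A form from the second alternative would be nonzero and preserved by the group, so the
  first alternative holds for every d.\<close>

lemma closure_without_form:
  assumes "\<not> (\<exists>B :: real^'n^'n. B \<noteq> 0 \<and> transpose B = B \<and> (\<forall>x\<in>carrier W. preserves_form B (\<rho> x)))"
  shows "zariski_closure_GL (\<rho> ` carrier W) = SL_pm"
proof
  show "zariski_closure_GL (\<rho> ` carrier W) \<subseteq> SL_pm"
    by (rule zariski_closure_GL_subset_SL_pm) (use det_\<rho> in auto)
  have "g \<in> closure_deg d (\<rho> ` carrier W)" if "det g = 1 \<or> det g = - 1" for g d
  proof (rule R.SL_pm_in_closure[OF _ that])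
    have "\<not> R.root_form F" for F
    proof
      assume F: "R.root_form F"
      then have "transpose F = F" unfolding R.root_form_def by blast
      moreover have "F \<noteq> 0"
      proof
        assume "F = 0"
        obtain s where "s \<in> S" using S_nonempty by blast
        then have "v s \<bullet> (F *v v s) \<noteq> 0" using F simple_root unfolding R.root_form_def by blast
        then show False using \<open>F = 0\<close> by simp
      qed
      ultimately show False
        using assms preserves_form_\<rho>[OF R.root_form_preserves[OF F]] by blast
    qed
    then show "g \<in> closure_deg d (\<rho> ` carrier W)" if "det g = 1" for g
      using R.closure_deg_dichotomy[OF infinite_pairings not_monomial, of d] that by blast
  qed
  then show "SL_pm \<subseteq> zariski_closure_GL (\<rho> ` carrier W)"
    unfolding SL_pm_def zariski_closure_GL_eq by blast
qed

end

theorem theorem1p1: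
  fixes W :: "('w, 'z) monoid_scheme" and S :: "'s set" and m :: "'s \<Rightarrow> 's \<Rightarrow> enat"
    and gen :: "'s \<Rightarrow> 'w" and \<rho> :: "'w \<Rightarrow> real^'n^'n"
  assumes "coxeter_group W S m gen"
    and "\<not> virtually_abelian W"
    and "reflection_rep W S m gen \<rho>"
    and "irreducible_rep W \<rho>"
  shows "(\<forall>B :: real^'n^'n. B \<noteq> 0 \<and> transpose B = B \<and> (\<forall>g\<in>carrier W. preserves_form B (\<rho> g))
            \<longrightarrow> zariski_closure_GL (\<rho> ` carrier W) = orth_group B)
     \<and> ((\<not> (\<exists>B :: real^'n^'n. B \<noteq> 0 \<and> transpose B = B \<and> (\<forall>g\<in>carrier W. preserves_form B (\<rho> g))))
            \<longrightarrow> zariski_closure_GL (\<rho> ` carrier W) = SL_pm)"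
proof -
  obtain \<alpha> v :: "'s \<Rightarrow> real^'n" where av: "\<forall>s\<in>S. \<alpha> s \<bullet> v s = 2"
    "\<forall>s\<in>S. \<forall>x. \<rho> (gen s) *v x = x - (\<alpha> s \<bullet> x) *\<^sub>R v s"
    "compatible_cartan S m (\<lambda>s t. \<alpha> s \<bullet> v t)" "interior {x. \<forall>s\<in>S. \<alpha> s \<bullet> x \<le> 0} \<noteq> {}"
    using assms(3) unfolding reflection_rep_def by blast
  obtain x0 where "x0 \<in> interior {x. \<forall>s\<in>S. \<alpha> s \<bullet> x \<le> 0}" using av(4) by blast
  then obtain e where e: "e > 0" "ball x0 e \<subseteq> {x. \<forall>s\<in>S. \<alpha> s \<bullet> x \<le> 0}" using mem_interior by blast
  have neg: "\<alpha> s \<bullet> x0 < 0" if s: "s \<in> S" for s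
  proof -
    have nz: "norm (\<alpha> s) > 0" using av(1) s by auto
    \<comment> \<open>A step of length e / 2 in the direction \<alpha>_s stays in the ball and
      increases \<alpha>_s, so its value at the centre is strictly negative.\<close>
    define k where "k = e / (2 * norm (\<alpha> s))"
    have k: "k > 0" using e nz by (simp add: k_def)
    have "x0 + k *\<^sub>R \<alpha> s \<in> ball x0 e" using e(1) nz by (simp add: dist_norm k_def)
    then have "\<alpha> s \<bullet> (x0 + k *\<^sub>R \<alpha> s) \<le> 0" using e(2) s by blast
    moreover have "k * (\<alpha> s \<bullet> \<alpha> s) > 0" using k nz by simp
    ultimately show ?thesis by (simp add: inner_add_right)
  qed
  interpret group W using assms(1) unfolding coxeter_group_def by blast
  interpret irreducible_coxeter_reflections W S m gen \<rho> \<alpha> v x0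
  proof
    show "coxeter_matrix S m" "generate W (gen ` S) = carrier W"
      using assms(1) unfolding coxeter_group_def by blast+
    show "gen s \<in> carrier W" if "s \<in> S" for s using assms(1) that unfolding coxeter_group_def by blast
    show "word_val W gen (alt_word s t k) = \<one>\<^bsub>W\<^esub>" if "s \<in> S" "t \<in> S" "m s t = enat k" for s t k
      using assms(1) that unfolding coxeter_group_def coxeter_relators_def by blast
    show "\<rho> \<in> hom W GL" using assms(3) unfolding reflection_rep_def by blast
    show "\<rho> (gen s) = refl_mat (\<alpha> s) (v s)" if "s \<in> S" for s
      using av(2) that unfolding matrix_eq refl_mat_mult_vec by blast
  qed (use av neg assms in auto)
  show ?thesis using closure_with_form closure_without_form by blast
qed

end
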